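(* If $\alpha\in(0,1)$ is irrational of bounded type, then $$\lim_{\lambda\to 0^+}\dim_H(\sigma_{\lambda,\alpha})=1 .$$
   Context: Let $S^1=\mathbb R/\mathbb Z$. For $\lambda>0$, $\alpha$ irrational and $\omega\in S^1$, let $H_{\lambda,\alpha,\omega}:\ell^2(\mathbb Z)\to\ell^2(\mathbb Z)$ be the bounded self-adjoint operator $$[H_{\lambda,\alpha,\omega}u](n)=u(n+1)+u(n-1)+\lambda\,\chi_{[1-\alpha,1)}(R_\alpha^n(\omega))\,u(n),$$ where $R_\alpha(\omega)=\omega+\alpha \pmod 1$ and $\chi_{[1-\alpha,1)}$ is the indicator function of $[1-\alpha,1)\subset S^1$ (with $S^1$ identified with $[0,1)$). The spectrum of $H_{\lambda,\alpha,\omega}$ does not depend on $\omega$; it is denoted $\sigma_{\lambda,\alpha}\subset\mathbb R$. An irrational $\alpha\in(0,1)$ with continued fraction expansion $\alpha=[a_1,a_2,\dots]=\cfrac{1}{a_1+\cfrac{1}{a_2+\cdots}}$, $a_k\in\mathbb N=\{1,2,\dots\}$, is of bounded type if only finitely many different values occur among the $a_k$. $\dim_H$ is Hausdorff dimension. *)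

theory Defs
  imports "HOL-Analysis.Analysis"
begin

section \<open>The Hilbert space of square-summable two-sided sequences\<close>

definition ell2 :: "(int \<Rightarrow> complex) set" where
  "ell2 = {u. (\<lambda>n. (cmod (u n))\<^sup>2) summable_on UNIV}"

definition ell2_norm :: "(int \<Rightarrow> complex) \<Rightarrow> real" where
  "ell2_norm u = sqrt (\<Sum>\<^sub>\<infinity>n. (cmod (u n))\<^sup>2)"

text \<open>An operator is a function on all sequences, of which only the restriction to
  \<^const>\<open>ell2\<close> matters.\<close>

definition bounded_operator :: "((int \<Rightarrow> complex) \<Rightarrow> (int \<Rightarrow> complex)) \<Rightarrow> bool" where
  "bounded_operator T \<longleftrightarrow>
     (\<forall>u\<in>ell2. T u \<in> ell2) \<and>
     (\<forall>u\<in>ell2. \<forall>v\<in>ell2. T (\<lambda>n. u n + v n) = (\<lambda>n. T u n + T v n)) \<and>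
     (\<forall>c. \<forall>u\<in>ell2. T (\<lambda>n. c * u n) = (\<lambda>n. c * T u n)) \<and>
     (\<exists>K. \<forall>u\<in>ell2. ell2_norm (T u) \<le> K * ell2_norm u)"

definition spectrum :: "((int \<Rightarrow> complex) \<Rightarrow> (int \<Rightarrow> complex)) \<Rightarrow> complex set" where
  "spectrum T = {z. \<not> (\<exists>B. bounded_operator B \<and>
     (\<forall>u\<in>ell2. B (\<lambda>n. T u n - z * u n) = u) \<and>
     (\<forall>u\<in>ell2. (\<lambda>n. T (B u) n - z * B u n) = u))}"

section \<open>The Sturmian Hamiltonian\<close>

text \<open>The circle is identified with \<open>[0, 1)\<close>, so that the \<open>n\<close>-th iterate of the rotation
  by \<open>\<alpha>\<close> maps \<open>\<omega>\<close> to \<open>frac (\<omega> + n \<alpha>)\<close>; this depends only on the class of \<open>\<omega>\<close> modulo 1.\<close>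

definition sturmian_hamiltonian ::
    "real \<Rightarrow> real \<Rightarrow> real \<Rightarrow> (int \<Rightarrow> complex) \<Rightarrow> (int \<Rightarrow> complex)" where
  "sturmian_hamiltonian lam \<alpha> \<omega> u = (\<lambda>n. u (n + 1) + u (n - 1) +
     complex_of_real (lam * indicator {1 - \<alpha>..<1} (frac (\<omega> + of_int n * \<alpha>))) * u n)"

text \<open>The operator is self-adjoint, so its spectrum consists of real numbers; here it is
  taken as a subset of the real line.\<close>

definition sturmian_spectrum :: "real \<Rightarrow> real \<Rightarrow> real \<Rightarrow> real set" where
  "sturmian_spectrum lam \<alpha> \<omega> =
     {E. complex_of_real E \<in> spectrum (sturmian_hamiltonian lam \<alpha> \<omega>)}"

section \<open>Continued fractions and bounded type\<close>

fun finite_cfrac :: "nat list \<Rightarrow> real" where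
  "finite_cfrac [] = 0"
| "finite_cfrac (a # as) = 1 / (real a + finite_cfrac as)"

text \<open>The partial quotients are indexed from 0: \<open>a k\<close> stands for the usual \<open>a\<^sub>k\<^sub>+\<^sub>1\<close>.\<close>

definition cfrac_expansion :: "real \<Rightarrow> (nat \<Rightarrow> nat) \<Rightarrow> bool" where
  "cfrac_expansion \<alpha> a \<longleftrightarrow>
     (\<forall>k. a k \<ge> 1) \<and> (\<lambda>n. finite_cfrac (map a [0..<n])) \<longlonglongrightarrow> \<alpha>"

text \<open>The expansion is unique, so the existential quantifier speaks about the partial
  quotients of \<open>\<alpha>\<close>.\<close>

definition bounded_type :: "real \<Rightarrow> bool" where
  "bounded_type \<alpha> \<longleftrightarrow> (\<exists>a. cfrac_expansion \<alpha> a \<and> finite (range a))"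

section \<open>Hausdorff dimension\<close>

text \<open>A nonempty set contributes 1 for \<open>s = 0\<close>, even if its diameter is 0 (whereas
  \<open>0 powr 0 = 0\<close>). Covering sets have to be required to be bounded, since
  \<^const>\<open>diameter\<close> is meaningless otherwise.\<close>

definition diam_pow :: "real \<Rightarrow> 'a::metric_space set \<Rightarrow> ennreal" where
  "diam_pow s U = (if U = {} then 0 else if s = 0 then 1 else ennreal (diameter U powr s))"

definition hausdorff_content :: "real \<Rightarrow> real \<Rightarrow> 'a::metric_space set \<Rightarrow> ennreal" where
  "hausdorff_content \<delta> s S =
     (INF U \<in> {U :: nat \<Rightarrow> 'a set. (\<forall>i. bounded (U i) \<and> diameter (U i) \<le> \<delta>) \<and> S \<subseteq> (\<Union>i. U i)}.
        \<Sum>i. diam_pow s (U i))"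

definition hausdorff_measure :: "real \<Rightarrow> 'a::metric_space set \<Rightarrow> ennreal" where
  "hausdorff_measure s S = (SUP \<delta>\<in>{0<..}. hausdorff_content \<delta> s S)"

definition hausdorff_dim :: "'a::metric_space set \<Rightarrow> ereal" where
  "hausdorff_dim S = Inf {ereal s | s. 0 \<le> s \<and> hausdorff_measure s S = 0}"

end

theory Submission
  imports Defs
begin

text \<open>The upper bound \<open>dim \<le> 1\<close> holds for every subset of the line. For the lower bound a Cantor set
of energies, of dimension close to 1 when the coupling \<open>\<lambda>\<close> is small, is found inside the spectrum
by means of the trace map.

Let \<open>M\<^sub>k\<close> be the transfer matrix at energy \<open>E\<close> over the first \<open>q\<^sub>k\<close> letters of the Sturmian word,
where \<open>q\<^sub>k\<close> is the denominator of the \<open>k\<close>-th convergent. The word is built by the rule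
\<open>w\<^sub>k\<^sub>+\<^sub>1 = w\<^sub>k\<^sup>a w\<^sub>k\<^sub>-\<^sub>1\<close>, where \<open>a\<close> is a partial quotient, so the half traces of
\<open>(M\<^sub>k, M\<^sub>k\<^sub>-\<^sub>1, M\<^sub>k\<^sub>-\<^sub>1 M\<^sub>k)\<close> evolve by polynomial maps, which preserve the Fricke invariant
\<open>x\<^sup>2 + y\<^sup>2 + z\<^sup>2 - 2 x y z - 1 = \<lambda>\<^sup>2 / 4\<close> (\<open>trace_word_digits\<close>). For large \<open>k\<close> the word begins
with two repetitions of \<open>w\<^sub>k\<close>, and so does its left half when it is read backwards. By the argument of
Gordon, the solutions at an energy with \<open>\<bar>tr M\<^sub>k\<bar> \<le> 2\<close> for infinitely many \<open>k\<close> do not decay on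
either side, and hence the energy belongs to the spectrum (\<open>bounded_traces_imp_spectrum\<close>).

For \<open>\<lambda> = 0\<close> the traces are \<open>(cos \<theta>\<^sub>1, cos \<theta>\<^sub>2, cos (\<theta>\<^sub>1 + \<theta>\<^sub>2))\<close>, and the trace map for a block of \<open>m\<close>
partial quotients is a linear automorphism of the torus with a positive integer matrix, whose entries
are at most a constant times the upper left entry \<open>p\<close>; the constant depends only on a bound for the
partial quotients. It maps a curve of fixed size whose two angles both increase to a curve of length
comparable to \<open>p\<close> in a strip of width \<open>\<pi> / p\<close>. This long curve contains a multiple of \<open>p\<close> pieces which
are again of the fixed size, increase in both angles, and stay away from the lines
\<open>\<theta>\<^sub>i \<in> \<pi> \<int>\<close>, where the angles are not smooth coordinates on the invariant surface. Away from these
lines the trace map on the surface of level \<open>\<lambda>\<^sup>2 / 4\<close> is, for a fixed block length, a perturbation of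
the linear map that is small together with its Lipschitz constant. So the same statement holds for
every small \<open>\<lambda>\<close> (\<open>expansion_step\<close>, \<open>admissible_lipschitz\<close>). Bounded type enters here: there are only
finitely many blocks of length \<open>m\<close>, so one bound on \<open>\<lambda>\<close> serves all of them.

Iterating gives a tree of intervals of energies. An interval has at least \<open>c p\<close> children, and
the lower bound for the lengths shrinks by the factor \<open>C p\<close> from one generation to the next. Here
\<open>c\<close> and \<open>C\<close> do not depend on \<open>m\<close>, while \<open>p\<close> is arbitrarily large if \<open>m\<close> is. The set of infinite
branches, which lies in the spectrum, therefore has dimension at least \<open>s\<close> as soon as
\<open>2 (C p)\<^sup>s \<le> c p\<close> (\<open>hausdorff_dim_ge_of_tree\<close>), and this can be arranged for every \<open>s < 1\<close>.
The only quantity carried from level to level is a Lipschitz constant; the pieces are found by the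
intermediate value theorem.\<close>

section \<open>Bounds for the Hausdorff dimension of a subset of the line\<close>

text \<open>Consecutive intervals of lengths \<open>c / 1, c / 2, c / 3, \<dots>\<close> cover a half-line, because the harmonic
series diverges, while the sum of the \<open>s\<close>-th powers of their lengths is \<open>c\<^sup>s\<close> times a convergent
series if \<open>s > 1\<close>. The two half-lines share the even and the odd indices.\<close>

lemma small_cover_of_line:
  fixes s \<delta> e :: real
  assumes s: "s > 1" and \<delta>: "\<delta> > 0" and e: "e > 0"
  shows "\<exists>U :: nat \<Rightarrow> real set. (\<forall>i. bounded (U i) \<and> diameter (U i) \<le> \<delta>) \<and>
           UNIV \<subseteq> (\<Union>i. U i) \<and> (\<Sum>i. diam_pow s (U i)) \<le> ennreal e"
proof -
  define g where "g = (\<lambda>n. real (Suc n) powr (-s))"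
  have "summable (\<lambda>n. real n powr (-s))"
    using s by (simp add: summable_real_powr_iff)
  hence sum_g: "summable g"
    unfolding g_def by (subst summable_Suc_iff)
  define Z where "Z = suminf g"
  have "g 0 \<le> Z"
    unfolding Z_def using sum_le_suminf[OF sum_g, of "{0}"] by (simp add: g_def)
  hence Z: "Z > 0" by (simp add: g_def)
  define c where "c = min \<delta> ((e / (2 powr s * Z)) powr (1 / s))"
  have c: "c > 0" "c \<le> \<delta>"
    using \<delta> e Z by (auto simp: c_def)
  have "c powr s \<le> ((e / (2 powr s * Z)) powr (1 / s)) powr s"
    using c s by (intro powr_mono2) (auto simp: c_def)
  also have "\<dots> = e / (2 powr s * Z)"
    using s e Z by (simp add: powr_powr)
  finally have c_powr: "c powr s * 2 powr s * Z \<le> e"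
    using Z by (simp add: field_simps)
  define P where "P = (\<lambda>n. {c * harm n..c * harm (Suc n)})"
  define U where "U = (\<lambda>n. if even n then P (n div 2) else uminus ` P (n div 2))"
  have diam_P: "diameter (P n) = c / real (Suc n)" for n
    using c by (simp add: P_def harm_Suc field_simps)
  have uminus_P: "uminus ` P n = {- (c * harm (Suc n))..- (c * harm n)}" for n
    by (simp add: P_def)
  have diam_minus_P: "diameter (uminus ` P n) = c / real (Suc n)" for n
    unfolding uminus_P using c by (simp add: harm_Suc field_simps)
  have diam_U: "diameter (U n) = c / real (Suc (n div 2))" for n
    by (simp add: U_def diam_P diam_minus_P)
  have U_bounded: "bounded (U n)" for n
    unfolding U_def uminus_P by (simp add: P_def)
  have P_covers: "\<exists>n. x \<in> P n" if x: "x \<ge> 0" for x :: real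
  proof -
    have "filterlim (harm :: nat \<Rightarrow> real) at_top sequentially"
    proof (rule filterlim_at_top_mono[OF _ always_eventually])
      show "filterlim (\<lambda>n. ln (real n + 1)) at_top sequentially"
        by (intro filterlim_compose[OF ln_at_top] filterlim_at_top_mono[OF filterlim_real_sequentially]) simp
      show "\<forall>n. ln (real n + 1) \<le> harm n"
        using ln_le_harm by (simp add: add.commute)
    qed
    hence "eventually (\<lambda>n. harm n > x / c) sequentially"
      by (auto simp: filterlim_at_top_dense)
    then obtain n0 where n0: "harm n0 > x / c"
      by (auto simp: eventually_at_top_linorder)
    define m where "m = (LEAST n. harm n > x / c)"
    have m: "harm m > x / c"
      unfolding m_def by (rule LeastI[of _ n0]) (rule n0)
    have "m \<noteq> 0"
    proof
      assume "m = 0"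
      with m have "x / c < 0" by (simp add: harm_def)
      with x c show False by (simp add: divide_less_0_iff)
    qed
    then obtain k where k: "m = Suc k" by (cases m) auto
    have "\<not> harm k > x / c"
      using not_less_Least[of k "\<lambda>n. harm n > x / c"] k m_def by auto
    hence "x \<in> P k"
      using m k c by (auto simp: P_def field_simps)
    thus ?thesis ..
  qed
  have covers: "x \<in> (\<Union>i. U i)" for x :: real
  proof (cases "x \<ge> 0")
    case True
    then obtain n where "x \<in> P n" using P_covers by blast
    hence "x \<in> U (2 * n)" by (simp add: U_def)
    thus ?thesis by blast
  next
    case False
    then obtain n where "-x \<in> P n" using P_covers[of "-x"] by auto
    hence "- (-x) \<in> uminus ` P n" by blast
    hence "x \<in> U (2 * n + 1)" by (simp add: U_def)
    thus ?thesis by blast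
  qed
  have term_le: "diam_pow s (U n) \<le> ennreal (c powr s * 2 powr s * g n)" for n
  proof -
    have "U n \<noteq> {}"
      unfolding U_def P_def using c by (auto simp: harm_Suc)
    have "Suc n \<le> 2 * Suc (n div 2)" by presburger
    hence "real (Suc n) \<le> real (2 * Suc (n div 2))" by (rule of_nat_mono)
    hence "real (Suc n) \<le> 2 * real (Suc (n div 2))" by simp
    hence "c * real (Suc n) \<le> c * (2 * real (Suc (n div 2)))"
      using c by (intro mult_left_mono) auto
    hence "c / real (Suc (n div 2)) \<le> c * 2 * (1 / real (Suc n))"
      by (simp add: field_simps)
    hence "(c / real (Suc (n div 2))) powr s \<le> (c * 2 * (1 / real (Suc n))) powr s"
      using c s by (intro powr_mono2) auto
    also have "\<dots> = c powr s * 2 powr s * g n"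
      using c by (simp add: g_def powr_mult powr_minus_divide powr_divide)
    finally show ?thesis
      using s \<open>U n \<noteq> {}\<close> by (simp add: diam_pow_def diam_U ennreal_leI)
  qed
  have "(\<Sum>i. diam_pow s (U i)) \<le> (\<Sum>n. ennreal (c powr s * 2 powr s * g n))"
    by (intro suminf_le term_le) auto
  also have "\<dots> = ennreal (\<Sum>n. c powr s * 2 powr s * g n)"
    by (intro suminf_ennreal2 summable_mult sum_g) (simp add: g_def)
  also have "\<dots> = ennreal (c powr s * 2 powr s * Z)"
    unfolding Z_def by (subst suminf_mult[OF sum_g]) simp
  also have "\<dots> \<le> ennreal e"
    using c_powr by (rule ennreal_leI)
  finally have total: "(\<Sum>i. diam_pow s (U i)) \<le> ennreal e" .
  have "c / real (Suc (n div 2)) \<le> \<delta>" for n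
  proof -
    have "c / real (Suc (n div 2)) \<le> c / 1"
      using c by (intro divide_left_mono) auto
    with c show ?thesis by simp
  qed
  hence "\<forall>i. bounded (U i) \<and> diameter (U i) \<le> \<delta>"
    using U_bounded diam_U by simp
  with covers total show ?thesis by blast
qed

lemma hausdorff_dim_real_le_1:
  fixes S :: "real set"
  shows "hausdorff_dim S \<le> 1"
proof -
  have zero: "hausdorff_measure s S = 0" if s: "s > 1" for s
  proof -
    have "hausdorff_content \<delta> s S = 0" if \<delta>: "\<delta> > 0" for \<delta>
    proof -
      have le_e: "hausdorff_content \<delta> s S \<le> 0 + ennreal e" if e: "e > 0" for e
      proof -
        obtain U :: "nat \<Rightarrow> real set" where
          U: "\<forall>i. bounded (U i) \<and> diameter (U i) \<le> \<delta>" "UNIV \<subseteq> (\<Union>i. U i)"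
             "(\<Sum>i. diam_pow s (U i)) \<le> ennreal e"
          using small_cover_of_line[OF s \<delta> e] by blast
        have "hausdorff_content \<delta> s S \<le> (\<Sum>i. diam_pow s (U i))"
          unfolding hausdorff_content_def using U by (intro INF_lower) auto
        with U show ?thesis by simp
      qed
      have "hausdorff_content \<delta> s S \<le> 0"
        by (rule ennreal_le_epsilon) (rule le_e)
      thus ?thesis by simp
    qed
    thus ?thesis by (simp add: hausdorff_measure_def)
  qed
  have "hausdorff_dim S \<le> ereal s" if "s > 1" for s
    unfolding hausdorff_dim_def using that zero by (intro Inf_lower) auto
  hence "hausdorff_dim S \<le> ereal 1 + ereal e" if "e > 0" for e
    using that by simp
  hence "hausdorff_dim S \<le> ereal 1"
    by (rule ereal_le_epsilon2)
  thus ?thesis by (simp add: one_ereal_def)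
qed

lemma meets_at_most_two_intervals:
  fixes U :: "real set" and lo hi :: "nat \<Rightarrow> real"
  assumes U: "bounded U" "diameter U < l"
    and long: "\<And>i. i < N \<Longrightarrow> l \<le> hi i - lo i"
    and disj: "\<And>i j. i < N \<Longrightarrow> j < N \<Longrightarrow> i \<noteq> j \<Longrightarrow> {lo i..hi i} \<inter> {lo j..hi j} = {}"
  shows "card {i. i < N \<and> U \<inter> {lo i..hi i} \<noteq> {}} \<le> 2"
proof (rule ccontr)
  define H where "H = {i. i < N \<and> U \<inter> {lo i..hi i} \<noteq> {}}"
  assume "\<not> card {i. i < N \<and> U \<inter> {lo i..hi i} \<noteq> {}} \<le> 2"
  hence card: "card H > 2" by (simp add: H_def)
  have fin: "finite H" by (simp add: H_def)
  have ne: "H \<noteq> {}" using card by auto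
  have "\<exists>i\<in>H. \<forall>j\<in>H. lo i \<le> lo j"
  proof -
    have "Min (lo ` H) \<in> lo ` H" using fin ne by (intro Min_in) auto
    then obtain i where "i \<in> H" "lo i = Min (lo ` H)" by auto
    thus ?thesis using fin by (intro bexI[of _ i]) auto
  qed
  then obtain i where i: "i \<in> H" "\<And>j. j \<in> H \<Longrightarrow> lo i \<le> lo j" by blast
  have "\<exists>k\<in>H. \<forall>j\<in>H. lo j \<le> lo k"
  proof -
    have "Max (lo ` H) \<in> lo ` H" using fin ne by (intro Max_in) auto
    then obtain k where "k \<in> H" "lo k = Max (lo ` H)" by auto
    thus ?thesis using fin by (intro bexI[of _ k]) auto
  qed
  then obtain k where k: "k \<in> H" "\<And>j. j \<in> H \<Longrightarrow> lo j \<le> lo k" by blast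
  have "\<exists>j. j \<in> H \<and> j \<noteq> i \<and> j \<noteq> k"
  proof (rule ccontr)
    assume "\<nexists>j. j \<in> H \<and> j \<noteq> i \<and> j \<noteq> k"
    hence "H \<subseteq> {i, k}" by blast
    hence "card H \<le> card {i, k}" by (intro card_mono) auto
    also have "\<dots> \<le> 2" by (simp add: card_insert_if)
    finally show False using card by simp
  qed
  then obtain j where j: "j \<in> H" "j \<noteq> i" "j \<noteq> k" by blast
  obtain x where x: "x \<in> U" "x \<in> {lo i..hi i}" using i(1) unfolding H_def by blast
  obtain y where y: "y \<in> U" "y \<in> {lo k..hi k}" using k(1) unfolding H_def by blast
  have lj: "lo j \<le> hi j" using j(1) by (auto simp: H_def)
  have lk: "lo k \<le> hi k" using y by auto
  have "hi i < lo j"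
  proof (rule ccontr)
    assume "\<not> hi i < lo j"
    hence "lo j \<in> {lo i..hi i} \<inter> {lo j..hi j}" using i(2)[OF j(1)] lj by auto
    thus False using disj[of i j] i(1) j by (auto simp: H_def)
  qed
  moreover have "hi j < lo k"
  proof (rule ccontr)
    assume "\<not> hi j < lo k"
    hence "lo k \<in> {lo j..hi j} \<inter> {lo k..hi k}" using k(2)[OF j(1)] lk by auto
    thus False using disj[of j k] k(1) j by (auto simp: H_def)
  qed
  moreover have "dist x y \<le> diameter U"
    using U(1) x y by (intro diameter_bounded_bound) auto
  moreover have "l \<le> hi j - lo j" using long j(1) by (auto simp: H_def)
  ultimately show False
    using x y U(2) by (auto simp: dist_real_def)
qed

text \<open>The step of the construction below: each covering set that meets the parent is shorter than the
children and hence meets at most two of them, so the weights that meet the children add up to at most twice the weight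
that meets the parent, and some child gets at most the average.\<close>

lemma light_child_exists:
  fixes U :: "nat \<Rightarrow> real set" and w :: "nat \<Rightarrow> real" and lo hi :: "nat \<Rightarrow> real"
  assumes w: "\<And>i. w i \<ge> 0" "summable w"
    and U: "\<And>i. bounded (U i)" "\<And>i. U i \<inter> {a..b} \<noteq> {} \<Longrightarrow> diameter (U i) < l"
    and sub: "\<And>k. k < N \<Longrightarrow> {lo k..hi k} \<subseteq> {a..b}"
    and long: "\<And>k. k < N \<Longrightarrow> l \<le> hi k - lo k"
    and disj: "\<And>j k. j < N \<Longrightarrow> k < N \<Longrightarrow> j \<noteq> k \<Longrightarrow> {lo j..hi j} \<inter> {lo k..hi k} = {}"
    and light: "2 * (\<Sum>i. if U i \<inter> {a..b} \<noteq> {} then w i else 0) < real N * B"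
  shows "\<exists>k<N. (\<Sum>i. if U i \<inter> {lo k..hi k} \<noteq> {} then w i else 0) < B"
proof (rule ccontr)
  assume "\<not> ?thesis"
  hence heavy: "B \<le> (\<Sum>i. if U i \<inter> {lo k..hi k} \<noteq> {} then w i else 0)" if "k < N" for k
    using that by (meson not_less)
  have summ: "summable (\<lambda>i. if P i then w i else 0)" for P
    using w by (intro summable_comparison_test'[OF w(2)]) auto
  have count: "(\<Sum>k<N. if U i \<inter> {lo k..hi k} \<noteq> {} then w i else 0)
                 \<le> 2 * (if U i \<inter> {a..b} \<noteq> {} then w i else 0)" for i
  proof (cases "U i \<inter> {a..b} = {}")
    case True
    hence "U i \<inter> {lo k..hi k} = {}" if "k < N" for k
      using sub[OF that] by blast
    hence "(\<Sum>k<N. if U i \<inter> {lo k..hi k} \<noteq> {} then w i else 0) = 0"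
      by (intro sum.neutral) auto
    with True show ?thesis by simp
  next
    case False
    have "(\<Sum>k<N. if U i \<inter> {lo k..hi k} \<noteq> {} then w i else 0)
        = (\<Sum>k | k < N \<and> U i \<inter> {lo k..hi k} \<noteq> {}. w i)"
      by (rule sum.mono_neutral_cong_right) auto
    also have "\<dots> = real (card {k. k < N \<and> U i \<inter> {lo k..hi k} \<noteq> {}}) * w i"
      by simp
    also have "\<dots> \<le> 2 * w i"
      using meets_at_most_two_intervals[OF U(1) U(2)[OF False] long disj, of N]
      by (intro mult_right_mono w) auto
    finally show ?thesis using False by simp
  qed
  have "real N * B = (\<Sum>k<N. B)" by simp
  also have "\<dots> \<le> (\<Sum>k<N. \<Sum>i. if U i \<inter> {lo k..hi k} \<noteq> {} then w i else 0)"
    by (intro sum_mono heavy) auto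
  also have "\<dots> = (\<Sum>i. \<Sum>k<N. if U i \<inter> {lo k..hi k} \<noteq> {} then w i else 0)"
    by (rule suminf_sum[symmetric]) (rule summ)
  also have "\<dots> \<le> (\<Sum>i. 2 * (if U i \<inter> {a..b} \<noteq> {} then w i else 0))"
    by (intro suminf_le count summable_sum summable_mult summ)
  also have "\<dots> = 2 * (\<Sum>i. if U i \<inter> {a..b} \<noteq> {} then w i else 0)"
    by (rule suminf_mult[OF summ])
  finally show False using light by simp
qed

text \<open>A form of the mass distribution principle without a measure. Going down the tree and choosing a light
child each time keeps the weight that meets the current interval below a fixed multiple of
\<open>l n powr s\<close>, which tends to 0. A covering set of positive weight cannot contain the point at the end of
this branch. The factor 2 that is lost in every step is paid by the factor 2 in the assumption on the
number of children.\<close>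

lemma weighted_cover_misses_point:
  fixes Adm :: "nat \<Rightarrow> real \<Rightarrow> real \<Rightarrow> bool" and L :: "nat \<Rightarrow> real" and N :: "nat \<Rightarrow> nat"
    and U :: "nat \<Rightarrow> real set" and w :: "nat \<Rightarrow> real"
  assumes s: "s > 0"
    and l: "\<And>n. l n > 0" "\<And>n. l n = L n * l (Suc n)" "l \<longlonglongrightarrow> 0"
    and L: "\<And>n. L n \<le> M"
    and N: "\<And>n. 2 * L n powr s \<le> real (N n)"
    and length: "\<And>n a b. Adm n a b \<Longrightarrow> l n \<le> b - a"
    and root: "Adm 0 a0 b0"
    and children: "\<And>n a b. Adm n a b \<Longrightarrow> \<exists>lo hi. (\<forall>k<N n. Adm (Suc n) (lo k) (hi k) \<and>
            {lo k..hi k} \<subseteq> {a..b}) \<and>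
            (\<forall>j<N n. \<forall>k<N n. j \<noteq> k \<longrightarrow> {lo j..hi j} \<inter> {lo k..hi k} = {})"
    and branch: "\<And>x. (\<And>n. \<exists>a b. Adm n a b \<and> x \<in> {a..b}) \<Longrightarrow> x \<in> S"
    and w: "\<And>i. w i > 0" "summable w"
    and U: "\<And>i. bounded (U i)" "\<And>i. U i \<noteq> {} \<Longrightarrow> diameter (U i) powr s \<le> w i"
    and light: "suminf w < M powr (-s) * l 0 powr s"
  shows "\<exists>x\<in>S. x \<notin> (\<Union>i. U i)"
proof -
  define W where "W = (\<lambda>a b. \<Sum>i. if U i \<inter> {a..b} \<noteq> {} then w i else 0)"
  define e where "e = M powr (-s)"
  define Q where "Q = (\<lambda>n (ab::real\<times>real). Adm n (fst ab) (snd ab) \<and>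
                         W (fst ab) (snd ab) < e * l n powr s)"
  have summ: "summable (\<lambda>i. if P i then w i else 0)" for P
    using w by (intro summable_comparison_test'[OF w(2)]) (auto intro: less_imp_le)
  have Lpos: "L n > 0" for n
    using l(1)[of n] l(2)[of n] l(1)[of "Suc n"] by (simp add: zero_less_mult_iff)
  have Mpos: "M > 0" using Lpos[of 0] L[of 0] by linarith
  have l_powr: "l n powr s = L n powr s * l (Suc n) powr s" for n
    using l(1)[of "Suc n"] Lpos[of n] by (subst l(2)) (simp add: powr_mult)
  have W_ge: "w i \<le> W a b" if "U i \<inter> {a..b} \<noteq> {}" for i a b
    using sum_le_suminf[OF summ[of "\<lambda>i. U i \<inter> {a..b} \<noteq> {}"], of "{i}"] that w(1)
    by (auto simp: W_def less_imp_le)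
  have Q0: "Q 0 (a0, b0)"
  proof -
    have "W a0 b0 \<le> suminf w"
      unfolding W_def using w by (intro suminf_le summ) (auto intro: less_imp_le)
    with light root show ?thesis by (simp add: Q_def e_def)
  qed
  have step: "\<exists>y. Q (Suc n) y \<and> {fst y..snd y} \<subseteq> {fst x..snd x}" if Q: "Q n x" for x n
  proof -
    obtain a b where x: "x = (a, b)" by (cases x)
    have adm: "Adm n a b" and W: "W a b < e * l n powr s"
      using Q by (auto simp: Q_def x)
    obtain lo hi where
      ch: "\<And>k. k < N n \<Longrightarrow> Adm (Suc n) (lo k) (hi k)"
          "\<And>k. k < N n \<Longrightarrow> {lo k..hi k} \<subseteq> {a..b}"
          "\<And>j k. j < N n \<Longrightarrow> k < N n \<Longrightarrow> j \<noteq> k \<Longrightarrow> {lo j..hi j} \<inter> {lo k..hi k} = {}"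
      using children[OF adm] by metis
    \<comment> \<open>A covering set of diameter at least \<open>l (Suc n)\<close> would alone be heavier than the bound on \<open>W a b\<close>.\<close>
    have small: "diameter (U i) < l (Suc n)" if i: "U i \<inter> {a..b} \<noteq> {}" for i
    proof -
      have "diameter (U i) powr s \<le> w i" using U(2) i by blast
      also have "\<dots> \<le> W a b" by (rule W_ge[OF i])
      also have "\<dots> < e * l n powr s" by (rule W)
      also have "\<dots> = (M powr (-s) * L n powr s) * l (Suc n) powr s"
        by (simp add: e_def l_powr[of n])
      also have "\<dots> \<le> 1 * l (Suc n) powr s"
      proof (rule mult_right_mono)
        have "L n powr s \<le> M powr s"
          using L[of n] Lpos[of n] s by (intro powr_mono2) auto
        thus "M powr (-s) * L n powr s \<le> 1"
          using Mpos by (simp add: powr_minus field_simps)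
      qed simp
      finally have *: "diameter (U i) powr s < l (Suc n) powr s" by simp
      show ?thesis
      proof (rule ccontr)
        assume "\<not> diameter (U i) < l (Suc n)"
        hence "l (Suc n) powr s \<le> diameter (U i) powr s"
          using s l(1)[of "Suc n"] by (intro powr_mono2) auto
        with * show False by simp
      qed
    qed
    have "2 * W a b < 2 * (e * l n powr s)" using W by simp
    also have "\<dots> = (2 * L n powr s) * (e * l (Suc n) powr s)"
      by (simp add: l_powr[of n])
    also have "\<dots> \<le> real (N n) * (e * l (Suc n) powr s)"
      by (intro mult_right_mono N) (simp add: e_def)
    finally have "\<exists>k<N n. W (lo k) (hi k) < e * l (Suc n) powr s"
      unfolding W_def using w U(1) small ch length
      by (intro light_child_exists[where a=a and b=b and l="l (Suc n)"])
         (auto intro: less_imp_le)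
    then obtain k where "k < N n" "W (lo k) (hi k) < e * l (Suc n) powr s" by blast
    hence "Q (Suc n) (lo k, hi k)" "{lo k..hi k} \<subseteq> {a..b}"
      using ch by (auto simp: Q_def)
    thus ?thesis by (intro exI[of _ "(lo k, hi k)"]) (auto simp: x)
  qed
  have "\<exists>f. f 0 = (a0, b0) \<and> (\<forall>n. Q n (f n) \<and> {fst (f (Suc n))..snd (f (Suc n))} \<subseteq> {fst (f n)..snd (f n)})"
  proof -
    have "\<exists>f. \<forall>n. (Q n (f n) \<and> (n = 0 \<longrightarrow> f n = (a0, b0))) \<and>
            {fst (f (Suc n))..snd (f (Suc n))} \<subseteq> {fst (f n)..snd (f n)}"
      using Q0 step by (intro dependent_nat_choice) auto
    thus ?thesis by metis
  qed
  then obtain f where f: "\<And>n. Q n (f n)"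
      "\<And>n. {fst (f (Suc n))..snd (f (Suc n))} \<subseteq> {fst (f n)..snd (f n)}" by metis
  have adm: "Adm n (fst (f n)) (snd (f n))" for n using f(1)[of n] by (simp add: Q_def)
  have "\<exists>x. \<forall>n. x \<in> {fst (f n)..snd (f n)}"
  proof -
    have "\<Inter> (range (\<lambda>n. {fst (f n)..snd (f n)})) \<noteq> {}"
    proof (rule compact_nest)
      show "compact {fst (f n)..snd (f n)}" for n by simp
      show "{fst (f n)..snd (f n)} \<noteq> {}" for n
        using length[OF adm[of n]] l(1)[of n] by auto
      show "{fst (f n)..snd (f n)} \<subseteq> {fst (f m)..snd (f m)}" if "m \<le> n" for m n
        using that by (induction rule: dec_induct) (use f(2) in blast)+
    qed
    thus ?thesis by blast
  qed
  then obtain x where x: "\<And>n. x \<in> {fst (f n)..snd (f n)}" by blast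
  have "x \<in> S" using adm x by (intro branch) blast
  moreover have "x \<notin> U i" for i
  proof
    assume i: "x \<in> U i"
    have "w i \<le> e * l n powr s" for n
    proof -
      have "U i \<inter> {fst (f n)..snd (f n)} \<noteq> {}" using i x by blast
      hence "w i \<le> W (fst (f n)) (snd (f n))" by (rule W_ge)
      also have "\<dots> < e * l n powr s" using f(1)[of n] by (simp add: Q_def)
      finally show ?thesis by simp
    qed
    moreover have "(\<lambda>n. e * l n powr s) \<longlonglongrightarrow> 0"
    proof -
      have "(\<lambda>n. l n powr s) \<longlonglongrightarrow> 0"
        using l(1) l(3) s by (intro tendsto_zero_powrI[where b=s]) (auto intro: always_eventually less_imp_le)
      thus ?thesis by (rule tendsto_mult_right_zero)
    qed
    ultimately have "w i \<le> 0"
      by (intro LIMSEQ_le_const) auto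
    with w(1)[of i] show False by simp
  qed
  ultimately show ?thesis by blast
qed

lemma hausdorff_measure_pos_of_tree:
  fixes Adm :: "nat \<Rightarrow> real \<Rightarrow> real \<Rightarrow> bool" and L :: "nat \<Rightarrow> real" and N :: "nat \<Rightarrow> nat"
  assumes s: "s > 0"
    and l: "\<And>n. l n > 0" "\<And>n. l n = L n * l (Suc n)" "l \<longlonglongrightarrow> 0"
    and L: "\<And>n. L n \<le> M"
    and N: "\<And>n. 2 * L n powr s \<le> real (N n)"
    and length: "\<And>n a b. Adm n a b \<Longrightarrow> l n \<le> b - a"
    and root: "Adm 0 a0 b0"
    and children: "\<And>n a b. Adm n a b \<Longrightarrow> \<exists>lo hi. (\<forall>k<N n. Adm (Suc n) (lo k) (hi k) \<and>
            {lo k..hi k} \<subseteq> {a..b}) \<and>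
            (\<forall>j<N n. \<forall>k<N n. j \<noteq> k \<longrightarrow> {lo j..hi j} \<inter> {lo k..hi k} = {})"
    and branch: "\<And>x. (\<And>n. \<exists>a b. Adm n a b \<and> x \<in> {a..b}) \<Longrightarrow> x \<in> S"
  shows "hausdorff_measure s S \<noteq> 0"
proof
  assume zero: "hausdorff_measure s S = 0"
  have "L 0 > 0"
    using l(1)[of 0] l(2)[of 0] l(1)[of "Suc 0"] by (simp add: zero_less_mult_iff)
  hence Mpos: "M > 0" using L[of 0] by linarith
  define e where "e = M powr (-s) * l 0 powr s"
  have e: "e > 0" using Mpos l(1)[of 0] by (simp add: e_def)
  have "hausdorff_content 1 s S \<le> hausdorff_measure s S"
    unfolding hausdorff_measure_def by (intro SUP_upper) auto
  hence "hausdorff_content 1 s S < ennreal (e / 4)"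
    using zero e by (simp add: le_less_trans)
  then obtain U :: "nat \<Rightarrow> real set" where
    U: "\<And>i. bounded (U i)" "S \<subseteq> (\<Union>i. U i)" "(\<Sum>i. diam_pow s (U i)) < ennreal (e / 4)"
    unfolding hausdorff_content_def by (auto simp: INF_less_iff)
  define v where "v = (\<lambda>i. enn2real (diam_pow s (U i)))"
  have v: "ennreal (v i) = diam_pow s (U i)" "v i \<ge> 0" for i
    by (auto simp: v_def diam_pow_def)
  have "(\<Sum>i. ennreal (v i)) < ennreal (e / 4)" using U(3) v(1) by simp
  hence "summable v" "suminf v \<le> e / 4"
  proof -
    assume *: "(\<Sum>i. ennreal (v i)) < ennreal (e / 4)"
    hence "(\<Sum>i. ennreal (v i)) \<noteq> top" by (auto simp: top_unique)
    thus summ: "summable v" using v(2) by (intro summable_suminf_not_top)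
    have "ennreal (suminf v) < ennreal (e / 4)"
      using * suminf_ennreal2[OF v(2) summ] by simp
    thus "suminf v \<le> e / 4" using e by (simp add: ennreal_less_iff suminf_nonneg summ v)
  qed
  note v' = this
  \<comment> \<open>The geometric term keeps the weight of a covering set positive when its diameter is 0.\<close>
  define w where "w = (\<lambda>i. v i + e / 4 * (1/2) ^ i)"
  have w: "summable w" "suminf w = suminf v + e / 4 * 2"
  proof -
    have g: "summable (\<lambda>i. e / 4 * (1/2::real) ^ i)" by (intro summable_mult summable_geometric) auto
    show "summable w" unfolding w_def by (intro summable_add v' g)
    have "suminf w = suminf v + (\<Sum>i. e / 4 * (1/2::real) ^ i)"
      unfolding w_def by (rule suminf_add[symmetric]) (intro v' g)+
    also have "(\<Sum>i. e / 4 * (1/2::real) ^ i) = e / 4 * 2"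
      by (subst suminf_mult) (auto simp: suminf_geometric)
    finally show "suminf w = suminf v + e / 4 * 2" .
  qed
  have "\<exists>x\<in>S. x \<notin> (\<Union>i. U i)"
  proof (rule weighted_cover_misses_point[OF s l L N length root children branch])
    show "w i > 0" for i unfolding w_def using v(2)[of i] e by (intro add_nonneg_pos) auto
    show "suminf w < M powr (-s) * l 0 powr s"
      using v'(2) e w(2) by (simp add: e_def[symmetric])
    show "diameter (U i) powr s \<le> w i" if "U i \<noteq> {}" for i
    proof -
      have "v i = diameter (U i) powr s" using that s by (simp add: v_def diam_pow_def)
      thus ?thesis using e by (simp add: w_def)
    qed
  qed (use U w in auto)
  with U(2) show False by blast
qed

lemma hausdorff_measure_0_eq_0_imp_empty:
  assumes "hausdorff_measure 0 S = 0"
  shows "S = {}"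
proof -
  have "hausdorff_content 1 0 S \<le> hausdorff_measure 0 S"
    unfolding hausdorff_measure_def by (intro SUP_upper) auto
  hence "hausdorff_content 1 0 S < 1" using assms by (simp add: le_less_trans)
  then obtain U :: "nat \<Rightarrow> 'a set" where
    U: "S \<subseteq> (\<Union>i. U i)" "(\<Sum>i. diam_pow 0 (U i)) < 1"
    unfolding hausdorff_content_def by (auto simp: INF_less_iff)
  have "U i = {}" for i
  proof (rule ccontr)
    assume "U i \<noteq> {}"
    hence "1 = (\<Sum>j\<in>{i}. diam_pow 0 (U j))" by (simp add: diam_pow_def)
    also have "\<dots> \<le> (\<Sum>i. diam_pow 0 (U i))" by (intro sum_le_suminf) auto
    finally show False using U(2) by simp
  qed
  with U(1) show ?thesis by auto
qed

lemma hausdorff_measure_empty: "hausdorff_measure s {} = 0"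
proof -
  have "hausdorff_content \<delta> s ({} :: 'a set) = 0" if "\<delta> > 0" for \<delta>
  proof -
    have "hausdorff_content \<delta> s ({} :: 'a set) \<le> (\<Sum>i::nat. diam_pow s ({} :: 'a set))"
      unfolding hausdorff_content_def using that by (intro INF_lower) auto
    thus ?thesis by (simp add: diam_pow_def)
  qed
  thus ?thesis by (simp add: hausdorff_measure_def)
qed

text \<open>The assumption on the number of children at exponent \<open>s\<close> implies the same at every smaller positive
exponent, because \<open>L n \<ge> 1\<close>. The exponent 0 has to be treated apart, since there a covering set
contributes 1 whatever its diameter.\<close>

lemma hausdorff_dim_ge_of_tree:
  fixes Adm :: "nat \<Rightarrow> real \<Rightarrow> real \<Rightarrow> bool" and L :: "nat \<Rightarrow> real" and N :: "nat \<Rightarrow> nat"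
  assumes s: "s > 0"
    and l: "\<And>n. l n > 0" "\<And>n. l n = L n * l (Suc n)"
    and L: "\<And>n. 2 \<le> L n" "\<And>n. L n \<le> M"
    and N: "\<And>n. 2 * L n powr s \<le> real (N n)"
    and length: "\<And>n a b. Adm n a b \<Longrightarrow> l n \<le> b - a"
    and root: "Adm 0 a0 b0"
    and children: "\<And>n a b. Adm n a b \<Longrightarrow> \<exists>lo hi. (\<forall>k<N n. Adm (Suc n) (lo k) (hi k) \<and>
            {lo k..hi k} \<subseteq> {a..b}) \<and>
            (\<forall>j<N n. \<forall>k<N n. j \<noteq> k \<longrightarrow> {lo j..hi j} \<inter> {lo k..hi k} = {})"
    and branch: "\<And>x. (\<And>n. \<exists>a b. Adm n a b \<and> x \<in> {a..b}) \<Longrightarrow> x \<in> S"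
  shows "hausdorff_dim S \<ge> ereal s"
proof -
  have l_le: "l n \<le> l 0 * (1/2) ^ n" for n
  proof (induction n)
    case (Suc n)
    have "2 * l (Suc n) \<le> L n * l (Suc n)"
      using L(1)[of n] l(1)[of "Suc n"] by (intro mult_right_mono) auto
    also have "\<dots> = l n" using l(2)[of n] by simp
    finally show ?case using Suc by simp
  qed simp
  have l0: "l \<longlonglongrightarrow> 0"
  proof (rule tendsto_sandwich[OF _ _ tendsto_const])
    have "(\<lambda>n. (1/2::real) ^ n) \<longlonglongrightarrow> 0" by (rule LIMSEQ_power_zero) simp
    thus "(\<lambda>n. l 0 * (1/2) ^ n) \<longlonglongrightarrow> 0" by (rule tendsto_mult_right_zero)
  qed (use l_le l(1) in \<open>auto intro: always_eventually less_imp_le\<close>)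
  have pos: "hausdorff_measure t S \<noteq> 0" if t: "0 < t" "t \<le> s" for t
  proof (rule hausdorff_measure_pos_of_tree[OF t(1) l l0 L(2) _ length root children branch])
    fix n
    have "2 * L n powr t \<le> 2 * L n powr s"
      using t L(1)[of n] by (intro mult_left_mono powr_mono) auto
    also have "\<dots> \<le> real (N n)" by (rule N)
    finally show "2 * L n powr t \<le> real (N n)" .
  qed
  have "ereal s \<le> ereal t" if t: "0 \<le> t" "hausdorff_measure t S = 0" for t
  proof -
    have "t \<noteq> 0"
      using t pos[of s] s hausdorff_measure_0_eq_0_imp_empty[of S] hausdorff_measure_empty by auto
    with t pos[of t] show ?thesis by force
  qed
  thus ?thesis
    unfolding hausdorff_dim_def by (intro Inf_greatest) auto
qed

section \<open>The trace map and the torus automorphisms that it perturbs\<close>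

type_synonym traces = "real \<times> real \<times> real"

text \<open>A triple \<open>(x, y, z)\<close> stands for the half traces of \<open>A\<close>, \<open>B\<close> and \<open>B A\<close>, where \<open>A\<close> and \<open>B\<close> are
matrices of determinant 1. Then \<open>trace_mult\<close> corresponds to \<open>(A, B) \<mapsto> (A, B A)\<close> and
\<open>trace_step b\<close> to \<open>(A, B) \<mapsto> (B A\<^sup>b, A)\<close>; see \<open>trace_step_pair_traces\<close>.\<close>

definition trace_mult :: "traces \<Rightarrow> traces" where
  "trace_mult = (\<lambda>(x, y, z). (x, z, 2 * x * z - y))"

definition trace_swap :: "traces \<Rightarrow> traces" where
  "trace_swap = (\<lambda>(x, y, z). (y, x, z))"

definition trace_step :: "nat \<Rightarrow> traces \<Rightarrow> traces" where
  "trace_step b = trace_swap \<circ> (trace_mult ^^ b)"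

definition trace_word :: "nat list \<Rightarrow> traces \<Rightarrow> traces" where
  "trace_word w = fold trace_step w"

definition fricke :: "traces \<Rightarrow> real" where
  "fricke = (\<lambda>(x, y, z). x\<^sup>2 + y\<^sup>2 + z\<^sup>2 - 2 * x * y * z - 1)"

lemma fricke_trace_step: "fricke (trace_step b p) = fricke p"
proof -
  have "fricke (trace_mult p) = fricke p" for p
    by (cases p) (simp add: fricke_def trace_mult_def power2_eq_square algebra_simps)
  hence "fricke ((trace_mult ^^ b) p) = fricke p"
    by (induction b) simp_all
  moreover have "fricke (trace_swap p) = fricke p" for p
    by (cases p) (simp add: fricke_def trace_swap_def algebra_simps)
  ultimately show ?thesis by (simp add: trace_step_def)
qed

lemma trace_word_append: "trace_word (v @ w) p = trace_word w (trace_word v p)"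
  by (simp add: trace_word_def)

lemma fricke_trace_word: "fricke (trace_word w p) = fricke p"
  by (induction w rule: rev_induct) (simp_all add: trace_word_def fricke_trace_step)

text \<open>A quadruple \<open>(p, q, r, s)\<close> is the matrix with rows \<open>(p, q)\<close> and \<open>(r, s)\<close>, and \<open>lin_step b\<close>
multiplies it from the left by the matrix with rows \<open>(b, 1)\<close> and \<open>(1, 0)\<close>.\<close>

definition lin_step :: "nat \<Rightarrow> nat \<times> nat \<times> nat \<times> nat \<Rightarrow> nat \<times> nat \<times> nat \<times> nat" where
  "lin_step b = (\<lambda>(p, q, r, s). (b * p + r, b * q + s, p, q))"

definition lin_word :: "nat list \<Rightarrow> nat \<times> nat \<times> nat \<times> nat" where
  "lin_word w = fold lin_step w (1, 0, 0, 1)"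

lemma lin_word_snoc: "lin_word (w @ [b]) = lin_step b (lin_word w)"
  by (simp add: lin_word_def)

lemma trace_step_cos:
  "trace_step b (cos u, cos v, cos (u + v)) =
     (cos (b * u + v), cos u, cos ((b * u + v) + u))"
proof -
  have "(trace_mult ^^ b) (cos u, cos v, cos (u + v)) =
          (cos u, cos (b * u + v), cos (u + (b * u + v)))"
  proof (induction b)
    case (Suc b)
    define t where "t = u + (b * u + v)"
    have "2 * cos u * cos t - cos (t - u) = cos (u + t)"
      by (simp add: cos_add cos_diff)
    thus ?case
      using Suc by (simp add: trace_mult_def t_def algebra_simps)
  qed simp
  thus ?thesis by (simp add: trace_step_def trace_swap_def add.commute)
qed

text \<open>On the surface of level 0 the trace map is the quotient of a torus automorphism by
\<open>\<theta> \<mapsto> - \<theta>\<close>, as for commuting rotations.\<close>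

lemma trace_word_cos:
  assumes "lin_word w = (p, q, r, s)"
  shows "trace_word w (cos u, cos v, cos (u + v)) =
     (cos (p * u + q * v), cos (r * u + s * v), cos ((p * u + q * v) + (r * u + s * v)))"
  using assms
proof (induction w arbitrary: p q r s rule: rev_induct)
  case Nil
  thus ?case by (auto simp: lin_word_def trace_word_def)
next
  case (snoc b w)
  obtain p' q' r' s' where w: "lin_word w = (p', q', r', s')" by (metis prod_cases4)
  have "trace_word (w @ [b]) (cos u, cos v, cos (u + v)) =
          trace_step b (trace_word w (cos u, cos v, cos (u + v)))"
    by (simp add: trace_word_def)
  also have "\<dots> = (cos (b * (p' * u + q' * v) + (r' * u + s' * v)), cos (p' * u + q' * v),
                    cos ((b * (p' * u + q' * v) + (r' * u + s' * v)) + (p' * u + q' * v)))"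
    unfolding snoc.IH[OF w] by (rule trace_step_cos)
  finally show ?case
    using snoc.prems by (auto simp: lin_word_snoc w lin_step_def algebra_simps)
qed

lemma lin_word_det:
  assumes "lin_word w = (p, q, r, s)"
  shows "\<bar>int p * int s - int q * int r\<bar> = 1"
  using assms
proof (induction w arbitrary: p q r s rule: rev_induct)
  case Nil
  thus ?case by (auto simp: lin_word_def)
next
  case (snoc b w)
  obtain p' q' r' s' where w: "lin_word w = (p', q', r', s')" by (metis prod_cases4)
  have "int p * int s - int q * int r = - (int p' * int s' - int q' * int r')"
    using snoc.prems by (auto simp: lin_word_snoc w lin_step_def algebra_simps)
  with snoc.IH[OF w] show ?case by simp
qed

text \<open>The bounds on \<open>q\<close>, \<open>r\<close>, \<open>s\<close> make the Lipschitz constant of the matrix comparable to \<open>p\<close>. The slope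
\<open>r / p\<close> of its image lines is between \<open>1 / K\<close> and 1, so that both angles grow along them.\<close>

definition balanced :: "nat \<Rightarrow> nat \<times> nat \<times> nat \<times> nat \<Rightarrow> bool" where
  "balanced K = (\<lambda>(p, q, r, s). 1 \<le> r \<and> r \<le> p \<and> p \<le> K * r \<and> q \<le> K * p \<and> s \<le> K * r)"

text \<open>The first digit is allowed to be 0, because the expansion is used with its first partial quotient
lowered by 1. A digit 0 in front makes some entries vanish, but not after three steps.\<close>

lemma lin_word_balanced:
  assumes "length w = n" "n \<ge> 3"
    and "w ! 0 < K" "\<And>i. 1 \<le> i \<Longrightarrow> i < n \<Longrightarrow> 1 \<le> w ! i \<and> w ! i < K"
  shows "balanced K (lin_word w) \<and> n \<le> fst (lin_word w) + 2"
  using assms(2,1,3,4)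
proof (induction n arbitrary: w rule: nat_induct_at_least)
  case base
  then obtain b1 b2 b3 where w: "w = [b1, b2, b3]"
    by (auto simp: length_Suc_conv eval_nat_numeral)
  have b: "b1 < K" "1 \<le> b2" "b2 < K" "1 \<le> b3" "b3 < K"
    using base(2) base(3)[of 1] base(3)[of 2] by (auto simp: w)
  have lw: "lin_word w = (b3 * (b2 * b1 + 1) + b1, b3 * b2 + 1, b2 * b1 + 1, b2)"
    by (simp add: w lin_word_def lin_step_def)
  have 1: "b1 \<le> b2 * b1" using b by simp
  have "b3 * (b2 * b1 + 1) + b1 \<le> (b3 + 1) * (b2 * b1 + 1)"
  proof -
    have "(b3 + 1) * (b2 * b1 + 1) = b3 * (b2 * b1 + 1) + (b2 * b1 + 1)" by simp
    with 1 show ?thesis by linarith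
  qed
  also have "\<dots> \<le> K * (b2 * b1 + 1)" using b by (intro mult_right_mono) auto
  finally have p: "b3 * (b2 * b1 + 1) + b1 \<le> K * (b2 * b1 + 1)" .
  have "b3 * b2 + 1 \<le> (b2 + 1) * b3" using b by (simp add: algebra_simps)
  also have "\<dots> \<le> K * (b3 * (b2 * b1 + 1) + b1)"
    using b by (intro mult_mono) (auto simp: algebra_simps)
  finally have q: "b3 * b2 + 1 \<le> K * (b3 * (b2 * b1 + 1) + b1)" .
  have "1 * (b2 * b1 + 1) \<le> b3 * (b2 * b1 + 1)" using b by (intro mult_right_mono) auto
  hence r: "b2 * b1 + 1 \<le> b3 * (b2 * b1 + 1) + b1" by (metis mult_1 trans_le_add1)
  have "K * 1 \<le> K * (b2 * b1 + 1)" by (intro mult_left_mono) auto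
  hence s: "b2 \<le> K * (b2 * b1 + 1)" using b by linarith
  from p q r s show ?case unfolding lw balanced_def by auto
next
  case (Suc n)
  obtain v b where w: "w = v @ [b]" "length v = n"
    using Suc.prems(1) by (cases w rule: rev_cases) auto
  have nth: "v ! i = w ! i" if "i < n" for i using that w by (simp add: nth_append)
  have IH: "balanced K (lin_word v) \<and> n \<le> fst (lin_word v) + 2"
    using Suc.prems(2,3) Suc.hyps nth w by (intro Suc.IH) auto
  have "w ! n = b" using w by (auto simp: nth_append)
  hence b: "1 \<le> b" "b < K" using Suc.prems(3)[of n] Suc.hyps by auto
  obtain p q r s where v: "lin_word v = (p, q, r, s)" by (metis prod_cases4)
  have lw: "lin_word w = (b * p + r, b * q + s, p, q)"
    by (simp add: w lin_word_snoc v lin_step_def)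
  have v': "1 \<le> r" "r \<le> p" "p \<le> K * r" "q \<le> K * p" "s \<le> K * r" "n \<le> p + 2"
    using IH by (auto simp: v balanced_def)
  have bp: "p \<le> b * p" using b by simp
  have pr: "p \<le> b * p + r" "Suc n \<le> b * p + r + 2" using bp v' by linarith+
  have "b * p + r \<le> (b + 1) * p" using v' by simp
  also have "\<dots> \<le> K * p" using b by (intro mult_right_mono) auto
  finally have 1: "b * p + r \<le> K * p" .
  have "b * q + s \<le> b * (K * p) + K * r" using v' by (intro add_mono mult_left_mono) auto
  hence 2: "b * q + s \<le> K * (b * p + r)" by (simp add: algebra_simps)
  from v' pr 1 2 show ?case unfolding lw balanced_def by simp
qed

section \<open>Perturbations that are small together with their Lipschitz constants\<close>

text \<open>The sup norm and the Lipschitz constant of \<open>f\<close> on \<open>D\<close> are both at most \<open>M\<close>. Such functions form an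
algebra, so that closeness in this sense passes from the coordinates to every polynomial in them. It
replaces closeness of derivatives.\<close>

definition lip_bounded :: "'a::metric_space set \<Rightarrow> real \<Rightarrow> ('a \<Rightarrow> real) \<Rightarrow> bool" where
  "lip_bounded D M f \<longleftrightarrow> (\<forall>P\<in>D. \<bar>f P\<bar> \<le> M) \<and> (\<forall>P\<in>D. \<forall>Q\<in>D. \<bar>f P - f Q\<bar> \<le> M * dist P Q)"

lemma lip_boundedD:
  assumes "lip_bounded D M f" "P \<in> D"
  shows "\<bar>f P\<bar> \<le> M" "Q \<in> D \<Longrightarrow> \<bar>f P - f Q\<bar> \<le> M * dist P Q"
  using assms by (auto simp: lip_bounded_def)

lemma lip_bounded_mono: "lip_bounded D M f \<Longrightarrow> M \<le> N \<Longrightarrow> lip_bounded D N f"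
  unfolding lip_bounded_def by (meson mult_right_mono order_trans zero_le_dist)

lemma lip_bounded_nonneg: "lip_bounded D M f \<Longrightarrow> P \<in> D \<Longrightarrow> M \<ge> 0"
  unfolding lip_bounded_def by force

lemma lip_bounded_add:
  assumes "lip_bounded D M f" "lip_bounded D N g"
  shows "lip_bounded D (M + N) (\<lambda>P. f P + g P)"
  unfolding lip_bounded_def
proof (intro conjI ballI)
  fix P assume D: "P \<in> D"
  have "\<bar>f P\<bar> \<le> M" "\<bar>g P\<bar> \<le> N" using assms D by (auto simp: lip_bounded_def)
  thus "\<bar>f P + g P\<bar> \<le> M + N" by linarith
next
  fix P Q assume D: "P \<in> D" "Q \<in> D"
  have "\<bar>f P - f Q\<bar> \<le> M * dist P Q" "\<bar>g P - g Q\<bar> \<le> N * dist P Q"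
    using assms D by (auto simp: lip_bounded_def)
  moreover have "(M + N) * dist P Q = M * dist P Q + N * dist P Q" by (simp add: algebra_simps)
  ultimately show "\<bar>f P + g P - (f Q + g Q)\<bar> \<le> (M + N) * dist P Q" by linarith
qed

lemma lip_bounded_mult:
  assumes "lip_bounded D M f" "lip_bounded D N g"
  shows "lip_bounded D (2 * M * N) (\<lambda>P. f P * g P)"
  unfolding lip_bounded_def
proof (intro conjI ballI)
  fix P assume P: "P \<in> D"
  have b: "\<bar>f P\<bar> \<le> M" "\<bar>g P\<bar> \<le> N" using assms P by (auto simp: lip_bounded_def)
  have MN: "M \<ge> 0" "N \<ge> 0" using lip_bounded_nonneg assms P by blast+
  have "\<bar>f P\<bar> * \<bar>g P\<bar> \<le> M * N" using b MN by (intro mult_mono) auto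
  moreover have "0 \<le> M * N" using MN by simp
  ultimately show "\<bar>f P * g P\<bar> \<le> 2 * M * N" by (simp add: abs_mult)
next
  fix P Q assume D: "P \<in> D" "Q \<in> D"
  have b: "\<bar>f P\<bar> \<le> M" "\<bar>g Q\<bar> \<le> N" "\<bar>f P - f Q\<bar> \<le> M * dist P Q" "\<bar>g P - g Q\<bar> \<le> N * dist P Q"
    using assms D by (auto simp: lip_bounded_def)
  have MN: "M \<ge> 0" "N \<ge> 0" using lip_bounded_nonneg assms D by blast+
  have "f P * g P - f Q * g Q = f P * (g P - g Q) + (f P - f Q) * g Q"
    by (simp add: algebra_simps)
  hence "\<bar>f P * g P - f Q * g Q\<bar> \<le> \<bar>f P\<bar> * \<bar>g P - g Q\<bar> + \<bar>f P - f Q\<bar> * \<bar>g Q\<bar>"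
    by (metis abs_mult abs_triangle_ineq)
  also have "\<dots> \<le> M * (N * dist P Q) + (M * dist P Q) * N"
    using b MN by (intro add_mono mult_mono) auto
  finally show "\<bar>f P * g P - f Q * g Q\<bar> \<le> 2 * M * N * dist P Q" by (simp add: algebra_simps)
qed

definition perturbation :: "'a::metric_space set \<Rightarrow> (real \<Rightarrow> 'a \<Rightarrow> real) \<Rightarrow> bool" where
  "perturbation D f \<longleftrightarrow> (\<exists>M\<ge>0. lip_bounded D M (f 0)) \<and>
     (\<forall>e>0. \<forall>\<^sub>F s in at_right 0. lip_bounded D e (\<lambda>P. f s P - f 0 P))"

lemma perturbation_fixed:
  assumes "lip_bounded D M f" "M \<ge> 0"
  shows "perturbation D (\<lambda>s. f)"
  using assms unfolding perturbation_def by (auto simp: lip_bounded_def)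

lemma perturbation_add:
  assumes f: "perturbation D f" and g: "perturbation D g"
  shows "perturbation D (\<lambda>s P. f s P + g s P)"
  unfolding perturbation_def
proof (intro conjI allI impI)
  obtain M N where "M \<ge> 0" "N \<ge> 0" "lip_bounded D M (f 0)" "lip_bounded D N (g 0)"
    using f g by (auto simp: perturbation_def)
  thus "\<exists>M\<ge>0. lip_bounded D M (\<lambda>P. f 0 P + g 0 P)"
    by (intro exI[of _ "M + N"]) (auto intro: lip_bounded_add)
next
  fix e :: real assume "e > 0"
  hence "\<forall>\<^sub>F s in at_right 0. lip_bounded D (e/2) (\<lambda>P. f s P - f 0 P)"
        "\<forall>\<^sub>F s in at_right 0. lip_bounded D (e/2) (\<lambda>P. g s P - g 0 P)"
    using f g unfolding perturbation_def by (metis half_gt_zero)+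
  thus "\<forall>\<^sub>F s in at_right 0. lip_bounded D e (\<lambda>P. f s P + g s P - (f 0 P + g 0 P))"
  proof eventually_elim
    case (elim s)
    from lip_bounded_add[OF elim] show ?case by (simp add: algebra_simps)
  qed
qed

lemma perturbation_mult:
  assumes f: "perturbation D f" and g: "perturbation D g"
  shows "perturbation D (\<lambda>s P. f s P * g s P)"
proof -
  obtain M N where MN: "M \<ge> 0" "N \<ge> 0" "lip_bounded D M (f 0)" "lip_bounded D N (g 0)"
    using f g by (auto simp: perturbation_def)
  show ?thesis
    unfolding perturbation_def
  proof (intro conjI allI impI)
    show "\<exists>M\<ge>0. lip_bounded D M (\<lambda>P. f 0 P * g 0 P)"
      using MN by (intro exI[of _ "2 * M * N"]) (auto intro: lip_bounded_mult)
  next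
    fix e :: real assume e: "e > 0"
    define d where "d = min 1 (e / (2 * (1 + M + N)))"
    have d: "d > 0" "d \<le> 1" using e MN by (auto simp: d_def)
    have "d \<le> e / (2 * (1 + M + N))" by (simp add: d_def)
    hence d_e: "2 * d * (1 + M + N) \<le> e" using MN by (simp add: field_simps)
    have "\<forall>\<^sub>F s in at_right 0. lip_bounded D d (\<lambda>P. f s P - f 0 P)"
         "\<forall>\<^sub>F s in at_right 0. lip_bounded D d (\<lambda>P. g s P - g 0 P)"
      using f g d unfolding perturbation_def by auto
    thus "\<forall>\<^sub>F s in at_right 0. lip_bounded D e (\<lambda>P. f s P * g s P - f 0 P * g 0 P)"
    proof eventually_elim
      case (elim s)
      have "lip_bounded D (2 * d * d + 2 * d * N + 2 * M * d)
              (\<lambda>P. (f s P - f 0 P) * (g s P - g 0 P) + (f s P - f 0 P) * g 0 P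
                     + f 0 P * (g s P - g 0 P))"
        by (intro lip_bounded_add lip_bounded_mult elim MN)
      moreover have "2 * d * d + 2 * d * N + 2 * M * d \<le> e"
      proof -
        have "2 * d * d \<le> 2 * d * 1" using d by (intro mult_left_mono) auto
        with d_e show ?thesis by (simp add: algebra_simps)
      qed
      ultimately have "lip_bounded D e
              (\<lambda>P. (f s P - f 0 P) * (g s P - g 0 P) + (f s P - f 0 P) * g 0 P
                     + f 0 P * (g s P - g 0 P))"
        by (rule lip_bounded_mono)
      thus ?case by (simp add: algebra_simps)
    qed
  qed
qed

lemma perturbation_diff:
  assumes "perturbation D f" "perturbation D g"
  shows "perturbation D (\<lambda>s P. f s P - g s P)"
proof -
  have "perturbation D (\<lambda>s P::'a. -1 :: real)"
    by (rule perturbation_fixed[of D 1]) (auto simp: lip_bounded_def)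
  from perturbation_add[OF assms(1) perturbation_mult[OF this assms(2)]]
  show ?thesis by simp
qed

lemma sqrt_diff_eq:
  assumes "x > 0" "y > 0"
  shows "sqrt x - sqrt y = (x - y) / (sqrt x + sqrt y)"
proof -
  have "(sqrt x - sqrt y) * (sqrt x + sqrt y) = x - y"
    using assms by (simp add: algebra_simps)
  moreover have "sqrt x + sqrt y > 0" using assms by (intro add_pos_pos) auto
  ultimately show ?thesis by (simp add: field_simps)
qed

text \<open>The coordinate \<open>z\<close> on the invariant surface of level \<open>s\<close> involves the square root of \<open>g + s\<close>. Its
difference to the square root of \<open>g\<close> is small with its Lipschitz constant only where \<open>g\<close> stays
away from 0. This is where the region excluded by the cells below matters.\<close>

lemma perturbation_sqrt:
  assumes g: "lip_bounded D M g" and \<rho>: "\<rho> > 0" and low: "\<And>P. P \<in> D \<Longrightarrow> \<rho>\<^sup>2 \<le> g P" and M: "M \<ge> 0"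
  shows "perturbation D (\<lambda>s P. sqrt (g P + s))"
  unfolding perturbation_def
proof (intro conjI allI impI)
  have ge: "\<rho> \<le> sqrt (g P)" if "P \<in> D" for P
    using low[OF that] by (rule real_le_rsqrt)
  have pos: "g P > 0" if "P \<in> D" for P
    using low[OF that] \<rho> by (meson less_le_trans zero_less_power)
  have gd: "\<bar>g P - g Q\<bar> \<le> M * dist P Q" if "P \<in> D" "Q \<in> D" for P Q
    using g that by (auto simp: lip_bounded_def)
  have "lip_bounded D (sqrt M + M / (2 * \<rho>)) (\<lambda>P. sqrt (g P + 0))"
    unfolding lip_bounded_def
  proof (intro conjI ballI)
    fix P assume P: "P \<in> D"
    have "sqrt (g P) \<le> sqrt M" using g P by (force simp: lip_bounded_def)
    moreover have "0 \<le> M / (2 * \<rho>)" using M \<rho> by simp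
    moreover have "\<bar>sqrt (g P + 0)\<bar> = sqrt (g P)" using pos[OF P] by simp
    ultimately show "\<bar>sqrt (g P + 0)\<bar> \<le> sqrt M + M / (2 * \<rho>)" by linarith
  next
    fix P Q assume D: "P \<in> D" "Q \<in> D"
    have "0 < sqrt (g P) + sqrt (g Q)" using pos D by (intro add_pos_pos) auto
    hence "\<bar>sqrt (g P) - sqrt (g Q)\<bar> = \<bar>g P - g Q\<bar> / (sqrt (g P) + sqrt (g Q))"
      using pos D by (subst sqrt_diff_eq) (auto simp: abs_divide)
    also have "\<dots> \<le> (M * dist P Q) / (\<rho> + \<rho>)"
      using gd[OF D] ge D \<rho> M by (intro frac_le add_mono) auto
    also have "\<dots> \<le> (sqrt M + M / (2 * \<rho>)) * dist P Q"
      using M by (simp add: algebra_simps)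
    finally show "\<bar>sqrt (g P + 0) - sqrt (g Q + 0)\<bar> \<le> (sqrt M + M / (2 * \<rho>)) * dist P Q" by simp
  qed
  thus "\<exists>M\<ge>0. lip_bounded D M (\<lambda>P. sqrt (g P + 0))"
    using M \<rho> by (intro exI[of _ "sqrt M + M / (2 * \<rho>)"]) auto
  fix e :: real assume e: "e > 0"
  define A where "A = 1 / \<rho> + M / \<rho> ^ 3"
  have A: "A > 0" using \<rho> M by (auto simp: A_def intro: add_pos_nonneg)
  have "\<forall>\<^sub>F s in at_right 0. 0 < s \<and> s < e / A"
    using e A by (auto simp: eventually_at_right_less eventually_conj_iff
        intro: eventually_at_rightI[of 0 "e / A"])
  thus "\<forall>\<^sub>F s in at_right 0. lip_bounded D e (\<lambda>P. sqrt (g P + s) - sqrt (g P + 0))"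
  proof eventually_elim
    case (elim s)
    define d where "d = (\<lambda>P. sqrt (g P + s) - sqrt (g P))"
    have d: "0 \<le> d P" "d P \<le> s / \<rho>" if P: "P \<in> D" for P
    proof -
      show "0 \<le> d P" using elim by (simp add: d_def)
      have "d P = s / (sqrt (g P + s) + sqrt (g P))"
        unfolding d_def using pos[OF P] elim by (subst sqrt_diff_eq) auto
      also have "\<dots> \<le> s / \<rho>"
      proof (rule divide_left_mono)
        have "0 \<le> sqrt (g P + s)" using pos[OF P] elim by simp
        thus le: "\<rho> \<le> sqrt (g P + s) + sqrt (g P)" using ge[OF P] by linarith
        show "0 < (sqrt (g P + s) + sqrt (g P)) * \<rho>"
          using le \<rho> by (intro mult_pos_pos) linarith+
      qed (use elim in simp)
      finally show "d P \<le> s / \<rho>" .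
    qed
    have "lip_bounded D (A * s) d"
      unfolding lip_bounded_def
    proof (intro conjI ballI)
      fix P assume P: "P \<in> D"
      have "d P \<le> s / \<rho> + M / \<rho> ^ 3 * s" using d[OF P] M \<rho> elim by (auto intro: add_increasing2)
      thus "\<bar>d P\<bar> \<le> A * s" using d[OF P] by (simp add: A_def algebra_simps)
    next
      fix P Q assume D: "P \<in> D" "Q \<in> D"
      define a where "a = sqrt (g P) + sqrt (g Q)"
      have a: "a \<ge> 2 * \<rho>" using ge[OF D(1)] ge[OF D(2)] unfolding a_def by linarith
      have b: "a + d P + d Q > 0" using a d D \<rho> by (smt (verit))
      have "sqrt (g P + s) - sqrt (g Q + s) = (g P - g Q) / (a + d P + d Q)"
        using pos D elim by (subst sqrt_diff_eq) (auto simp: a_def d_def intro: add_pos_pos)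
      moreover have "sqrt (g P) - sqrt (g Q) = (g P - g Q) / a"
        using pos D by (subst sqrt_diff_eq) (auto simp: a_def)
      ultimately have "d P - d Q = (g P - g Q) / (a + d P + d Q) - (g P - g Q) / a"
        by (simp add: d_def)
      also have "\<dots> = - (g P - g Q) * (d P + d Q) / (a * (a + d P + d Q))"
        using a \<rho> b by (simp add: field_simps)
      finally have "\<bar>d P - d Q\<bar> = \<bar>g P - g Q\<bar> * (d P + d Q) / (a * (a + d P + d Q))"
        using a b \<rho> d D by (simp add: abs_mult abs_minus_commute)
      also have "\<dots> \<le> (M * dist P Q) * (s / \<rho> + s / \<rho>) / ((2 * \<rho>) * (2 * \<rho>))"
        using gd[OF D] d D a \<rho> M elim
        by (intro frac_le mult_mono add_mono) (auto intro!: mult_nonneg_nonneg add_nonneg_nonneg add_increasing2)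
      also have "\<dots> = (M / \<rho> ^ 3 / 2 * s) * dist P Q"
        using \<rho> by (simp add: field_simps power3_eq_cube)
      also have "\<dots> \<le> A * s * dist P Q"
      proof (intro mult_right_mono)
        have "0 \<le> M / \<rho> ^ 3" "0 \<le> 1 / \<rho>" using M \<rho> by auto
        moreover have "x / 2 \<le> y + x" if "0 \<le> x" "0 \<le> y" for x y :: real
          using that by simp
        ultimately show "M / \<rho> ^ 3 / 2 \<le> A" unfolding A_def by blast
      qed (use elim in auto)
      finally show "\<bar>d P - d Q\<bar> \<le> A * s * dist P Q" .
    qed
    moreover have "A * s \<le> e" using elim A by (simp add: field_simps)
    ultimately have "lip_bounded D e d" by (rule lip_bounded_mono)
    thus ?case by (simp add: d_def)
  qed
qed

definition perturbation3 :: "'a::metric_space set \<Rightarrow> (real \<Rightarrow> 'a \<Rightarrow> traces) \<Rightarrow> bool" where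
  "perturbation3 D f \<longleftrightarrow> perturbation D (\<lambda>s P. fst (f s P)) \<and>
     perturbation D (\<lambda>s P. fst (snd (f s P))) \<and> perturbation D (\<lambda>s P. snd (snd (f s P)))"

lemma perturbation3_trace_word:
  assumes "perturbation3 D f"
  shows "perturbation3 D (\<lambda>s P. trace_word w (f s P))"
proof -
  have two: "perturbation D (\<lambda>s P::'a. 2 :: real)"
    by (rule perturbation_fixed[of D 2]) (auto simp: lip_bounded_def)
  have mult: "perturbation3 D (\<lambda>s P. trace_mult (f s P))" if f: "perturbation3 D f"
    for f :: "real \<Rightarrow> 'a \<Rightarrow> traces"
    using f unfolding perturbation3_def trace_mult_def
    by (auto simp: case_prod_beta intro!: perturbation_diff perturbation_mult two)
  have mults: "perturbation3 D (\<lambda>s P. (trace_mult ^^ b) (f s P))" if f: "perturbation3 D f"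
    for f :: "real \<Rightarrow> 'a \<Rightarrow> traces" and b
    by (induction b) (use f mult in auto)
  have swap: "perturbation3 D (\<lambda>s P. trace_swap (f s P))" if f: "perturbation3 D f"
    for f :: "real \<Rightarrow> 'a \<Rightarrow> traces"
    using f unfolding perturbation3_def trace_swap_def by (auto simp: case_prod_beta)
  show ?thesis
  proof (induction w rule: rev_induct)
    case Nil
    show ?case using assms by (simp add: trace_word_def)
  next
    case (snoc b w)
    from swap[OF mults[OF snoc]] show ?case by (simp add: trace_word_def trace_step_def)
  qed
qed

section \<open>Cells of the torus\<close>

definition parity :: "int \<Rightarrow> real" where
  "parity i = (if even i then 1 else -1)"

lemma parity_cases: "parity i = 1 \<or> parity i = -1"
  by (simp add: parity_def)

lemma parity_sq [simp]: "parity i * parity i = 1" "parity i * (parity i * x) = x" "\<bar>parity i\<bar> = 1"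
  by (simp_all add: parity_def)

lemma cos_sin_cell:
  "cos \<theta> = parity i * cos (\<theta> - of_int i * pi)" "sin \<theta> = parity i * sin (\<theta> - of_int i * pi)"
proof -
  have c: "cos (of_int i * pi) = parity i" by (simp add: parity_def cos_npi_int mult.commute)
  have s: "sin (of_int i * pi) = 0" by (metis mult.commute sin_npi_int)
  show "cos \<theta> = parity i * cos (\<theta> - of_int i * pi)"
    using c s by (simp add: cos_diff algebra_simps)
  show "sin \<theta> = parity i * sin (\<theta> - of_int i * pi)"
    using c s by (simp add: sin_diff algebra_simps)
qed

text \<open>On a cell with \<open>\<zeta> > 0\<close> the cosine is a bi-Lipschitz coordinate.\<close>

definition cell :: "real \<Rightarrow> int \<Rightarrow> real set" where
  "cell \<zeta> i = {of_int i * pi + \<zeta>..of_int i * pi + pi - \<zeta>}"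

lemma sin_ge_sin:
  assumes "0 < \<zeta>" "\<zeta> \<le> x" "x \<le> pi - \<zeta>"
  shows "sin \<zeta> \<le> sin x"
proof (cases "x \<le> pi / 2")
  case True
  thus ?thesis using assms by (intro sin_monotone_2pi_le) auto
next
  case False
  have "sin \<zeta> \<le> sin (pi - x)" using assms False by (intro sin_monotone_2pi_le) auto
  thus ?thesis by simp
qed

lemma cos_expanding:
  assumes "0 < \<zeta>" "a \<in> {\<zeta>..pi - \<zeta>}" "b \<in> {\<zeta>..pi - \<zeta>}"
  shows "sin \<zeta> * \<bar>a - b\<bar> \<le> \<bar>cos a - cos b\<bar>"
proof -
  have *: "sin \<zeta> * (b - a) \<le> \<bar>cos a - cos b\<bar>"
    if ab: "a \<in> {\<zeta>..pi - \<zeta>}" "b \<in> {\<zeta>..pi - \<zeta>}" "a < b" for a b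
  proof -
    obtain z where z: "a < z" "z < b" "cos b - cos a = (b - a) * (- sin z)"
      using MVT2[OF ab(3), of cos "\<lambda>x. - sin x"] by (auto intro: DERIV_cos)
    have "sin \<zeta> \<le> sin z" using that z assms(1) by (intro sin_ge_sin) auto
    hence "(b - a) * sin \<zeta> \<le> (b - a) * sin z" using that by (intro mult_left_mono) auto
    thus ?thesis using z(3) by (simp add: mult.commute)
  qed
  show ?thesis
    using *[of a b] *[of b a] assms by (cases a b rule: linorder_cases) (auto simp: abs_minus_commute)
qed

lemma cell_bounds:
  assumes "0 < \<zeta>" "\<theta> \<in> cell \<zeta> i"
  shows "sin \<zeta> \<le> parity i * sin \<theta>" "\<bar>cos \<theta>\<bar> \<le> cos \<zeta>"
proof -
  define x where "x = \<theta> - of_int i * pi"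
  have x: "\<zeta> \<le> x" "x \<le> pi - \<zeta>" using assms by (auto simp: cell_def x_def)
  show "sin \<zeta> \<le> parity i * sin \<theta>"
    using sin_ge_sin[OF assms(1) x] by (simp add: cos_sin_cell(2)[of \<theta> i] x_def)
  have "cos x \<le> cos \<zeta>" using x assms(1) by (intro cos_monotone_0_pi_le) auto
  moreover have "cos (pi - \<zeta>) \<le> cos x" using x assms(1) by (intro cos_monotone_0_pi_le) auto
  ultimately have "\<bar>cos x\<bar> \<le> cos \<zeta>" by simp
  thus "\<bar>cos \<theta>\<bar> \<le> cos \<zeta>" by (simp add: cos_sin_cell(1)[of \<theta> i] x_def abs_mult)
qed

lemma cell_cos_expanding:
  assumes "0 < \<zeta>" "a \<in> cell \<zeta> i" "b \<in> cell \<zeta> i"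
  shows "sin \<zeta> * \<bar>a - b\<bar> \<le> \<bar>cos a - cos b\<bar>"
proof -
  have "sin \<zeta> * \<bar>(a - of_int i * pi) - (b - of_int i * pi)\<bar>
          \<le> \<bar>cos (a - of_int i * pi) - cos (b - of_int i * pi)\<bar>"
    using assms by (intro cos_expanding) (auto simp: cell_def)
  also have "\<dots> = \<bar>parity i * (cos (a - of_int i * pi) - cos (b - of_int i * pi))\<bar>"
    by (simp add: abs_mult)
  also have "\<dots> = \<bar>cos a - cos b\<bar>"
    by (simp add: cos_sin_cell(1)[of a i] cos_sin_cell(1)[of b i] right_diff_distrib)
  finally show ?thesis by simp
qed

lemma cell_near:
  assumes "\<theta> \<in> cell (3/4 * \<eta>) i" "\<bar>\<theta>' - \<theta>\<bar> \<le> \<eta> / 4"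
  shows "\<theta>' \<in> cell (\<eta>/2) i"
  using assms unfolding cell_def atLeastAtMost_iff by (intro conjI; linarith)

text \<open>A value near \<open>cos \<theta>\<close> is the cosine of an angle near \<open>\<theta>\<close>, given by the branch of the arc cosine that
belongs to the cell of \<open>\<theta>\<close>. The constant \<open>d\<close> is the modulus of continuity of \<open>arccos\<close> at \<open>e\<close>.\<close>

lemma cell_lift:
  assumes x: "\<bar>x\<bar> \<le> 1" and \<theta>: "\<theta> \<in> cell 0 i" and close: "\<bar>x - cos \<theta>\<bar> \<le> e"
    and e: "\<And>x y. x \<in> {-1..1} \<Longrightarrow> y \<in> {-1..1} \<Longrightarrow> \<bar>x - y\<bar> \<le> e \<Longrightarrow> \<bar>arccos x - arccos y\<bar> \<le> d"
  defines "\<psi> \<equiv> of_int i * pi + arccos (parity i * x)"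
  shows "cos \<psi> = x" "\<bar>\<psi> - \<theta>\<bar> \<le> d"
proof -
  have px: "parity i * x \<in> {-1..1}" using x parity_cases[of i] by auto
  have "cos \<psi> = parity i * cos (arccos (parity i * x))"
    by (subst cos_sin_cell(1)[of _ i]) (simp add: \<psi>_def)
  also have "\<dots> = x" using px by simp
  finally show "cos \<psi> = x" .
  have "arccos (cos (\<theta> - of_int i * pi)) = \<theta> - of_int i * pi"
    using \<theta> by (intro arccos_cos) (auto simp: cell_def)
  moreover have "\<bar>arccos (parity i * x) - arccos (cos (\<theta> - of_int i * pi))\<bar> \<le> d"
  proof (rule e[OF px])
    have "parity i * x - cos (\<theta> - of_int i * pi) = parity i * (x - cos \<theta>)"
      by (simp add: cos_sin_cell(1)[of \<theta> i] right_diff_distrib)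
    thus "\<bar>parity i * x - cos (\<theta> - of_int i * pi)\<bar> \<le> e" using close by (simp add: abs_mult)
  qed auto
  ultimately show "\<bar>\<psi> - \<theta>\<bar> \<le> d" by (simp add: \<psi>_def algebra_simps)
qed

text \<open>The level \<open>s\<close> surface of the Fricke invariant is quadratic in \<open>z\<close>. Over a given point \<open>(x, y)\<close> it has
two points, which \<open>\<sigma> = 1\<close> and \<open>\<sigma> = -1\<close> distinguish. For angles in the cells \<open>i\<close> and \<open>j\<close> the torus
point \<open>(\<theta>\<^sub>1, \<theta>\<^sub>2)\<close> lies on the sheet with \<open>\<sigma> = (-1)\<^sup>i\<^sup>+\<^sup>j\<close>.\<close>

definition sheet :: "real \<Rightarrow> real \<Rightarrow> real \<times> real \<Rightarrow> traces" where
  "sheet \<sigma> s = (\<lambda>(x, y). (x, y, x * y - \<sigma> * sqrt ((1 - x\<^sup>2) * (1 - y\<^sup>2) + s)))"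

lemma fricke_sheet:
  assumes "\<sigma>\<^sup>2 = 1" "\<bar>x\<bar> \<le> 1" "\<bar>y\<bar> \<le> 1" "s \<ge> 0"
  shows "fricke (sheet \<sigma> s (x, y)) = s"
proof -
  define r where "r = sqrt ((1 - x\<^sup>2) * (1 - y\<^sup>2) + s)"
  have "x\<^sup>2 \<le> 1" "y\<^sup>2 \<le> 1" using assms abs_square_le_1 by auto
  hence r: "r\<^sup>2 = (1 - x\<^sup>2) * (1 - y\<^sup>2) + s" using assms by (simp add: r_def)
  have "fricke (sheet \<sigma> s (x, y)) = x\<^sup>2 + y\<^sup>2 - x\<^sup>2 * y\<^sup>2 + \<sigma>\<^sup>2 * r\<^sup>2 - 1"
    unfolding fricke_def sheet_def prod.case r_def[symmetric]
    by (simp add: power2_eq_square algebra_simps)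
  also have "\<dots> = s" using r assms(1) by (simp add: algebra_simps)
  finally show ?thesis .
qed

lemma eq_sheet:
  assumes fr: "fricke (x, y, z) = s" and \<sigma>: "\<sigma>\<^sup>2 = 1" and sign: "\<sigma> * (z - x * y) < 0"
  shows "(x, y, z) = sheet \<sigma> s (x, y)"
proof -
  have "(\<sigma> * (z - x * y))\<^sup>2 = (z - x * y)\<^sup>2" using \<sigma> by (simp add: power_mult_distrib)
  also have "\<dots> = (1 - x\<^sup>2) * (1 - y\<^sup>2) + s"
    using fr by (simp add: fricke_def power2_eq_square algebra_simps)
  finally have "sqrt ((1 - x\<^sup>2) * (1 - y\<^sup>2) + s) = - (\<sigma> * (z - x * y))"
    using sign by (metis abs_of_neg real_sqrt_abs)
  hence "x * y - \<sigma> * sqrt ((1 - x\<^sup>2) * (1 - y\<^sup>2) + s) = x * y + \<sigma>\<^sup>2 * (z - x * y)"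
    by (simp add: power2_eq_square)
  thus ?thesis using \<sigma> by (simp add: sheet_def)
qed

lemma sheet_0_cos:
  assumes "0 \<le> \<sigma> * (sin u * sin v)" and "\<sigma> = 1 \<or> \<sigma> = -1"
  shows "sheet \<sigma> 0 (cos u, cos v) = (cos u, cos v, cos (u + v))"
proof -
  have "(1 - (cos u)\<^sup>2) * (1 - (cos v)\<^sup>2) + 0 = (sin u * sin v)\<^sup>2"
    by (simp add: sin_squared_eq power_mult_distrib)
  hence "sqrt ((1 - (cos u)\<^sup>2) * (1 - (cos v)\<^sup>2) + 0) = \<bar>sin u * sin v\<bar>"
    by (metis real_sqrt_abs)
  hence "\<sigma> * sqrt ((1 - (cos u)\<^sup>2) * (1 - (cos v)\<^sup>2) + 0) = sin u * sin v"
    using assms by auto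
  thus ?thesis by (simp add: sheet_def cos_add)
qed

abbreviation square :: "real \<Rightarrow> (real \<times> real) set" where
  "square c \<equiv> {-c..c} \<times> {-c..c}"

lemma perturbation3_sheet:
  assumes c: "0 \<le> c" "c < 1"
  shows "perturbation3 (square c) (\<lambda>s. sheet \<sigma> s)"
proof -
  have lip1: "lip_bounded (square c) 1 fst" "lip_bounded (square c) 1 snd"
  proof -
    have "\<bar>fst P - fst Q\<bar> \<le> 1 * dist P Q" "\<bar>snd P - snd Q\<bar> \<le> 1 * dist P Q" for P Q :: "real \<times> real"
      using dist_fst_le[of P Q] dist_snd_le[of P Q] by (simp_all add: dist_real_def)
    moreover have "\<bar>fst P\<bar> \<le> 1" "\<bar>snd P\<bar> \<le> 1" if "P \<in> square c" for P
      using that c by auto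
    ultimately show "lip_bounded (square c) 1 fst" "lip_bounded (square c) 1 snd"
      unfolding lip_bounded_def by blast+
  qed
  have const: "lip_bounded (square c) \<bar>k\<bar> (\<lambda>_. k)" for k :: real
    by (auto simp: lip_bounded_def)
  have sq: "lip_bounded (square c) 5 (\<lambda>P. 1 - (f P)\<^sup>2)" if "lip_bounded (square c) 1 f" for f
    using lip_bounded_add[OF const[of 1] lip_bounded_mult[OF const[of "-1"] lip_bounded_mult[OF that that]]]
    by (auto simp: power2_eq_square intro: lip_bounded_mono)
  note M = lip_bounded_mult[OF sq[OF lip1(1)] sq[OF lip1(2)]]
  have low: "(1 - c\<^sup>2)\<^sup>2 \<le> (1 - (fst P)\<^sup>2) * (1 - (snd P)\<^sup>2)" if "P \<in> square c" for P
  proof -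
    have "\<bar>fst P\<bar> \<le> c" "\<bar>snd P\<bar> \<le> c" using that by auto
    hence "(fst P)\<^sup>2 \<le> c\<^sup>2" "(snd P)\<^sup>2 \<le> c\<^sup>2" using c by (auto simp: abs_le_square_iff[symmetric])
    moreover have "c\<^sup>2 \<le> 1" using c by (simp add: power_le_one)
    ultimately show ?thesis unfolding power2_eq_square[of "1 - c\<^sup>2"] by (intro mult_mono) auto
  qed
  have "1 - c\<^sup>2 > 0" using c by (simp add: power_less_one_iff abs_square_less_1)
  hence root: "perturbation (square c) (\<lambda>s P. sqrt ((1 - (fst P)\<^sup>2) * (1 - (snd P)\<^sup>2) + s))"
    by (intro perturbation_sqrt[OF M _ low]) auto
  have fix1: "perturbation (square c) (\<lambda>s. fst)" "perturbation (square c) (\<lambda>s. snd)"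
    by (rule perturbation_fixed[of _ 1]; use lip1 in simp)+
  have fix2: "perturbation (square c) (\<lambda>s _. \<sigma>)"
    by (rule perturbation_fixed[OF const]) simp
  show ?thesis
    unfolding perturbation3_def sheet_def
    using fix1 perturbation_diff[OF perturbation_mult[OF fix1] perturbation_mult[OF fix2 root]]
    by (simp add: case_prod_beta)
qed

section \<open>Expansion of admissible curves\<close>

text \<open>The end \<open>t2\<close> is the first time at which \<open>u\<close> reaches \<open>U2\<close>, and \<open>t1\<close> is the last time before \<open>t2\<close> at
which \<open>u\<close> is at most \<open>U1\<close>.\<close>

lemma crossing_subinterval:
  fixes u :: "real \<Rightarrow> real"
  assumes u: "continuous_on {a..b} u" and ab: "a \<le> b"
    and U: "u a \<le> U1" "U1 < U2" "U2 \<le> u b"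
  obtains t1 t2 where "a \<le> t1" "t1 \<le> t2" "t2 \<le> b" "u t1 = U1" "u t2 = U2"
    "\<And>t. t \<in> {t1..t2} \<Longrightarrow> u t \<in> {U1..U2}"
proof -
  have clos: "compact {t \<in> {a..c}. u t \<in> C}" if "closed C" "continuous_on {a..c} u" for c C
  proof -
    have "{t \<in> {a..c}. u t \<in> C} = {a..c} \<inter> ({a..c} \<inter> u -` C)" by auto
    also have "compact \<dots>"
      using that by (intro compact_Int_closed continuous_closed_preimage) auto
    finally show ?thesis .
  qed
  have "compact {t \<in> {a..b}. u t \<in> {U2..}}"
    using u by (intro clos) auto
  moreover have "b \<in> {t \<in> {a..b}. u t \<in> {U2..}}" using ab U by auto
  ultimately obtain t2 where t2: "t2 \<in> {a..b}" "u t2 \<ge> U2" "\<And>t. t \<in> {a..b} \<Longrightarrow> u t \<ge> U2 \<Longrightarrow> t2 \<le> t"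
    using compact_attains_inf[of "{t \<in> {a..b}. u t \<in> {U2..}}"] by auto
  have u2: "continuous_on {a..t2} u" using u t2 by (auto intro: continuous_on_subset)
  have "compact {t \<in> {a..t2}. u t \<in> {..U1}}"
    using u2 by (intro clos) auto
  moreover have "a \<in> {t \<in> {a..t2}. u t \<in> {..U1}}" using t2 U by auto
  ultimately obtain t1 where t1: "t1 \<in> {a..t2}" "u t1 \<le> U1" "\<And>t. t \<in> {a..t2} \<Longrightarrow> u t \<le> U1 \<Longrightarrow> t \<le> t1"
    using compact_attains_sup[of "{t \<in> {a..t2}. u t \<in> {..U1}}"] by auto
  have eq2: "u t2 = U2"
  proof -
    obtain x where "a \<le> x" "x \<le> t2" "u x = U2"
      using IVT'[of u a U2 t2] u2 t2 U by auto
    thus ?thesis using t2(3)[of x] t2(1) by auto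
  qed
  have u3: "continuous_on {t1..t2} u" using u2 t1 by (auto intro: continuous_on_subset)
  have eq1: "u t1 = U1"
  proof -
    obtain x where "t1 \<le> x" "x \<le> t2" "u x = U1"
      using IVT'[of u t1 U1 t2] u3 t1 eq2 U by auto
    thus ?thesis using t1(3)[of x] t1(1) by auto
  qed
  have "u t \<in> {U1..U2}" if t: "t \<in> {t1..t2}" for t
  proof (rule ccontr)
    assume "u t \<notin> {U1..U2}"
    then consider "u t < U1" | "u t > U2" by force
    thus False
    proof cases
      case 1
      with t1(3)[of t] t t1(1) have "t = t1" by auto
      with 1 eq1 show False by simp
    next
      case 2
      with t2(3)[of t] t t1(1) t2(1) have "t = t2" by auto
      with 2 eq2 show False by simp
    qed
  qed
  with eq1 eq2 t1(1) t2(1) show ?thesis by (intro that[of t1 t2]) auto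
qed

text \<open>While \<open>u\<close> runs through the middle half of its cell, the line runs through an interval of length
\<open>\<kappa> \<pi> / 2 \<le> \<pi> / 2\<close>, which can come close to only one multiple of \<open>\<pi>\<close>. Hence the first or the last
third of this interval keeps the distance \<open>\<kappa> \<pi> / 12\<close> from all multiples of \<open>\<pi>\<close>.\<close>

lemma line_avoids_lattice:
  fixes \<kappa> d :: real
  assumes \<kappa>: "0 < \<kappa>" "\<kappa> \<le> 1"
  obtains U j where "U \<in> {of_int i * pi + pi/4..of_int i * pi + 3*pi/4 - pi/6}"
    "\<And>u. u \<in> {U..U + pi/6} \<Longrightarrow> \<kappa> * u + d \<in> cell (\<kappa> * pi / 12) j"
proof -
  define u0 where "u0 = of_int i * pi + pi/4"
  define v0 where "v0 = \<kappa> * u0 + d"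
  define j where "j = \<lfloor>v0 / pi\<rfloor>"
  define w where "w = \<kappa> * pi / 12"
  have w: "0 < w" "12 * w \<le> pi" using \<kappa> by (auto simp: w_def)
  have "of_int j \<le> v0 / pi" "v0 / pi < of_int j + 1" by (auto simp: j_def)
  hence j: "of_int j * pi \<le> v0" "v0 < of_int j * pi + pi"
    by (simp_all add: field_simps)
  have range: "\<kappa> * u + d \<in> {\<kappa> * a + d..\<kappa> * a + d + 2 * w}" if "u \<in> {a..a + pi/6}" for u a
  proof -
    have "\<kappa> * a \<le> \<kappa> * u" "\<kappa> * u \<le> \<kappa> * (a + pi/6)" using that \<kappa> by (auto intro: mult_left_mono)
    thus ?thesis by (simp add: w_def algebra_simps)
  qed
  have last: "\<kappa> * (u0 + pi/3) + d = v0 + 4 * w" by (simp add: v0_def w_def algebra_simps)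
  consider "of_int j * pi + w \<le> v0" "v0 + 2 * w \<le> of_int j * pi + pi - w"
    | "v0 < of_int j * pi + w"
    | "v0 + 2 * w > of_int j * pi + pi - w" by linarith
  thus ?thesis
  proof cases
    case 1
    show ?thesis
    proof (rule that[of u0 j])
      show "\<kappa> * u + d \<in> cell (\<kappa> * pi / 12) j" if "u \<in> {u0..u0 + pi/6}" for u
        using range[OF that] 1 by (simp add: cell_def w_def[symmetric] v0_def)
    qed (simp add: u0_def)
  next
    case 2
    show ?thesis
    proof (rule that[of "u0 + pi/3" j])
      show "\<kappa> * u + d \<in> cell (\<kappa> * pi / 12) j" if "u \<in> {u0 + pi/3..u0 + pi/3 + pi/6}" for u
        using range[OF that] 2 j w unfolding last by (simp add: cell_def w_def[symmetric])
    qed (simp add: u0_def)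
  next
    case 3
    show ?thesis
    proof (rule that[of "u0 + pi/3" "j + 1"])
      show "\<kappa> * u + d \<in> cell (\<kappa> * pi / 12) (j + 1)" if "u \<in> {u0 + pi/3..u0 + pi/3 + pi/6}" for u
        using range[OF that] 3 j w unfolding last
        by (simp add: cell_def w_def[symmetric] distrib_right)
    qed (simp add: u0_def)
  qed
qed

text \<open>These are the pieces of curves on the surface of level \<open>s\<close> that the trace map reproduces. Staying in
one cell for each angle keeps them where the angles are smooth coordinates. Both angles have to
increase because this rules out the direction that a positive matrix contracts.\<close>

definition admissible :: "real \<Rightarrow> real \<Rightarrow> (real \<Rightarrow> traces) \<Rightarrow> real \<Rightarrow> real \<Rightarrow> bool" where
  "admissible s \<eta> X a b \<longleftrightarrow> a \<le> b \<and> (\<exists>\<theta>1 \<theta>2 i j.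
     continuous_on {a..b} \<theta>1 \<and> continuous_on {a..b} \<theta>2 \<and>
     (\<forall>t\<in>{a..b}. \<theta>1 t \<in> cell (\<eta>/2) i \<and> \<theta>2 t \<in> cell (\<eta>/2) j \<and>
        X t = sheet (parity (i + j)) s (cos (\<theta>1 t), cos (\<theta>2 t))) \<and>
     \<theta>1 b - \<theta>1 a \<ge> \<eta> \<and> \<theta>2 b - \<theta>2 a \<ge> \<eta>)"

text \<open>The size \<open>e\<close> of the perturbation is chosen before the word, so that it depends only on the width
of the cells; then \<open>s\<close> is chosen small enough for the word.\<close>

definition close_word :: "real \<Rightarrow> real \<Rightarrow> real \<Rightarrow> nat list \<Rightarrow> bool" where
  "close_word c e s w \<longleftrightarrow> (\<forall>\<sigma>\<in>{1, -1}.
     lip_bounded (square c) e (\<lambda>P. fst (trace_word w (sheet \<sigma> s P)) - fst (trace_word w (sheet \<sigma> 0 P))) \<and>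
     lip_bounded (square c) e (\<lambda>P. fst (snd (trace_word w (sheet \<sigma> s P))) - fst (snd (trace_word w (sheet \<sigma> 0 P)))) \<and>
     lip_bounded (square c) e (\<lambda>P. snd (snd (trace_word w (sheet \<sigma> s P))) - snd (snd (trace_word w (sheet \<sigma> 0 P)))))"

lemma eventually_close_word:
  assumes "0 \<le> c" "c < 1" "e > 0"
  shows "\<forall>\<^sub>F s in at_right 0. close_word c e s w"
  unfolding close_word_def
  using perturbation3_trace_word[OF perturbation3_sheet[OF assms(1,2)], of w] assms(3)
  by (auto simp: perturbation3_def perturbation_def eventually_conj_iff)

text \<open>A curve on the surface of level \<open>s\<close> that is close to the torus curve \<open>(\<phi>1, \<phi>2)\<close> inherits
admissibility from it, with margins that absorb the error \<open>\<eta> / 4\<close> of the angles. The sheet is the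
same because the two points over \<open>(x, y)\<close> are further apart than the error.\<close>

lemma admissible_child:
  assumes \<eta>: "0 < \<eta>" "\<eta> \<le> pi / 12"
    and ab: "a \<le> b" "continuous_on {a..b} \<phi>1" "continuous_on {a..b} \<phi>2" "continuous_on {a..b} X"
    and cells: "\<And>t. t \<in> {a..b} \<Longrightarrow> \<phi>1 t \<in> cell (3/4 * \<eta>) i"
               "\<And>t. t \<in> {a..b} \<Longrightarrow> \<phi>2 t \<in> cell (3/4 * \<eta>) j"
    and incr: "\<phi>1 b - \<phi>1 a \<ge> 3/2 * \<eta>" "\<phi>2 b - \<phi>2 a \<ge> 3/2 * \<eta>"
    and fr: "\<And>t. t \<in> {a..b} \<Longrightarrow> fricke (X t) = s"
    and close: "\<And>t. t \<in> {a..b} \<Longrightarrow> \<bar>fst (X t) - cos (\<phi>1 t)\<bar> \<le> e"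
               "\<And>t. t \<in> {a..b} \<Longrightarrow> \<bar>fst (snd (X t)) - cos (\<phi>2 t)\<bar> \<le> e"
               "\<And>t. t \<in> {a..b} \<Longrightarrow> \<bar>snd (snd (X t)) - cos (\<phi>1 t + \<phi>2 t)\<bar> \<le> e"
    and e: "\<And>x y. x \<in> {-1..1} \<Longrightarrow> y \<in> {-1..1} \<Longrightarrow> \<bar>x - y\<bar> \<le> e \<Longrightarrow> \<bar>arccos x - arccos y\<bar> \<le> \<eta> / 4"
       "e \<le> 1 - cos (\<eta> / 2)" "4 * e \<le> (sin (\<eta> / 2))\<^sup>2" "0 < e"
  shows "admissible s \<eta> X a b"
proof -
  \<comment> \<open>The angles of \<open>X\<close>, on the branches of the arc cosine that belong to the cells of \<open>\<phi>1\<close> and \<open>\<phi>2\<close>.\<close>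
  define \<theta>1 where "\<theta>1 = (\<lambda>t. of_int i * pi + arccos (parity i * fst (X t)))"
  define \<theta>2 where "\<theta>2 = (\<lambda>t. of_int j * pi + arccos (parity j * fst (snd (X t))))"
  have cells2: "\<phi>1 t \<in> cell (\<eta>/2) i" "\<phi>2 t \<in> cell (\<eta>/2) j" "\<phi>1 t \<in> cell 0 i" "\<phi>2 t \<in> cell 0 j"
    if "t \<in> {a..b}" for t
    using cells[OF that] \<eta> by (auto simp: cell_def)
  have abs1: "\<bar>fst (X t)\<bar> \<le> 1" "\<bar>fst (snd (X t))\<bar> \<le> 1" if t: "t \<in> {a..b}" for t
    using cell_bounds(2)[OF _ cells2(1)[OF t]] cell_bounds(2)[OF _ cells2(2)[OF t]] \<eta>
          close(1,2)[OF t] e(2) by linarith+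
  have cos\<theta>: "cos (\<theta>1 t) = fst (X t)" "cos (\<theta>2 t) = fst (snd (X t))"
    and near: "\<bar>\<theta>1 t - \<phi>1 t\<bar> \<le> \<eta> / 4" "\<bar>\<theta>2 t - \<phi>2 t\<bar> \<le> \<eta> / 4" if t: "t \<in> {a..b}" for t
    using cell_lift[OF abs1(1)[OF t] cells2(3)[OF t] close(1)[OF t] e(1)]
          cell_lift[OF abs1(2)[OF t] cells2(4)[OF t] close(2)[OF t] e(1)]
    unfolding \<theta>1_def \<theta>2_def by auto
  have cell\<theta>: "\<theta>1 t \<in> cell (\<eta>/2) i" "\<theta>2 t \<in> cell (\<eta>/2) j" if t: "t \<in> {a..b}" for t
    using near[OF t] cells[OF t] by (blast intro: cell_near)+
  have "\<forall>t\<in>{a..b}. parity i * fst (X t) \<in> {-1..1}"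
    using abs1(1) parity_cases[of i] by (auto simp: abs_le_iff)
  hence c1: "continuous_on {a..b} \<theta>1" unfolding \<theta>1_def
    using ab(4) by (intro continuous_intros) auto
  have "\<forall>t\<in>{a..b}. parity j * fst (snd (X t)) \<in> {-1..1}"
    using abs1(2) parity_cases[of j] by (auto simp: abs_le_iff)
  hence c2: "continuous_on {a..b} \<theta>2" unfolding \<theta>2_def
    using ab(4) by (intro continuous_intros) auto
  have inc: "\<theta>1 b - \<theta>1 a \<ge> \<eta>" "\<theta>2 b - \<theta>2 a \<ge> \<eta>"
  proof -
    have "a \<in> {a..b}" "b \<in> {a..b}" using ab(1) by auto
    note near[OF this(1)] near[OF this(2)]
    with incr show "\<theta>1 b - \<theta>1 a \<ge> \<eta>" "\<theta>2 b - \<theta>2 a \<ge> \<eta>" by linarith+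
  qed
  have par: "parity (i + j) = parity i * parity j" by (auto simp: parity_def)
  have "X t = sheet (parity (i + j)) s (cos (\<theta>1 t), cos (\<theta>2 t))" if t: "t \<in> {a..b}" for t
  proof -
    obtain x y z where X: "X t = (x, y, z)" by (metis prod_cases3)
    define A where "A = parity i * sin (\<phi>1 t)"
    define B where "B = parity j * sin (\<phi>2 t)"
    have AB: "sin (\<eta>/2) \<le> A" "sin (\<eta>/2) \<le> B"
      using cell_bounds(1)[OF _ cells2(1)[OF t]] cell_bounds(1)[OF _ cells2(2)[OF t]] \<eta>
      by (auto simp: A_def B_def)
    have s0: "sin (\<eta>/2) > 0" using \<eta> by (intro sin_gt_zero) auto
    have "sin (\<eta>/2) * sin (\<eta>/2) \<le> A * B" using AB s0 by (intro mult_mono) auto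
    hence AB4: "4 * e \<le> A * B" using e(3) by (simp add: power2_eq_square)
    have xy: "\<bar>x * y - cos (\<phi>1 t) * cos (\<phi>2 t)\<bar> \<le> 2 * e"
    proof -
      have "x * y - cos (\<phi>1 t) * cos (\<phi>2 t) = x * (y - cos (\<phi>2 t)) + (x - cos (\<phi>1 t)) * cos (\<phi>2 t)"
        by (simp add: algebra_simps)
      also have "\<bar>\<dots>\<bar> \<le> \<bar>x\<bar> * \<bar>y - cos (\<phi>2 t)\<bar> + \<bar>x - cos (\<phi>1 t)\<bar> * \<bar>cos (\<phi>2 t)\<bar>"
        by (metis abs_mult abs_triangle_ineq)
      also have "\<dots> \<le> 1 * e + e * 1"
        using close(1,2)[OF t] abs1[OF t] X e(4) by (intro add_mono mult_mono) auto
      finally show ?thesis by simp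
    qed
    have "cos (\<phi>1 t + \<phi>2 t) - cos (\<phi>1 t) * cos (\<phi>2 t) = - (parity (i + j) * (A * B))"
      by (simp add: cos_add A_def B_def par algebra_simps)
    hence "\<bar>(z - x * y) + parity (i + j) * (A * B)\<bar> \<le> 3 * e"
      using xy close(3)[OF t] X by (auto simp: abs_le_iff)
    hence "parity (i + j) * (z - x * y) < 0"
      using AB4 e(4) parity_cases[of "i + j"] by (auto simp: abs_le_iff)
    moreover have "(parity (i + j))\<^sup>2 = 1" by (simp add: power2_eq_square)
    ultimately have "(x, y, z) = sheet (parity (i + j)) s (x, y)"
      using fr[OF t] X by (intro eq_sheet) auto
    moreover have "cos (\<theta>1 t) = x" "cos (\<theta>2 t) = y" using cos\<theta>[OF t] X by simp_all
    ultimately show ?thesis unfolding X by simp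
  qed
  thus ?thesis
    unfolding admissible_def using c1 c2 inc cell\<theta> ab(1) by blast
qed

lemma continuous_on_trace_word:
  assumes "continuous_on S f"
  shows "continuous_on S (\<lambda>t. trace_word w (f t))"
proof -
  have mult: "continuous_on S (\<lambda>t. trace_mult (g t))" if "continuous_on S g"
    for g :: "'a \<Rightarrow> traces"
    using that unfolding trace_mult_def case_prod_beta by (intro continuous_intros)
  have mults: "continuous_on S (\<lambda>t. (trace_mult ^^ b) (g t))" if "continuous_on S g"
    for g :: "'a \<Rightarrow> traces" and b
    by (induction b) (use that mult in auto)
  have swap: "continuous_on S (\<lambda>t. trace_swap (g t))" if "continuous_on S g"
    for g :: "'a \<Rightarrow> traces"
    using that unfolding trace_swap_def case_prod_beta by (intro continuous_intros)
  show ?thesis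
  proof (induction w rule: rev_induct)
    case Nil
    show ?case using assms by (simp add: trace_word_def)
  next
    case (snoc b w)
    from swap[OF mults[OF snoc]] show ?case by (simp add: trace_word_def trace_step_def)
  qed
qed

lemma sheet_0_cells:
  assumes "0 < \<eta>" "\<eta> \<le> pi" "a \<in> cell (\<eta>/2) i" "b \<in> cell (\<eta>/2) j"
  shows "sheet (parity (i + j)) 0 (cos a, cos b) = (cos a, cos b, cos (a + b))"
proof (rule sheet_0_cos)
  have "0 \<le> sin (\<eta>/2)" using assms by (intro sin_ge_zero) auto
  hence "0 \<le> parity i * sin a" "0 \<le> parity j * sin b"
    using cell_bounds(1)[OF _ assms(3)] cell_bounds(1)[OF _ assms(4)] assms(1) by auto
  hence "0 \<le> (parity i * sin a) * (parity j * sin b)" by simp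
  also have "\<dots> = parity (i + j) * (sin a * sin b)" by (auto simp: parity_def)
  finally show "0 \<le> parity (i + j) * (sin a * sin b)" .
qed (rule parity_cases)

lemma abs_cos_diff_le: "\<bar>cos x - cos y\<bar> \<le> \<bar>x - y\<bar>" for x y :: real
proof -
  have "\<bar>cos x - cos y\<bar> = 2 * \<bar>sin ((x + y) / 2)\<bar> * \<bar>sin ((y - x) / 2)\<bar>"
    by (simp add: cos_diff_cos abs_mult)
  also have "\<dots> \<le> 2 * 1 * \<bar>(y - x) / 2\<bar>"
    by (intro mult_mono abs_sin_x_le_abs_x) auto
  finally show ?thesis by simp
qed

definition xy :: "traces \<Rightarrow> real \<times> real" where
  "xy X = (fst X, fst (snd X))"

lemma xy_sheet [simp]: "xy (sheet \<sigma> s P) = P"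
  by (cases P) (simp add: xy_def sheet_def)

lemma dist_pair_le: "dist (a, b) (c, d) \<le> \<bar>a - c\<bar> + \<bar>b - d\<bar>" for a b c d :: real
  unfolding dist_Pair_Pair dist_real_def using sqrt_sum_squares_le_sum_abs[of "a - c" "b - d"] by simp

lemma abs_diff_le_dist:
  "\<bar>a - c\<bar> \<le> dist (a, b) (c, d)" "\<bar>b - d\<bar> \<le> dist (a, b) (c, d)" for a b c d :: real
  using dist_fst_le[of "(a, b)" "(c, d)"] dist_snd_le[of "(a, b)" "(c, d)"]
  by (simp_all add: dist_real_def)

text \<open>An admissible curve cannot be short in the coordinates \<open>(x, y)\<close>. With the Lipschitz bound for these
coordinates as functions of the energy, this bounds the interval of energies from below.\<close>

lemma admissible_length:
  assumes "0 < \<eta>" "\<eta> \<le> pi" "admissible s \<eta> X a b"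
  shows "sin (\<eta>/2) * \<eta> \<le> dist (xy (X a)) (xy (X b))"
proof -
  obtain \<theta>1 \<theta>2 i j where
    ab: "a \<le> b" and cells: "\<And>t. t \<in> {a..b} \<Longrightarrow> \<theta>1 t \<in> cell (\<eta>/2) i"
    and X: "\<And>t. t \<in> {a..b} \<Longrightarrow> X t = sheet (parity (i + j)) s (cos (\<theta>1 t), cos (\<theta>2 t))"
    and inc: "\<theta>1 b - \<theta>1 a \<ge> \<eta>"
    using assms(3) unfolding admissible_def by blast
  have "sin (\<eta>/2) * \<eta> \<le> sin (\<eta>/2) * \<bar>\<theta>1 a - \<theta>1 b\<bar>"
    using inc assms(1,2) by (intro mult_left_mono sin_ge_zero) auto
  also have "\<dots> \<le> \<bar>cos (\<theta>1 a) - cos (\<theta>1 b)\<bar>"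
    using cells ab assms(1) by (intro cell_cos_expanding) auto
  also have "\<dots> \<le> dist (cos (\<theta>1 a), cos (\<theta>2 a)) (cos (\<theta>1 b), cos (\<theta>2 b))"
    by (rule abs_diff_le_dist)
  finally show ?thesis using ab by (simp add: X)
qed

lemma free_coordinate_lipschitz:
  assumes \<eta>: "0 < \<eta>" "\<eta> \<le> pi"
    and cells: "a \<in> cell (\<eta>/2) i" "a' \<in> cell (\<eta>/2) i" "b \<in> cell (\<eta>/2) j" "b' \<in> cell (\<eta>/2) j"
  shows "\<bar>cos (real p * a + real q * b) - cos (real p * a' + real q * b')\<bar>
     \<le> (real p + real q) / sin (\<eta>/2) * dist (cos a, cos b) (cos a', cos b')"
proof -
  define D where "D = dist (cos a, cos b) (cos a', cos b')"
  have s: "0 < sin (\<eta>/2)" using \<eta> by (intro sin_gt_zero) auto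
  have "sin (\<eta>/2) * \<bar>a - a'\<bar> \<le> D" "sin (\<eta>/2) * \<bar>b - b'\<bar> \<le> D"
    unfolding D_def using cell_cos_expanding[OF _ cells(1,2)] cell_cos_expanding[OF _ cells(3,4)] \<eta>
      abs_diff_le_dist(1)[of "cos a" "cos a'" "cos b" "cos b'"]
      abs_diff_le_dist(2)[of "cos b" "cos b'" "cos a" "cos a'"] by fastforce+
  hence ab: "\<bar>a - a'\<bar> \<le> D / sin (\<eta>/2)" "\<bar>b - b'\<bar> \<le> D / sin (\<eta>/2)"
    using s by (simp_all add: field_simps)
  have "\<bar>cos (real p * a + real q * b) - cos (real p * a' + real q * b')\<bar>
          \<le> \<bar>(real p * a + real q * b) - (real p * a' + real q * b')\<bar>"
    by (rule abs_cos_diff_le)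
  also have "\<dots> = \<bar>real p * (a - a') + real q * (b - b')\<bar>" by (simp add: algebra_simps)
  also have "\<dots> \<le> real p * \<bar>a - a'\<bar> + real q * \<bar>b - b'\<bar>"
    by (rule order_trans[OF abs_triangle_ineq]) (simp add: abs_mult)
  also have "\<dots> \<le> real p * (D / sin (\<eta>/2)) + real q * (D / sin (\<eta>/2))"
    using ab by (intro add_mono mult_left_mono) auto
  also have "\<dots> = (real p + real q) / sin (\<eta>/2) * D" by (simp add: add_divide_distrib algebra_simps)
  finally show ?thesis by (simp add: D_def)
qed

text \<open>The Lipschitz constant of the free map in the coordinates \<open>(x, y)\<close> is of order \<open>p\<close>, and the
perturbation adds at most 1 to it in each coordinate. What matters is that the factor in front of \<open>p\<close>
does not depend on the word.\<close>

lemma admissible_lipschitz: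
  assumes \<eta>: "0 < \<eta>" "\<eta> \<le> pi"
    and lw: "lin_word w = (p, q, r, s')" and bal: "balanced K (p, q, r, s')"
    and close: "close_word (cos (\<eta>/2)) e s w" "e \<le> 1"
    and adm: "admissible s \<eta> X a b" and t: "t \<in> {a..b}" "t' \<in> {a..b}"
  shows "dist (xy (trace_word w (X t))) (xy (trace_word w (X t')))
     \<le> (2 + (2 + 2 * real K) / sin (\<eta>/2)) * real p * dist (xy (X t)) (xy (X t'))"
proof -
  obtain \<theta>1 \<theta>2 i j where
    cells: "\<And>t. t \<in> {a..b} \<Longrightarrow> \<theta>1 t \<in> cell (\<eta>/2) i" "\<And>t. t \<in> {a..b} \<Longrightarrow> \<theta>2 t \<in> cell (\<eta>/2) j"
    and X: "\<And>t. t \<in> {a..b} \<Longrightarrow> X t = sheet (parity (i + j)) s (cos (\<theta>1 t), cos (\<theta>2 t))"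
    using adm unfolding admissible_def by blast
  define \<sigma> where "\<sigma> = parity (i + j)"
  have \<sigma>: "\<sigma> \<in> {1, -1}" using parity_cases[of "i + j"] by (auto simp: \<sigma>_def)
  define P where "P = (\<lambda>t. (cos (\<theta>1 t), cos (\<theta>2 t)))"
  define D where "D = dist (P t) (P t')"
  have s: "0 < sin (\<eta>/2)" using \<eta> by (intro sin_gt_zero) auto
  have box: "P t \<in> square (cos (\<eta>/2))" if "t \<in> {a..b}" for t
    using cell_bounds(2)[OF _ cells(1)[OF that]] cell_bounds(2)[OF _ cells(2)[OF that]] \<eta>
    by (auto simp: P_def abs_le_iff)
  have free: "trace_word w (sheet \<sigma> 0 (P t)) = (cos (p * \<theta>1 t + q * \<theta>2 t), cos (r * \<theta>1 t + s' * \<theta>2 t),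
      cos ((p * \<theta>1 t + q * \<theta>2 t) + (r * \<theta>1 t + s' * \<theta>2 t)))" if "t \<in> {a..b}" for t
    unfolding \<sigma>_def P_def using sheet_0_cells[OF \<eta> cells[OF that]] trace_word_cos[OF lw] by simp
  define F where "F = (\<lambda>s P. fst (trace_word w (sheet \<sigma> s P)))"
  define G where "G = (\<lambda>s P. fst (snd (trace_word w (sheet \<sigma> s P))))"
  have lip: "lip_bounded (square (cos (\<eta>/2))) e (\<lambda>P. F s P - F 0 P)"
            "lip_bounded (square (cos (\<eta>/2))) e (\<lambda>P. G s P - G 0 P)"
    using close(1) \<sigma> by (auto simp: close_word_def F_def G_def)
  have "\<bar>(F s (P t) - F 0 (P t)) - (F s (P t') - F 0 (P t'))\<bar> \<le> e * D"
       "\<bar>(G s (P t) - G 0 (P t)) - (G s (P t') - G 0 (P t'))\<bar> \<le> e * D"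
    unfolding D_def by (rule lip_boundedD(2)[OF lip(1) box[OF t(1)] box[OF t(2)]],
        rule lip_boundedD(2)[OF lip(2) box[OF t(1)] box[OF t(2)]])
  moreover have "e * D \<le> 1 * D" using close(2) unfolding D_def by (intro mult_right_mono) auto
  moreover have "\<bar>F 0 (P t) - F 0 (P t')\<bar> \<le> (real p + real q) / sin (\<eta>/2) * D"
    unfolding F_def free[OF t(1)] free[OF t(2)] fst_conv unfolding D_def P_def
    using cells t by (intro free_coordinate_lipschitz \<eta>) auto
  moreover have "\<bar>G 0 (P t) - G 0 (P t')\<bar> \<le> (real r + real s') / sin (\<eta>/2) * D"
    unfolding G_def free[OF t(1)] free[OF t(2)] fst_conv snd_conv unfolding D_def P_def
    using cells t by (intro free_coordinate_lipschitz \<eta>) auto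
  ultimately have "\<bar>F s (P t) - F s (P t')\<bar> + \<bar>G s (P t) - G s (P t')\<bar>
      \<le> 2 * D + ((real p + real q) / sin (\<eta>/2) * D + (real r + real s') / sin (\<eta>/2) * D)"
    by linarith
  also have "\<dots> = (2 + (real p + real q + real r + real s') / sin (\<eta>/2)) * D"
    by (simp add: add_divide_distrib algebra_simps)
  also have "\<dots> \<le> (2 + (2 + 2 * real K) / sin (\<eta>/2)) * real p * D"
  proof (intro mult_right_mono)
    have b: "1 \<le> r" "r \<le> p" "q \<le> K * p" "s' \<le> K * r" using bal by (auto simp: balanced_def)
    have "K * r \<le> K * p" using b by (intro mult_left_mono) auto
    moreover have "(2 + 2 * K) * p = p + p + K * p + K * p" by (simp add: algebra_simps)
    ultimately have "p + q + r + s' \<le> (2 + 2 * K) * p" using b by linarith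
    hence "real (p + q + r + s') \<le> real ((2 + 2 * K) * p)" by (rule of_nat_mono)
    hence "real p + real q + real r + real s' \<le> (2 + 2 * real K) * real p" by (simp add: algebra_simps)
    hence "(real p + real q + real r + real s') / sin (\<eta>/2) \<le> (2 + 2 * real K) * real p / sin (\<eta>/2)"
      using s by (intro divide_right_mono) auto
    moreover have "1 \<le> real p" using b by simp
    ultimately show "2 + (real p + real q + real r + real s') / sin (\<eta>/2)
        \<le> (2 + (2 + 2 * real K) / sin (\<eta>/2)) * real p"
      by (simp add: distrib_right)
  qed (simp add: D_def)
  finally have "\<bar>F s (P t) - F s (P t')\<bar> + \<bar>G s (P t) - G s (P t')\<bar>
      \<le> (2 + (2 + 2 * real K) / sin (\<eta>/2)) * real p * D" .
  moreover have "xy (trace_word w (X u)) = (F s (P u), G s (P u))" if "u \<in> {a..b}" for u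
    using X[OF that] by (simp add: xy_def F_def G_def P_def \<sigma>_def)
  moreover have "xy (X u) = P u" if "u \<in> {a..b}" for u
    using X[OF that] by (simp add: P_def)
  ultimately show ?thesis
    using dist_pair_le[of "F s (P t)" "G s (P t)" "F s (P t')" "G s (P t')"] t
    by (simp add: D_def)
qed

text \<open>The first angle \<open>u\<close> of the image under the free map grows by at least \<open>p \<eta>\<close>, hence passes through
nearly \<open>p \<eta> / \<pi>\<close> cells. In each of them \<open>line_avoids_lattice\<close> selects a piece on which the second
angle \<open>v\<close> stays in a cell as well, and \<open>admissible_child\<close> transfers this piece to the perturbed curve.\<close>

lemma expansion_step:
  assumes K: "K \<ge> 1" and \<eta>: "\<eta> = pi / (12 * real K)" and s: "s \<ge> 0"
    and lw: "lin_word w = (p, q, r, s')" and bal: "balanced K (p, q, r, s')"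
    and big: "pi / real p \<le> \<eta> / 4"
    and close: "close_word (cos (\<eta>/2)) e s w"
    and e: "\<And>x y. x \<in> {-1..1} \<Longrightarrow> y \<in> {-1..1} \<Longrightarrow> \<bar>x - y\<bar> \<le> e \<Longrightarrow> \<bar>arccos x - arccos y\<bar> \<le> \<eta> / 4"
       "e \<le> 1 - cos (\<eta> / 2)" "4 * e \<le> (sin (\<eta> / 2))\<^sup>2" "0 < e"
    and adm: "admissible s \<eta> X a b" and cont: "continuous_on {a..b} X"
    and N: "real N + 1 \<le> real p * \<eta> / pi"
  shows "\<exists>lo hi. (\<forall>k<N. admissible s \<eta> (\<lambda>t. trace_word w (X t)) (lo k) (hi k) \<and>
            {lo k..hi k} \<subseteq> {a..b}) \<and>
            (\<forall>j<N. \<forall>k<N. j \<noteq> k \<longrightarrow> {lo j..hi j} \<inter> {lo k..hi k} = {})"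
proof -
  obtain \<theta>1 \<theta>2 i j where ab: "a \<le> b"
    and cont\<theta>: "continuous_on {a..b} \<theta>1" "continuous_on {a..b} \<theta>2"
    and cells: "\<And>t. t \<in> {a..b} \<Longrightarrow> \<theta>1 t \<in> cell (\<eta>/2) i" "\<And>t. t \<in> {a..b} \<Longrightarrow> \<theta>2 t \<in> cell (\<eta>/2) j"
    and X: "\<And>t. t \<in> {a..b} \<Longrightarrow> X t = sheet (parity (i + j)) s (cos (\<theta>1 t), cos (\<theta>2 t))"
    and inc: "\<theta>1 b - \<theta>1 a \<ge> \<eta>" "\<theta>2 b - \<theta>2 a \<ge> \<eta>"
    using adm unfolding admissible_def by blast
  have \<eta>': "0 < \<eta>" "\<eta> \<le> pi / 12"
    using K unfolding \<eta> by (auto simp: divide_le_eq)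
  have b: "1 \<le> r" "r \<le> p" "p \<le> K * r" using bal by (auto simp: balanced_def)
  define \<sigma> where "\<sigma> = parity (i + j)"
  have \<sigma>: "\<sigma> \<in> {1, -1}" using parity_cases[of "i + j"] by (auto simp: \<sigma>_def)
  define u where "u = (\<lambda>t. real p * \<theta>1 t + real q * \<theta>2 t)"
  define v where "v = (\<lambda>t. real r * \<theta>1 t + real s' * \<theta>2 t)"
  have contuv: "continuous_on {a..b} u" "continuous_on {a..b} v"
    unfolding u_def v_def by (intro continuous_intros cont\<theta>)+
  define \<kappa> where "\<kappa> = real r / real p"
  have \<kappa>: "0 < \<kappa>" "\<kappa> \<le> 1" "\<eta> \<le> \<kappa> * pi / 12"
  proof -
    show "0 < \<kappa>" "\<kappa> \<le> 1" using b by (auto simp: \<kappa>_def)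
    have "real p \<le> real (K * r)" using b(3) by (rule of_nat_mono)
    hence "1 / real K \<le> \<kappa>" using K b by (simp add: \<kappa>_def field_simps)
    hence "1 / real K * (pi / 12) \<le> \<kappa> * (pi / 12)" by (intro mult_right_mono) auto
    thus "\<eta> \<le> \<kappa> * pi / 12" by (simp add: \<eta> mult.commute)
  qed
  define det where "det = real p * real s' - real q * real r"
  have det: "\<bar>det\<bar> = 1"
  proof -
    have "real_of_int \<bar>int p * int s' - int q * int r\<bar> = real_of_int 1"
      using lin_word_det[OF lw] by simp
    thus ?thesis by (simp add: det_def)
  qed
  define d where "d = det * \<theta>2 a / real p"
  \<comment> \<open>The image curve stays in a strip of width \<open>\<pi> / p\<close> around a line of slope \<open>\<kappa>\<close>.\<close>
  have strip: "\<bar>v t - (\<kappa> * u t + d)\<bar> \<le> \<eta> / 4" if t: "t \<in> {a..b}" for t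
  proof -
    have "v t - (\<kappa> * u t + d) = det * (\<theta>2 t - \<theta>2 a) / real p"
      using b by (simp add: v_def u_def \<kappa>_def d_def det_def field_simps)
    hence "\<bar>v t - (\<kappa> * u t + d)\<bar> = \<bar>\<theta>2 t - \<theta>2 a\<bar> / real p"
      using det by (simp add: abs_mult)
    also have "\<bar>\<theta>2 t - \<theta>2 a\<bar> \<le> pi"
      using cells(2)[OF t] cells(2)[of a] ab \<eta>'(1) by (auto simp: cell_def abs_le_iff)
    hence "\<bar>\<theta>2 t - \<theta>2 a\<bar> / real p \<le> pi / real p" by (intro divide_right_mono) auto
    finally show ?thesis using big by linarith
  qed
  have growth: "u b - u a \<ge> real p * \<eta>"
  proof -
    have "real p * \<eta> + 0 \<le> real p * (\<theta>1 b - \<theta>1 a) + real q * (\<theta>2 b - \<theta>2 a)"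
      using inc \<eta>' by (intro add_mono mult_left_mono mult_nonneg_nonneg) auto
    thus ?thesis by (simp add: u_def algebra_simps)
  qed
  \<comment> \<open>The cells \<open>i0, \<dots>, i0 + N - 1\<close> of \<open>u\<close> lie entirely between \<open>u a\<close> and \<open>u b\<close>.\<close>
  define i0 where "i0 = \<lceil>u a / pi\<rceil>"
  have child: "\<exists>l h. admissible s \<eta> (\<lambda>t. trace_word w (X t)) l h \<and> {l..h} \<subseteq> {a..b} \<and>
      (\<forall>t\<in>{l..h}. u t \<in> {of_int (i0 + int k) * pi + pi/4..of_int (i0 + int k) * pi + 3*pi/4})"
    if k: "k < N" for k
  proof -
    define m where "m = i0 + int k"
    have "u a / pi \<le> of_int i0" "of_int i0 < u a / pi + 1" unfolding i0_def by linarith+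
    moreover have "real k + 1 \<le> real N" using k by simp
    ultimately have "u a / pi \<le> of_int m" "of_int m + 1 \<le> u a / pi + real p * \<eta> / pi"
      using N unfolding m_def by auto
    hence m: "u a \<le> of_int m * pi" "of_int m * pi + pi \<le> u b"
      using growth by (simp_all add: field_simps)
    obtain U j' where U: "U \<in> {of_int m * pi + pi/4..of_int m * pi + 3*pi/4 - pi/6}"
      and avoid: "\<And>x. x \<in> {U..U + pi/6} \<Longrightarrow> \<kappa> * x + d \<in> cell (\<kappa> * pi / 12) j'"
      using line_avoids_lattice[OF \<kappa>(1,2), of m d] by blast
    have "u a \<le> U" "U < U + pi/6" "U + pi/6 \<le> u b" using U m pi_gt_zero by auto
    then obtain t1 t2 where t: "a \<le> t1" "t1 \<le> t2" "t2 \<le> b" "u t1 = U" "u t2 = U + pi/6"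
      and ut: "\<And>t. t \<in> {t1..t2} \<Longrightarrow> u t \<in> {U..U + pi/6}"
      using crossing_subinterval[OF contuv(1) ab] by metis
    have sub: "{t1..t2} \<subseteq> {a..b}" using t by auto
    have "admissible s \<eta> (\<lambda>t. trace_word w (X t)) t1 t2"
    proof (rule admissible_child[OF \<eta>' t(2) _ _ _ _ _ _ _ _ _ _ _ e])
      show "continuous_on {t1..t2} u" "continuous_on {t1..t2} v"
           "continuous_on {t1..t2} (\<lambda>t. trace_word w (X t))"
        using contuv cont sub by (auto intro: continuous_on_subset continuous_on_trace_word)
      show "u t \<in> cell (3/4 * \<eta>) m" if "t \<in> {t1..t2}" for t
        using ut[OF that] U \<eta>' by (auto simp: cell_def)
      show "v t \<in> cell (3/4 * \<eta>) j'" if "t \<in> {t1..t2}" for t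
      proof -
        have "of_int j' * pi + \<kappa> * pi / 12 \<le> \<kappa> * u t + d"
             "\<kappa> * u t + d \<le> of_int j' * pi + pi - \<kappa> * pi / 12"
          using avoid[OF ut[OF that]] by (simp_all add: cell_def)
        moreover have "t \<in> {a..b}" using that sub by blast
        note strip[OF this]
        ultimately show ?thesis
          using \<kappa>(3) unfolding cell_def atLeastAtMost_iff by (intro conjI; linarith)
      qed
      show "3/2 * \<eta> \<le> u t2 - u t1" using t \<eta>' by simp
      show "3/2 * \<eta> \<le> v t2 - v t1"
      proof -
        have "\<bar>v t1 - (\<kappa> * U + d)\<bar> \<le> \<eta> / 4" "\<bar>v t2 - (\<kappa> * (U + pi/6) + d)\<bar> \<le> \<eta> / 4"
          using strip[of t1] strip[of t2] t by auto
        moreover have "\<kappa> * (U + pi/6) = \<kappa> * U + 2 * (\<kappa> * pi / 12)" by (simp add: algebra_simps)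
        ultimately show ?thesis using \<kappa>(3) by linarith
      qed
      fix t assume "t \<in> {t1..t2}"
      hence tab: "t \<in> {a..b}" using sub by auto
      have c: "\<bar>cos (\<theta>1 t)\<bar> \<le> cos (\<eta>/2)" "\<bar>cos (\<theta>2 t)\<bar> \<le> cos (\<eta>/2)"
        using cell_bounds(2)[OF _ cells(1)[OF tab]] cell_bounds(2)[OF _ cells(2)[OF tab]] \<eta>' by auto
      hence box: "(cos (\<theta>1 t), cos (\<theta>2 t)) \<in> square (cos (\<eta>/2))" by (auto simp: abs_le_iff)
      show "fricke (trace_word w (X t)) = s"
        unfolding fricke_trace_word X[OF tab]
        using s by (intro fricke_sheet) (auto simp: power2_eq_square)
      have free: "trace_word w (sheet \<sigma> 0 (cos (\<theta>1 t), cos (\<theta>2 t))) = (cos (u t), cos (v t), cos (u t + v t))"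
        unfolding \<sigma>_def u_def v_def
        using sheet_0_cells[OF _ _ cells(1)[OF tab] cells(2)[OF tab]] trace_word_cos[OF lw] \<eta>' by simp
      have Xt: "X t = sheet \<sigma> s (cos (\<theta>1 t), cos (\<theta>2 t))" using X[OF tab] by (simp add: \<sigma>_def)
      show "\<bar>fst (trace_word w (X t)) - cos (u t)\<bar> \<le> e"
           "\<bar>fst (snd (trace_word w (X t))) - cos (v t)\<bar> \<le> e"
           "\<bar>snd (snd (trace_word w (X t))) - cos (u t + v t)\<bar> \<le> e"
      proof -
        have lip: "lip_bounded (square (cos (\<eta>/2))) e (\<lambda>P. fst (trace_word w (sheet \<sigma> s P)) - fst (trace_word w (sheet \<sigma> 0 P)))"
          "lip_bounded (square (cos (\<eta>/2))) e (\<lambda>P. fst (snd (trace_word w (sheet \<sigma> s P))) - fst (snd (trace_word w (sheet \<sigma> 0 P))))"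
          "lip_bounded (square (cos (\<eta>/2))) e (\<lambda>P. snd (snd (trace_word w (sheet \<sigma> s P))) - snd (snd (trace_word w (sheet \<sigma> 0 P))))"
          using close \<sigma> unfolding close_word_def by blast+
        show "\<bar>fst (trace_word w (X t)) - cos (u t)\<bar> \<le> e"
             "\<bar>fst (snd (trace_word w (X t))) - cos (v t)\<bar> \<le> e"
             "\<bar>snd (snd (trace_word w (X t))) - cos (u t + v t)\<bar> \<le> e"
          using lip_boundedD(1)[OF lip(1) box] lip_boundedD(1)[OF lip(2) box] lip_boundedD(1)[OF lip(3) box]
          unfolding free Xt by simp_all
      qed
    qed
    moreover have "\<forall>t\<in>{t1..t2}. u t \<in> {of_int m * pi + pi/4..of_int m * pi + 3*pi/4}"
      using ut U by force
    ultimately show ?thesis unfolding m_def using sub by blast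
  qed
  then obtain lo hi where
    ch: "\<And>k. k < N \<Longrightarrow> admissible s \<eta> (\<lambda>t. trace_word w (X t)) (lo k) (hi k)"
        "\<And>k. k < N \<Longrightarrow> {lo k..hi k} \<subseteq> {a..b}"
    and uk: "\<And>k t. k < N \<Longrightarrow> t \<in> {lo k..hi k} \<Longrightarrow>
          u t \<in> {of_int (i0 + int k) * pi + pi/4..of_int (i0 + int k) * pi + 3*pi/4}"
    by metis
  have "{lo k..hi k} \<inter> {lo l..hi l} = {}" if kl: "k < N" "l < N" "k < l" for k l
  proof (rule ccontr)
    assume "{lo k..hi k} \<inter> {lo l..hi l} \<noteq> {}"
    then obtain t where t: "t \<in> {lo k..hi k}" "t \<in> {lo l..hi l}" by blast
    have "real_of_int (i0 + int k + 1) * pi \<le> of_int (i0 + int l) * pi"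
      using kl by (intro mult_right_mono) auto
    hence "real_of_int (i0 + int k) * pi + pi \<le> of_int (i0 + int l) * pi"
      by (simp add: algebra_simps)
    with uk[OF kl(1) t(1)] uk[OF kl(2) t(2)] show False
      using pi_gt_zero unfolding atLeastAtMost_iff by linarith
  qed
  hence "{lo k..hi k} \<inter> {lo l..hi l} = {}" if "k < N" "l < N" "k \<noteq> l" for k l
    using that by (metis inf_commute linorder_neqE_nat)
  with ch show ?thesis by blast
qed

section \<open>Continued fractions\<close>

lemma finite_cfrac_nonneg: "finite_cfrac as \<ge> 0"
  by (induction as) auto

lemma finite_cfrac_le_1:
  assumes "\<forall>x\<in>set as. x \<ge> 1"
  shows "finite_cfrac as \<le> 1"
proof (cases as)
  case (Cons x xs)
  have "real x + finite_cfrac xs \<ge> 1"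
    using assms Cons finite_cfrac_nonneg[of xs] by auto
  thus ?thesis by (simp add: Cons divide_le_eq)
qed simp

lemma cfrac_expansion_range:
  assumes "cfrac_expansion \<alpha> a"
  shows "0 \<le> \<alpha>" "\<alpha> \<le> 1"
proof -
  have lim: "(\<lambda>n. finite_cfrac (map a [0..<n])) \<longlonglongrightarrow> \<alpha>" and ge: "\<forall>k. a k \<ge> 1"
    using assms by (auto simp: cfrac_expansion_def)
  show "0 \<le> \<alpha>" by (rule LIMSEQ_le_const[OF lim]) (auto intro: finite_cfrac_nonneg)
  have "finite_cfrac (map a [0..<n]) \<le> 1" for n
    using ge by (intro finite_cfrac_le_1) auto
  thus "\<alpha> \<le> 1" by (intro LIMSEQ_le_const2[OF lim]) auto
qed

lemma cfrac_expansion_tail: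
  assumes "cfrac_expansion \<alpha> a" "\<alpha> \<noteq> 0"
  shows "cfrac_expansion (1 / \<alpha> - a 0) (\<lambda>k. a (Suc k))"
proof -
  have lim: "(\<lambda>n. finite_cfrac (map a [0..<Suc n])) \<longlonglongrightarrow> \<alpha>" and ge: "\<forall>k. a k \<ge> 1"
    using assms LIMSEQ_Suc[of "\<lambda>n. finite_cfrac (map a [0..<n])" \<alpha>]
    unfolding cfrac_expansion_def by blast+
  have eq: "finite_cfrac (map (\<lambda>k. a (Suc k)) [0..<n]) = 1 / finite_cfrac (map a [0..<Suc n]) - a 0" for n
  proof -
    have "map a [0..<Suc n] = a 0 # map (\<lambda>k. a (Suc k)) [0..<n]"
      by (simp only: upt_conv_Cons zero_less_Suc list.map map_Suc_upt[symmetric] map_map o_def)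
    thus ?thesis by simp
  qed
  have "(\<lambda>n. finite_cfrac (map (\<lambda>k. a (Suc k)) [0..<n])) \<longlonglongrightarrow> 1 / \<alpha> - a 0"
    unfolding eq by (intro tendsto_intros lim assms(2))
  with ge show ?thesis by (simp add: cfrac_expansion_def)
qed

locale rotation =
  fixes \<alpha> :: real and a :: "nat \<Rightarrow> nat"
  assumes \<alpha>: "0 < \<alpha>" "\<alpha> < 1" and irr: "\<alpha> \<notin> \<rat>" and cf: "cfrac_expansion \<alpha> a"
begin

lemma a_ge_1: "a k \<ge> 1"
  using cf by (simp add: cfrac_expansion_def)

lemma int_mult_not_int: "n \<noteq> 0 \<Longrightarrow> of_int n * \<alpha> \<noteq> of_int m"
proof
  assume n: "n \<noteq> 0" and "of_int n * \<alpha> = of_int m"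
  hence "\<alpha> = of_int m / of_int n" by (simp add: field_simps)
  with irr show False by (metis Rats_divide Rats_of_int)
qed

text \<open>This is the orbit of \<open>\<alpha>\<close> under the Gauss map. Its partial products \<open>\<beta>\<close> below are the
approximation errors \<open>\<bar>q\<^sub>k \<alpha> - p\<^sub>k\<bar>\<close> of the convergents (\<open>approximation_error\<close>).\<close>

primrec tail :: "nat \<Rightarrow> real" where
  "tail 0 = \<alpha>"
| "tail (Suc k) = 1 / tail k - a k"

lemma tail: "0 < tail k \<and> tail k < 1 \<and> tail k \<notin> \<rat> \<and> cfrac_expansion (tail k) (\<lambda>n. a (k + n))"
proof (induction k)
  case 0
  show ?case using \<alpha> irr cf by simp
next
  case (Suc k)
  hence *: "cfrac_expansion (tail (Suc k)) (\<lambda>n. a (Suc k + n))"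
    using cfrac_expansion_tail[of "tail k" "\<lambda>n. a (k + n)"] by auto
  have "tail (Suc k) \<notin> \<rat>"
  proof
    assume "tail (Suc k) \<in> \<rat>"
    hence "1 / (tail (Suc k) + of_nat (a k)) \<in> \<rat>" by (intro Rats_divide Rats_add) auto
    with Suc show False by simp
  qed
  moreover from this have "tail (Suc k) \<noteq> 0" "tail (Suc k) \<noteq> 1" by (metis Rats_0 Rats_1)+
  ultimately show ?case using cfrac_expansion_range[OF *] * by (metis order_less_le)
qed

definition \<beta> :: "nat \<Rightarrow> real" where
  "\<beta> k = (\<Prod>i\<le>k. tail i)"

lemma \<beta>_pos: "\<beta> k > 0"
  unfolding \<beta>_def using tail by (intro prod_pos) auto

lemma \<beta>_Suc_less: "\<beta> (Suc k) < \<beta> k"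
proof -
  have "\<beta> k * tail (Suc k) < \<beta> k * 1"
    using tail \<beta>_pos by (intro mult_strict_left_mono) blast+
  thus ?thesis by (simp add: \<beta>_def)
qed

lemma \<beta>_0: "\<beta> 0 = \<alpha>" and \<beta>_1: "\<beta> (Suc 0) = 1 - a 0 * \<alpha>"
  using \<alpha> by (auto simp: \<beta>_def field_simps)

lemma \<beta>_rec: "\<beta> (Suc (Suc k)) = \<beta> k - a (Suc k) * \<beta> (Suc k)"
proof -
  have "\<beta> (Suc (Suc k)) = \<beta> (Suc k) * (1 / tail (Suc k)) - a (Suc k) * \<beta> (Suc k)"
    by (simp add: \<beta>_def algebra_simps)
  also have "\<beta> (Suc k) * (1 / tail (Suc k)) = \<beta> k"
    using tail[of "Suc k"] by (simp add: \<beta>_def del: tail.simps)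
  finally show ?thesis .
qed

lemma \<beta>_small: "e > 0 \<Longrightarrow> \<exists>k. even k \<and> \<beta> k < e"
proof -
  assume e: "e > 0"
  have half: "\<beta> (2 * k) \<le> (1/2) ^ k" for k
  proof (induction k)
    case (Suc k)
    have "1 * \<beta> (Suc (2 * k)) \<le> a (Suc (2 * k)) * \<beta> (Suc (2 * k))"
      using a_ge_1[of "Suc (2 * k)"] \<beta>_pos[of "Suc (2 * k)"] by (intro mult_right_mono) auto
    hence "2 * \<beta> (Suc (Suc (2 * k))) \<le> \<beta> (2 * k)"
      using \<beta>_rec[of "2 * k"] \<beta>_Suc_less[of "Suc (2 * k)"] by linarith
    with Suc show ?case by simp
  qed (use \<alpha> \<beta>_0 in simp)
  obtain k where "(1/2 :: real) ^ k < e" using real_arch_pow_inv[OF e, of "1/2"] by auto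
  with half[of k] show ?thesis by (intro exI[of _ "2 * k"]) auto
qed

fun q :: "nat \<Rightarrow> nat" where
  "q 0 = 1"
| "q (Suc 0) = a 0"
| "q (Suc (Suc k)) = a (Suc k) * q (Suc k) + q k"

fun p :: "nat \<Rightarrow> nat" where
  "p 0 = 0"
| "p (Suc 0) = 1"
| "p (Suc (Suc k)) = a (Suc k) * p (Suc k) + p k"

lemma q_pos: "q k \<ge> 1"
  by (induction k rule: q.induct) (use a_ge_1 in auto)

lemma q_add_le: "q (Suc k) + q k \<le> q (Suc (Suc k))"
proof -
  have "1 * q (Suc k) \<le> a (Suc k) * q (Suc k)" using a_ge_1 by (intro mult_right_mono) auto
  thus ?thesis by simp
qed

lemma q_Suc_le: "q k \<le> q (Suc k)"
proof (cases k)
  case 0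
  thus ?thesis using a_ge_1 by simp
next
  case (Suc l)
  show ?thesis unfolding Suc using q_add_le[of l] by linarith
qed

lemma q_mono: "k \<le> l \<Longrightarrow> q k \<le> q l"
  using q_Suc_le by (rule lift_Suc_mono_le)

lemma q_ge_2: "k \<ge> 2 \<Longrightarrow> q k \<ge> 2"
  using q_mono[of "Suc (Suc 0)" k] q_add_le[of 0] q_pos[of "Suc 0"] q_pos[of 0] by linarith

lemma approximation_error: "real (q k) * \<alpha> - real (p k) = (-1) ^ k * \<beta> k"
proof (induction k rule: q.induct)
  case (3 k)
  have "real (q (Suc (Suc k))) * \<alpha> - real (p (Suc (Suc k))) =
     a (Suc k) * (real (q (Suc k)) * \<alpha> - real (p (Suc k))) + (real (q k) * \<alpha> - real (p k))"
    by (simp add: algebra_simps)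
  also have "\<dots> = (-1) ^ (Suc (Suc k)) * \<beta> (Suc (Suc k))"
    unfolding 3 \<beta>_rec by (simp add: algebra_simps)
  finally show ?case .
qed (simp_all add: \<beta>_0 \<beta>_1)

lemma convergents_det: "int (q (Suc k)) * int (p k) - int (q k) * int (p (Suc k)) = - ((-1) ^ k)"
proof (induction k)
  case (Suc k)
  have "int (q (Suc (Suc k))) * int (p (Suc k)) - int (q (Suc k)) * int (p (Suc (Suc k))) =
     - (int (q (Suc k)) * int (p k) - int (q k) * int (p (Suc k)))"
    by (simp add: algebra_simps)
  with Suc show ?case by simp
qed simp

text \<open>Write \<open>(n, m)\<close> as an integer combination \<open>x (q\<^sub>k, p\<^sub>k) + y (q\<^sub>k\<^sub>+\<^sub>1, p\<^sub>k\<^sub>+\<^sub>1)\<close>. Since \<open>0 < n < q\<^sub>k\<^sub>+\<^sub>1\<close>,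
\<open>x\<close> is not 0 and \<open>y\<close> does not have the sign of \<open>x\<close>. As the errors of consecutive convergents have
opposite signs, the two contributions to \<open>n \<alpha> - m\<close> do not cancel.\<close>

lemma best_approximation:
  assumes n: "1 \<le> n" "n < int (q (Suc k))"
  shows "\<beta> k \<le> \<bar>of_int n * \<alpha> - of_int m\<bar>"
proof -
  define Q Q' P P' where "Q = int (q k)" "Q' = int (q (Suc k))" "P = int (p k)" "P' = int (p (Suc k))"
  note defs = this
  define d where "d = - ((-1::int) ^ k)"
  have det: "Q' * P - Q * P' = d" using convergents_det[of k] by (simp add: defs d_def)
  have d2: "d * d = 1" by (simp add: d_def flip: power_mult_distrib)
  define x y where "x = - d * (n * P' - m * Q')" "y = - d * (m * Q - n * P)"
  note xy = this
  have "x * Q + y * Q' = d * (Q' * P - Q * P') * n" by (simp add: xy algebra_simps)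
  hence nxy: "n = x * Q + y * Q'" using det d2 by simp
  have "x * P + y * P' = d * (Q' * P - Q * P') * m" by (simp add: xy algebra_simps)
  hence mxy: "m = x * P + y * P'" using det d2 by simp
  have pos: "Q \<ge> 1" "Q' \<ge> 1" using q_pos[of k] q_pos[of "Suc k"] by (simp_all add: defs)
  have "of_int n * \<alpha> - of_int m =
      of_int x * (of_int Q * \<alpha> - of_int P) + of_int y * (of_int Q' * \<alpha> - of_int P')"
    by (subst nxy, subst mxy) (simp add: algebra_simps)
  also have "of_int Q * \<alpha> - of_int P = (-1) ^ k * \<beta> k"
    using approximation_error[of k] by (simp add: defs)
  also have "of_int Q' * \<alpha> - of_int P' = - ((-1) ^ k * \<beta> (Suc k))"
    using approximation_error[of "Suc k"] by (simp add: defs)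
  also have "of_int x * ((-1) ^ k * \<beta> k) + of_int y * - ((-1) ^ k * \<beta> (Suc k)) =
      (-1) ^ k * (of_int x * \<beta> k - of_int y * \<beta> (Suc k))"
    by (simp add: algebra_simps)
  finally have eq: "\<bar>of_int n * \<alpha> - of_int m\<bar> = \<bar>of_int x * \<beta> k - of_int y * \<beta> (Suc k)\<bar>"
    by (simp add: abs_mult)
  have \<beta>: "\<beta> k > 0" "\<beta> (Suc k) > 0" by (rule \<beta>_pos)+
  consider "x = 0" | "x > 0" | "x < 0" by linarith
  thus ?thesis
  proof cases
    case 1
    hence "n = y * Q'" using nxy by simp
    moreover have "y > 0"
    proof (rule ccontr)
      assume "\<not> y > 0"
      hence "y * Q' \<le> 0" using pos by (simp add: mult_le_0_iff)
      thus False using n calculation by simp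
    qed
    ultimately have "n \<ge> 1 * Q'" using pos by (auto intro: mult_right_mono)
    thus ?thesis using n by (simp add: defs)
  next
    case 2
    have "y \<le> 0"
    proof (rule ccontr)
      assume "\<not> y \<le> 0"
      hence "1 * Q' \<le> y * Q'" "0 \<le> x * Q" using pos 2 by (auto intro: mult_right_mono)
      moreover have "n < Q'" using n by (simp add: defs)
      ultimately show False using nxy by linarith
    qed
    hence "1 * \<beta> k \<le> of_int x * \<beta> k" "of_int y * \<beta> (Suc k) \<le> 0"
      using 2 \<beta> by (auto intro: mult_right_mono simp: mult_le_0_iff)
    thus ?thesis unfolding eq by linarith
  next
    case 3
    have "y \<ge> 0"
    proof (rule ccontr)
      assume "\<not> y \<ge> 0"
      hence "y * Q' \<le> 0" "x * Q \<le> 0" using pos 3 by (auto simp: mult_le_0_iff)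
      thus False using nxy n by simp
    qed
    moreover have "of_int x * \<beta> k \<le> (-1) * \<beta> k" using 3 \<beta> by (intro mult_right_mono) auto
    moreover have "0 \<le> of_int y * \<beta> (Suc k)" using calculation(1) \<beta> by simp
    ultimately show ?thesis unfolding eq by linarith
  qed
qed

text \<open>Adding \<open>q\<^sub>k \<alpha>\<close> moves \<open>n \<alpha>\<close> by an integer up to \<open>\<beta>\<^sub>k\<close>, and \<open>n \<alpha>\<close> is not closer than this to an
integer.\<close>

lemma floor_shift:
  assumes n: "1 \<le> n" "n < int (q (Suc k))"
  shows "\<lfloor>of_int (n + int (q k)) * \<alpha>\<rfloor> = \<lfloor>of_int n * \<alpha>\<rfloor> + int (p k)"
proof -
  define m where "m = \<lfloor>of_int n * \<alpha>\<rfloor>"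
  have m: "of_int m \<le> of_int n * \<alpha>" "of_int n * \<alpha> < of_int m + 1" by (simp_all add: m_def)
  have b: "\<beta> k \<le> of_int n * \<alpha> - of_int m" "\<beta> k \<le> of_int m + 1 - of_int n * \<alpha>"
    using best_approximation[OF n, of m] best_approximation[OF n, of "m + 1"] m by auto
  have err: "\<bar>real (q k) * \<alpha> - real (p k)\<bar> = \<beta> k"
    using approximation_error[of k] \<beta>_pos[of k] by (simp add: abs_mult)
  have ne: "of_int (n + int (q k)) * \<alpha> \<noteq> of_int (m + int (p k) + 1)"
    using n by (intro int_mult_not_int) simp
  have "of_int (n + int (q k)) * \<alpha> = of_int n * \<alpha> + real (q k) * \<alpha>" by (simp add: algebra_simps)
  hence "of_int (m + int (p k)) \<le> of_int (n + int (q k)) * \<alpha>"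
        "of_int (n + int (q k)) * \<alpha> < of_int (m + int (p k)) + 1"
    using b err ne by auto
  thus ?thesis unfolding m_def[symmetric] by (intro floor_unique)
qed

section \<open>The Sturmian word\<close>

text \<open>The Sturmian word of phase 0: \<open>letter n = 1\<close> iff the fractional part of \<open>n \<alpha>\<close> is in \<open>[1 - \<alpha>, 1)\<close>
(\<open>indicator_eq_floor_diff\<close>).\<close>

definition letter :: "int \<Rightarrow> int" where
  "letter n = \<lfloor>of_int (n + 1) * \<alpha>\<rfloor> - \<lfloor>of_int n * \<alpha>\<rfloor>"

lemma letter_periodic:
  assumes "1 \<le> n" "n + 1 < int (q (Suc k))"
  shows "letter (n + int (q k)) = letter n"
proof -
  have "n + int (q k) + 1 = (n + 1) + int (q k)" by simp
  hence "letter (n + int (q k)) = \<lfloor>of_int (n + 1 + int (q k)) * \<alpha>\<rfloor> - \<lfloor>of_int (n + int (q k)) * \<alpha>\<rfloor>"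
    by (simp only: letter_def)
  moreover have "n < int (q (Suc k))" "1 \<le> n + 1" using assms by auto
  ultimately show ?thesis
    by (simp only: letter_def floor_shift[OF assms(1) \<open>n < int (q (Suc k))\<close>] floor_shift[OF \<open>1 \<le> n + 1\<close> assms(2)])
qed

text \<open>Apart from the letters at the sites \<open>-1\<close> and \<open>0\<close> the word is symmetric, so that everything about its
right half holds for its left half, too.\<close>

lemma letter_reflect:
  assumes "1 \<le> n"
  shows "letter (- 1 - n) = letter n"
proof -
  have neg: "\<lfloor>- (of_int m * \<alpha>)\<rfloor> = - \<lfloor>of_int m * \<alpha>\<rfloor> - 1" if "m \<ge> 1" for m
  proof -
    have "of_int m * \<alpha> \<noteq> of_int \<lfloor>of_int m * \<alpha>\<rfloor>" using that by (intro int_mult_not_int) simp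
    thus ?thesis by (intro floor_unique) (auto, linarith+)
  qed
  have "letter (- 1 - n) = \<lfloor>- (of_int n * \<alpha>)\<rfloor> - \<lfloor>- (of_int (n + 1) * \<alpha>)\<rfloor>"
    by (simp add: letter_def algebra_simps)
  also have "\<dots> = letter n"
    using neg[of n] neg[of "n + 1"] assms by (simp add: letter_def)
  finally show ?thesis .
qed

lemma floor_first_block:
  assumes "0 \<le> n" "n \<le> int (a 0)"
  shows "\<lfloor>of_int n * \<alpha>\<rfloor> = 0"
proof -
  have "of_int n * \<alpha> \<le> of_int (int (a 0)) * \<alpha>" using assms \<alpha> by (intro mult_right_mono) auto
  also have "\<dots> < 1" using \<beta>_1 \<beta>_pos[of "Suc 0"] by simp
  finally show ?thesis using assms \<alpha> by (intro floor_unique) auto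
qed

lemma letter_first_block:
  "1 \<le> n \<Longrightarrow> n < int (a 0) \<Longrightarrow> letter n = 0" "letter (int (a 0)) = 1"
proof -
  assume "1 \<le> n" "n < int (a 0)"
  thus "letter n = 0" using floor_first_block[of n] floor_first_block[of "n + 1"] by (simp add: letter_def)
next
  have "\<beta> (Suc 0) < \<alpha>" using \<beta>_Suc_less[of 0] by (simp add: \<beta>_0)
  moreover have "0 < \<beta> (Suc 0)" by (rule \<beta>_pos)
  ultimately have "\<lfloor>of_int (int (a 0) + 1) * \<alpha>\<rfloor> = 1"
    using \<alpha> by (intro floor_unique) (auto simp: \<beta>_1 algebra_simps)
  thus "letter (int (a 0)) = 1" using floor_first_block[of "int (a 0)"] by (simp add: letter_def)
qed

text \<open>The word \<open>w\<^sub>2\<close> ends with \<open>w\<^sub>0 = 0\<close>. The periodicity of the letters does not give this, because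
\<open>w\<^sub>0\<close> is not a prefix of the word if the first partial quotient is 1.\<close>

lemma letter_q2: "letter (int (q (Suc (Suc 0)))) = 0"
proof -
  define k where "k = Suc (Suc 0)"
  have err: "real (q k) * \<alpha> = real (p k) + \<beta> k"
    using approximation_error[of k] by (simp add: k_def)
  have "1 * \<alpha> \<le> real (a 0) * \<alpha>" using a_ge_1[of 0] \<alpha> by (intro mult_right_mono) auto
  hence "\<beta> k + \<alpha> < 1" using \<beta>_Suc_less[of "Suc 0"] \<beta>_1 by (simp add: k_def)
  hence "\<lfloor>of_int (int (q k) + 1) * \<alpha>\<rfloor> = int (p k)" "\<lfloor>of_int (int (q k)) * \<alpha>\<rfloor> = int (p k)"
    using \<beta>_pos[of k] \<alpha> err by (auto intro!: floor_unique simp: algebra_simps)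
  thus ?thesis by (simp add: letter_def k_def)
qed

end

section \<open>Transfer matrices\<close>

type_synonym mat2 = "real \<times> real \<times> real \<times> real"

definition mmul :: "mat2 \<Rightarrow> mat2 \<Rightarrow> mat2" (infixl "\<odot>" 70) where
  "A \<odot> B = (case (A, B) of ((a, b, c, d), (a', b', c', d')) \<Rightarrow>
     (a * a' + b * c', a * b' + b * d', c * a' + d * c', c * b' + d * d'))"

definition mtr :: "mat2 \<Rightarrow> real" where
  "mtr A = (case A of (a, b, c, d) \<Rightarrow> a + d)"

definition mdet :: "mat2 \<Rightarrow> real" where
  "mdet A = (case A of (a, b, c, d) \<Rightarrow> a * d - b * c)"

definition mone :: mat2 where "mone = (1, 0, 0, 1)"

primrec mpow :: "mat2 \<Rightarrow> nat \<Rightarrow> mat2" where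
  "mpow A 0 = mone"
| "mpow A (Suc n) = mpow A n \<odot> A"

lemma mmul_assoc: "(A \<odot> B) \<odot> C = A \<odot> (B \<odot> C)"
  by (cases A; cases B; cases C) (simp add: mmul_def algebra_simps)

lemma mmul_mone [simp]: "A \<odot> mone = A" "mone \<odot> A = A"
  by (cases A; simp add: mmul_def mone_def)+

lemma mdet_mmul: "mdet (A \<odot> B) = mdet A * mdet B"
  by (cases A; cases B) (simp add: mmul_def mdet_def algebra_simps)

lemma mtr_commute: "mtr (A \<odot> B) = mtr (B \<odot> A)"
  by (cases A; cases B) (simp add: mmul_def mtr_def algebra_simps)

lemma mtr_mmul_twice:
  assumes "mdet A = 1"
  shows "mtr (B \<odot> A \<odot> A) = mtr A * mtr (B \<odot> A) - mtr B"
proof -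
  have "mtr (B \<odot> A \<odot> A) = mtr A * mtr (B \<odot> A) - mdet A * mtr B"
    by (cases A; cases B) (simp add: mmul_def mtr_def mdet_def algebra_simps)
  thus ?thesis using assms by simp
qed

text \<open>For matrices of determinant 1 the three half traces determine those of all products of \<open>A\<close> and
\<open>B\<close>, by the Cayley-Hamilton theorem.\<close>

definition pair_traces :: "mat2 \<Rightarrow> mat2 \<Rightarrow> traces" where
  "pair_traces A B = (mtr A / 2, mtr B / 2, mtr (B \<odot> A) / 2)"

lemma trace_step_pair_traces:
  assumes "mdet A = 1"
  shows "trace_step b (pair_traces A B) = pair_traces (B \<odot> mpow A b) A"
proof -
  have "(trace_mult ^^ b) (pair_traces A B) = pair_traces A (B \<odot> mpow A b)"
  proof (induction b)
    case (Suc b)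
    have "trace_mult (pair_traces A C) = pair_traces A (C \<odot> A)" for C
      using mtr_mmul_twice[OF assms, of C]
      by (simp add: pair_traces_def trace_mult_def field_simps)
    with Suc show ?case by (simp add: mmul_assoc)
  qed simp
  thus ?thesis
    by (simp add: trace_step_def trace_swap_def pair_traces_def mtr_commute[of A])
qed

fun site_prod :: "(nat \<Rightarrow> mat2) \<Rightarrow> nat \<Rightarrow> mat2" where
  "site_prod T 0 = mone"
| "site_prod T (Suc n) = T (Suc n) \<odot> site_prod T n"

lemma site_prod_cong:
  "(\<And>i. 1 \<le> i \<Longrightarrow> i \<le> n \<Longrightarrow> T i = T' i) \<Longrightarrow> site_prod T n = site_prod T' n"
  by (induction n) auto

lemma site_prod_add: "site_prod T (m + n) = site_prod (\<lambda>i. T (i + m)) n \<odot> site_prod T m"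
  by (induction n) (simp_all add: mmul_assoc add.commute)

lemma mpow_Suc_left: "mpow A (Suc n) = A \<odot> mpow A n"
  by (induction n) (simp_all add: mmul_assoc)

lemma site_prod_const: "(\<And>i. 1 \<le> i \<Longrightarrow> i \<le> n \<Longrightarrow> T i = A) \<Longrightarrow> site_prod T n = mpow A n"
  by (induction n) (simp_all add: mpow_Suc_left del: mpow.simps(2))

lemma site_prod_periodic:
  assumes "\<And>i. 1 \<le> i \<Longrightarrow> i + q \<le> c * q + r \<Longrightarrow> T (i + q) = T i"
  shows "site_prod T (c * q + r) = site_prod T r \<odot> mpow (site_prod T q) c"
  using assms
proof (induction c)
  case (Suc c)
  have "site_prod T (Suc c * q + r) = site_prod (\<lambda>i. T (i + q)) (c * q + r) \<odot> site_prod T q"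
    by (simp add: site_prod_add[symmetric] add.assoc)
  also have "site_prod (\<lambda>i. T (i + q)) (c * q + r) = site_prod T (c * q + r)"
    using Suc.prems by (intro site_prod_cong) auto
  also have "\<dots> = site_prod T r \<odot> mpow (site_prod T q) c"
    using Suc.prems by (intro Suc.IH) auto
  finally show ?case by (simp add: mmul_assoc)
qed simp

lemma mdet_site_prod: "(\<And>i. mdet (T i) = 1) \<Longrightarrow> mdet (site_prod T n) = 1"
  by (induction n) (simp_all add: mdet_mmul, simp add: mdet_def mone_def)

definition site_matrix :: "real \<Rightarrow> real \<Rightarrow> mat2" where
  "site_matrix E v = (E - v, -1, 1, 0)"

lemma mdet_site_matrix [simp]: "mdet (site_matrix E v) = 1"
  by (simp add: mdet_def site_matrix_def)

context rotation
begin

definition block :: "real \<Rightarrow> real \<Rightarrow> nat \<Rightarrow> mat2" where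
  "block lam E k = site_prod (\<lambda>n. site_matrix E (lam * of_int (letter (int n)))) (q k)"

text \<open>Lowering the first partial quotient by 1 lets the recursion start from the transfer matrices of the
single letters 0 and 1, since \<open>w\<^sub>1 = 0\<^sup>a\<^sup>-\<^sup>1 1\<close> for the first partial quotient \<open>a\<close>.\<close>

definition digit :: "nat \<Rightarrow> nat" where
  "digit k = (if k = 0 then a 0 - 1 else a k)"

definition initial_traces :: "real \<Rightarrow> real \<Rightarrow> traces" where
  "initial_traces lam E = pair_traces (site_matrix E 0) (site_matrix E lam)"

lemma mdet_block [simp]: "mdet (block lam E k) = 1"
  unfolding block_def by (intro mdet_site_prod) simp

text \<open>In the pair after \<open>k + 1\<close> digits the second matrix belongs to \<open>w\<^sub>k\<close>. For \<open>k = 0\<close> this is the single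
letter 0, which need not be the first letter of the Sturmian word.\<close>

lemma trace_word_digits:
  "trace_word (map digit [0..<Suc k]) (initial_traces lam E) =
     pair_traces (block lam E (Suc k)) (if k = 0 then site_matrix E 0 else block lam E k)"
proof (induction k)
  case 0
  define T where "T = (\<lambda>n. site_matrix E (lam * of_int (letter (int n))))"
  obtain n where n: "a 0 = Suc n" using a_ge_1[of 0] by (cases "a 0") auto
  have "site_prod T n = mpow (site_matrix E 0) n"
    by (rule site_prod_const) (simp add: T_def letter_first_block(1) n)
  hence "block lam E (Suc 0) = site_matrix E lam \<odot> mpow (site_matrix E 0) n"
    using letter_first_block(2) by (simp add: block_def T_def[symmetric] n) (simp add: T_def)
  moreover have "digit 0 = n" by (simp add: digit_def n)
  ultimately show ?case
    by (simp add: trace_word_def initial_traces_def trace_step_pair_traces)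
next
  case (Suc k)
  define T where "T = (\<lambda>n. site_matrix E (lam * of_int (letter (int n))))"
  define N where "N = (if k = 0 then site_matrix E 0 else block lam E k)"
  have "map digit [0..<Suc (Suc k)] = map digit [0..<Suc k] @ [digit (Suc k)]" by simp
  hence "trace_word (map digit [0..<Suc (Suc k)]) (initial_traces lam E) =
          trace_word [digit (Suc k)] (trace_word (map digit [0..<Suc k]) (initial_traces lam E))"
    by (simp only: trace_word_append)
  also have "\<dots> = trace_step (a (Suc k)) (pair_traces (block lam E (Suc k)) N)"
    unfolding Suc N_def by (simp add: digit_def trace_word_def)
  also have "\<dots> = pair_traces (N \<odot> mpow (block lam E (Suc k)) (a (Suc k))) (block lam E (Suc k))"
    by (simp add: trace_step_pair_traces)
  also have "N \<odot> mpow (block lam E (Suc k)) (a (Suc k)) = block lam E (Suc (Suc k))"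
  proof -
    have per: "T (i + q (Suc k)) = T i" if "1 \<le> i" "i + 1 < q (Suc (Suc k))" for i
    proof -
      have "1 \<le> int i" "int i + 1 < int (q (Suc (Suc k)))" using that by linarith+
      from letter_periodic[OF this] show ?thesis by (simp add: T_def)
    qed
    show ?thesis
    proof (cases "k = 0")
      case True
      define m where "m = a (Suc 0) * a 0"
      have "site_prod T (a (Suc 0) * q (Suc 0) + 0) = site_prod T 0 \<odot> mpow (site_prod T (q (Suc 0))) (a (Suc 0))"
        using a_ge_1[of 0] per True by (intro site_prod_periodic) auto
      hence m: "site_prod T m = mpow (block lam E (Suc 0)) (a (Suc 0))"
        by (simp add: m_def block_def T_def)
      have q2: "q (Suc (Suc 0)) = Suc m" by (simp add: m_def)
      have "T (Suc m) = site_matrix E 0"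
        using letter_q2 unfolding q2 by (simp add: T_def)
      hence "block lam E (Suc (Suc 0)) = site_matrix E 0 \<odot> mpow (block lam E (Suc 0)) (a (Suc 0))"
        unfolding block_def q2 T_def[symmetric] using m by (simp add: block_def T_def)
      thus ?thesis using True by (simp add: N_def)
    next
      case False
      have "q (Suc k) \<ge> 2" using False by (intro q_ge_2) simp
      hence "site_prod T (a (Suc k) * q (Suc k) + q k)
          = site_prod T (q k) \<odot> mpow (site_prod T (q (Suc k))) (a (Suc k))"
        using per by (intro site_prod_periodic) auto
      thus ?thesis using False by (simp add: N_def block_def T_def)
    qed
  qed
  finally show ?case by simp
qed

lemma initial_traces_eq:
  "initial_traces lam E = (E / 2, (E - lam) / 2, 2 * (E / 2) * ((E - lam) / 2) - 1)"
  by (simp add: initial_traces_def pair_traces_def site_matrix_def mtr_def mmul_def field_simps)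

end

section \<open>Energies with bounded traces lie in the spectrum\<close>

definition mapply :: "mat2 \<Rightarrow> complex \<times> complex \<Rightarrow> complex \<times> complex" where
  "mapply A w = (case (A, w) of ((a, b, c, d), (x, y)) \<Rightarrow>
     (of_real a * x + of_real b * y, of_real c * x + of_real d * y))"

lemma mapply_mmul: "mapply (A \<odot> B) w = mapply A (mapply B w)"
  by (cases A; cases B; cases w) (simp add: mapply_def mmul_def algebra_simps)

lemma mapply_mone [simp]: "mapply mone w = w"
  by (cases w) (simp add: mapply_def mone_def)

lemma cayley_hamilton:
  assumes "mdet A = 1"
  shows "fst w = of_real (mtr A) * fst (mapply A w) - fst (mapply A (mapply A w))"
    "snd w = of_real (mtr A) * snd (mapply A w) - snd (mapply A (mapply A w))"
proof -
  obtain a b c d where A: "A = (a, b, c, d)" by (metis prod_cases4)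
  obtain x y where w: "w = (x, y)" by (cases w)
  have "a * d - b * c = 1" using assms by (simp add: A mdet_def)
  hence 1: "complex_of_real a * of_real d = of_real b * of_real c + 1"
    by (metis of_real_1 of_real_add of_real_mult add_diff_cancel_left' add.commute diff_add_cancel)
  have "of_real (mtr A) * fst (mapply A w) - fst (mapply A (mapply A w)) =
          (complex_of_real a * of_real d - of_real b * of_real c) * x"
    by (simp add: A w mtr_def mapply_def algebra_simps)
  thus "fst w = of_real (mtr A) * fst (mapply A w) - fst (mapply A (mapply A w))"
    by (simp add: 1 w)
  have "of_real (mtr A) * snd (mapply A w) - snd (mapply A (mapply A w)) =
          (complex_of_real a * of_real d - of_real b * of_real c) * y"
    by (simp add: A w mtr_def mapply_def algebra_simps)
  thus "snd w = of_real (mtr A) * snd (mapply A w) - snd (mapply A (mapply A w))"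
    by (simp add: 1 w)
qed

lemma solution_eq_site_prod:
  fixes f :: "nat \<Rightarrow> complex" and v :: "nat \<Rightarrow> real"
  assumes "\<And>n. 1 \<le> n \<Longrightarrow> n \<le> N \<Longrightarrow> f (n + 1) + f (n - 1) + of_real (v n) * f n = of_real E * f n"
    and "n \<le> N"
  shows "(f (n + 1), f n) = mapply (site_prod (\<lambda>n. site_matrix E (v n)) n) (f 1, f 0)"
  using assms(2)
proof (induction n)
  case (Suc n)
  have "f (Suc n + 1) + f n + of_real (v (Suc n)) * f (Suc n) = of_real E * f (Suc n)"
    using assms(1)[of "Suc n"] Suc.prems by simp
  hence "f (Suc n + 1) = of_real (E - v (Suc n)) * f (Suc n) - f n"
    by (simp add: algebra_simps)
  moreover have "mapply (site_prod (\<lambda>n. site_matrix E (v n)) (Suc n)) (f 1, f 0) =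
      mapply (site_matrix E (v (Suc n))) (f (n + 1), f n)"
    using Suc by (simp add: mapply_mmul)
  ultimately show ?case by (simp add: mapply_def site_matrix_def)
qed simp

definition size_at :: "(nat \<Rightarrow> complex) \<Rightarrow> nat \<Rightarrow> real" where
  "size_at f n = cmod (f (n + 1)) + cmod (f n)"

text \<open>Gordon's argument on two periods: if \<open>A\<close> is the transfer matrix over one period, the Cayley-Hamilton
theorem gives \<open>w = (tr A) A w - A\<^sup>2 w\<close>, so with \<open>\<bar>tr A\<bar> \<le> 2\<close> one of \<open>A w\<close> and \<open>A\<^sup>2 w\<close> is at least a
third of \<open>w\<close>.\<close>

lemma gordon_bound:
  fixes f :: "nat \<Rightarrow> complex" and v :: "nat \<Rightarrow> real"
  assumes f: "\<And>n. 1 \<le> n \<Longrightarrow> n \<le> 2 * q \<Longrightarrow> f (n + 1) + f (n - 1) + of_real (v n) * f n = of_real E * f n"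
    and per: "\<And>n. 1 \<le> n \<Longrightarrow> n \<le> q \<Longrightarrow> v (n + q) = v n"
    and tr: "\<bar>mtr (site_prod (\<lambda>n. site_matrix E (v n)) q)\<bar> \<le> 2"
  shows "\<exists>n\<in>{q, 2 * q}. size_at f 0 \<le> 3 * size_at f n"
proof -
  define T where "T = (\<lambda>n. site_matrix E (v n))"
  define A where "A = site_prod T q"
  define w where "w = (f 1, f 0)"
  have "site_prod T (2 * q + 0) = site_prod T 0 \<odot> mpow A 2"
    unfolding A_def using per by (intro site_prod_periodic) (auto simp: T_def)
  hence A2: "site_prod T (2 * q) = A \<odot> A" by (simp add: eval_nat_numeral)
  have "mdet A = 1" unfolding A_def T_def by (intro mdet_site_prod) simp
  note ch = cayley_hamilton[OF this, of w]
  have w1: "mapply A w = (f (q + 1), f q)"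
    using solution_eq_site_prod[of "2 * q" f v E q] f by (simp add: A_def T_def w_def)
  have w2: "mapply A (mapply A w) = (f (2 * q + 1), f (2 * q))"
    using solution_eq_site_prod[of "2 * q" f v E "2 * q"] f A2
    by (simp add: T_def w_def mapply_mmul)
  note w2' = w2[unfolded w1]
  have le: "cmod x \<le> 2 * cmod y + cmod z" if "x = of_real (mtr A) * y - z" for x y z :: complex
  proof -
    have "cmod x \<le> cmod (of_real (mtr A) * y) + cmod z" unfolding that by (rule norm_triangle_ineq4)
    also have "cmod (of_real (mtr A) * y) \<le> 2 * cmod y"
      using tr unfolding norm_mult A_def T_def by (intro mult_right_mono) auto
    finally show ?thesis by simp
  qed
  have "cmod (f 1) \<le> 2 * cmod (f (q + 1)) + cmod (f (2 * q + 1))"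
       "cmod (f 0) \<le> 2 * cmod (f q) + cmod (f (2 * q))"
    using le[OF ch(1)] le[OF ch(2)] unfolding w1 w2' by (simp_all add: w_def)
  hence "size_at f 0 \<le> 2 * size_at f q + size_at f (2 * q)"
    by (simp add: size_at_def)
  thus ?thesis by fastforce
qed

lemma size_at_sum_le:
  fixes f :: "nat \<Rightarrow> complex"
  assumes inj: "inj_on n J" and fin: "finite J"
    and sum: "\<And>F. finite F \<Longrightarrow> (\<Sum>i\<in>F. (cmod (f i))\<^sup>2) \<le> S"
    and ge: "\<And>j. j \<in> J \<Longrightarrow> c \<le> size_at f (n j)" and c: "c \<ge> 0"
  shows "real (card J) * c\<^sup>2 \<le> 4 * S"
proof -
  have "real (card J) * c\<^sup>2 = (\<Sum>j\<in>J. c\<^sup>2)" by simp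
  also have "\<dots> \<le> (\<Sum>j\<in>J. 2 * (cmod (f (n j + 1)))\<^sup>2 + 2 * (cmod (f (n j)))\<^sup>2)"
  proof (rule sum_mono)
    fix j assume "j \<in> J"
    hence "c\<^sup>2 \<le> (size_at f (n j))\<^sup>2" using ge c by (intro power_mono) auto
    also have "\<dots> \<le> 2 * (cmod (f (n j + 1)))\<^sup>2 + 2 * (cmod (f (n j)))\<^sup>2"
      using sum_squares_bound[of "cmod (f (n j + 1))" "cmod (f (n j))"]
      by (simp add: size_at_def power2_sum)
    finally show "c\<^sup>2 \<le> 2 * (cmod (f (n j + 1)))\<^sup>2 + 2 * (cmod (f (n j)))\<^sup>2" .
  qed
  also have "\<dots> = 2 * (\<Sum>j\<in>J. (cmod (f (n j + 1)))\<^sup>2) + 2 * (\<Sum>j\<in>J. (cmod (f (n j)))\<^sup>2)"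
    by (simp add: sum.distrib sum_distrib_left)
  also have "(\<Sum>j\<in>J. (cmod (f (n j + 1)))\<^sup>2) = (\<Sum>i\<in>(\<lambda>j. n j + 1) ` J. (cmod (f i))\<^sup>2)"
    using inj by (subst sum.reindex) (auto simp: inj_on_def)
  also have "(\<Sum>j\<in>J. (cmod (f (n j)))\<^sup>2) = (\<Sum>i\<in>n ` J. (cmod (f i))\<^sup>2)"
    using inj by (subst sum.reindex) (auto simp: inj_on_def)
  finally show ?thesis
    using sum[of "(\<lambda>j. n j + 1) ` J"] sum[of "n ` J"] fin by simp
qed

lemma sum_le_ell2_norm:
  assumes "u \<in> ell2" "finite F"
  shows "(\<Sum>n\<in>F. (cmod (u n))\<^sup>2) \<le> (ell2_norm u)\<^sup>2"
proof -
  have summ: "(\<lambda>n. (cmod (u n))\<^sup>2) summable_on UNIV" using assms(1) by (simp add: ell2_def)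
  have "(\<Sum>n\<in>F. (cmod (u n))\<^sup>2) \<le> (\<Sum>\<^sub>\<infinity>n. (cmod (u n))\<^sup>2)"
    using assms by (intro finite_sum_le_infsum[OF summ]) auto
  moreover have "0 \<le> (\<Sum>\<^sub>\<infinity>n. (cmod (u n))\<^sup>2)" by (intro infsum_nonneg) auto
  ultimately show ?thesis by (simp add: ell2_norm_def)
qed

lemma delta_in_ell2:
  "(\<lambda>n. if n = N then 1 else 0) \<in> ell2" "ell2_norm (\<lambda>n. if n = N then 1 else 0) = 1"
proof -
  have sq: "(\<lambda>n. (cmod (if n = N then 1 else 0))\<^sup>2) = (\<lambda>n. if n = N then 1 else 0 :: real)"
    by auto
  have "((\<lambda>n. if n = N then 1 else 0 :: real) has_sum (\<Sum>n\<in>{N}. if n = N then 1 else 0)) {N}"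
    by (rule has_sum_finite) simp
  hence hs: "((\<lambda>n. if n = N then 1 else 0 :: real) has_sum 1) UNIV"
    by (subst (asm) has_sum_cong_neutral[where T = UNIV]) auto
  show "(\<lambda>n. if n = N then 1 else 0) \<in> ell2"
    unfolding ell2_def mem_Collect_eq sq using hs by (auto simp: summable_on_def)
  show "ell2_norm (\<lambda>n. if n = N then 1 else 0) = 1"
    unfolding ell2_norm_def sq using infsumI[OF hs] by simp
qed

context rotation
begin

text \<open>The convergents of even index lie below \<open>\<alpha>\<close>, so moving back by \<open>q\<^sub>k\<close> sites lowers the phase by the small
positive number \<open>\<beta>\<^sub>k\<close>; repeated moves bring it to \<open>[0, \<beta>\<^sub>k)\<close>.\<close>

lemma near_zero_phase:
  assumes "e > 0"
  obtains N x where "0 \<le> x" "x < e" "frac (\<omega> + of_int N * \<alpha>) = frac x"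
    "\<And>n. frac (\<omega> + of_int (N + n) * \<alpha>) = frac (x + of_int n * \<alpha>)"
proof -
  obtain k where k: "even k" "\<beta> k < e" using \<beta>_small[OF assms] by blast
  have err: "real (q k) * \<alpha> = real (p k) + \<beta> k"
    using approximation_error[of k] k by simp
  define j where "j = \<lfloor>\<omega> / \<beta> k\<rfloor>"
  define x where "x = \<omega> - of_int j * \<beta> k"
  have "of_int j \<le> \<omega> / \<beta> k" "\<omega> / \<beta> k < of_int j + 1" by (simp_all add: j_def)
  hence x: "0 \<le> x" "x < \<beta> k" using \<beta>_pos[of k] by (simp_all add: x_def field_simps)
  define N where "N = - j * int (q k)"
  have eq: "\<omega> + of_int (N + n) * \<alpha> = (x + of_int n * \<alpha>) + of_int (- j * int (p k))" for n
  proof -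
    have "\<omega> + of_int (N + n) * \<alpha> = \<omega> + of_int n * \<alpha> - of_int j * (real (q k) * \<alpha>)"
      by (simp add: N_def algebra_simps)
    thus ?thesis unfolding err by (simp add: x_def algebra_simps)
  qed
  have fr: "frac (\<omega> + of_int (N + n) * \<alpha>) = frac (x + of_int n * \<alpha>)" for n
  proof -
    have "frac (y + of_int z) = frac y" for y :: real and z :: int by (simp add: frac_def)
    thus ?thesis unfolding eq .
  qed
  show ?thesis using that[of x N] x k fr fr[of 0] by simp
qed

lemma indicator_eq_floor_diff:
  "indicator {1 - \<alpha>..<1} (frac y) = real_of_int (\<lfloor>y + \<alpha>\<rfloor> - \<lfloor>y\<rfloor>)"
proof (cases "frac y \<ge> 1 - \<alpha>")
  case True
  have "\<lfloor>y + \<alpha>\<rfloor> = \<lfloor>y\<rfloor> + 1"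
    using True frac_lt_1[of y] \<alpha> by (intro floor_unique) (auto simp: frac_def)
  thus ?thesis using True frac_lt_1[of y] by simp
next
  case False
  have "\<lfloor>y + \<alpha>\<rfloor> = \<lfloor>y\<rfloor>"
  proof (rule floor_unique)
    have "of_int \<lfloor>y\<rfloor> \<le> y" by (rule of_int_floor_le)
    thus "of_int \<lfloor>y\<rfloor> \<le> y + \<alpha>" using \<alpha> by linarith
    show "y + \<alpha> < of_int \<lfloor>y\<rfloor> + 1" using False by (simp add: frac_def)
  qed
  thus ?thesis using False by simp
qed

text \<open>Every long finite window of the phase 0 word occurs in the potential of every phase. The phase has to
be approached from the right, because the indicator function is continuous from the right only.\<close>

lemma shifted_potential:
  obtains N where "\<And>n. \<bar>n\<bar> \<le> int R \<Longrightarrow>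
    indicator {1 - \<alpha>..<1} (frac (\<omega> + of_int (N + n) * \<alpha>)) = real_of_int (letter n)"
proof -
  define S where "S = {- int R - 1..int R + 1}"
  define e where "e = Min ((\<lambda>n. 1 - frac (of_int n * \<alpha>)) ` S)"
  have S: "finite S" "S \<noteq> {}" by (auto simp: S_def)
  have "e \<in> (\<lambda>n. 1 - frac (of_int n * \<alpha>)) ` S"
    unfolding e_def using S by (intro Min_in) auto
  hence e: "e > 0" using frac_lt_1 by auto
  obtain N x where x: "0 \<le> x" "x < e"
    and fr: "\<And>n. frac (\<omega> + of_int (N + n) * \<alpha>) = frac (x + of_int n * \<alpha>)"
    using near_zero_phase[OF e] by metis
  have fl: "\<lfloor>x + of_int n * \<alpha>\<rfloor> = \<lfloor>of_int n * \<alpha>\<rfloor>" if "n \<in> S" for n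
  proof (rule floor_unique)
    have "e \<le> 1 - frac (of_int n * \<alpha>)" unfolding e_def using S that by (intro Min_le) auto
    thus "x + of_int n * \<alpha> < of_int \<lfloor>of_int n * \<alpha>\<rfloor> + 1" using x by (simp add: frac_def)
    show "of_int \<lfloor>of_int n * \<alpha>\<rfloor> \<le> x + of_int n * \<alpha>" using x by linarith
  qed
  show ?thesis
  proof (rule that[of N])
    fix n assume n: "\<bar>n\<bar> \<le> int R"
    have next_site: "x + of_int n * \<alpha> + \<alpha> = x + of_int (n + 1) * \<alpha>" by (simp add: algebra_simps)
    have "n \<in> S" "n + 1 \<in> S" using n by (auto simp: S_def)
    thus "indicator {1 - \<alpha>..<1} (frac (\<omega> + of_int (N + n) * \<alpha>)) = real_of_int (letter n)"
      unfolding fr indicator_eq_floor_diff letter_def next_site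
      using fl[of n] fl[of "n + 1"] by simp
  qed
qed

text \<open>If \<open>E\<close> were in the resolvent set, then \<open>u = (H - E)\<^sup>-\<^sup>1 \<delta>\<^sub>N\<close> would have norm at most \<open>K\<close>, wherever
the site \<open>N\<close> is. Choose \<open>N\<close> as the origin of a long window of the phase 0 word. On each side of \<open>N\<close>, \<open>u\<close>
solves the eigenvalue equation, and Gordon's argument at the scales \<open>q\<^sub>m, \<dots>, q\<^sub>J\<^sub>m\<close> makes \<open>u\<close> at \<open>J\<close>
different places as large as near \<open>N\<close>, up to a factor 3. Since \<open>u\<close> is not small near \<open>N\<close> on both sides, this
contradicts the bound \<open>K\<close> if \<open>J\<close> is large.\<close>

lemma bounded_traces_imp_spectrum:
  assumes lam: "lam \<ge> 0" and m: "m \<ge> 4"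
    and tr: "\<And>j. j \<ge> 1 \<Longrightarrow> \<bar>mtr (block lam E (j * m))\<bar> \<le> 2"
  shows "E \<in> sturmian_spectrum lam \<alpha> \<omega>"
proof (rule ccontr)
  define H where "H = sturmian_hamiltonian lam \<alpha> \<omega>"
  assume "E \<notin> sturmian_spectrum lam \<alpha> \<omega>"
  then obtain B where B: "bounded_operator B"
      "\<And>u. u \<in> ell2 \<Longrightarrow> (\<lambda>n. H (B u) n - of_real E * B u n) = u"
    unfolding sturmian_spectrum_def spectrum_def H_def by auto
  obtain K where K: "\<And>u. u \<in> ell2 \<Longrightarrow> ell2_norm (B u) \<le> K * ell2_norm u"
    using B(1) unfolding bounded_operator_def by blast
  define c where "c = 1 / (2 * (1 + lam + \<bar>E\<bar>))"
  have c: "c > 0" using lam by (simp add: c_def add_pos_nonneg)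
  obtain J :: nat where J: "real J * (c / 3)\<^sup>2 > 4 * K\<^sup>2"
    using reals_Archimedean3[of "(c/3)\<^sup>2"] c by auto
  define R where "R = 2 * q (J * m) + 1"
  obtain N where N: "\<And>n. \<bar>n\<bar> \<le> int R \<Longrightarrow>
      indicator {1 - \<alpha>..<1} (frac (\<omega> + of_int (N + n) * \<alpha>)) = real_of_int (letter n)"
    using shifted_potential by blast
  define \<delta> where "\<delta> = (\<lambda>n. if n = N then 1 else 0 :: complex)"
  have \<delta>: "\<delta> \<in> ell2" "ell2_norm \<delta> = 1" using delta_in_ell2[of N] by (simp_all add: \<delta>_def)
  define u where "u = B \<delta>"
  have u: "u \<in> ell2" using B(1) \<delta>(1) by (simp add: u_def bounded_operator_def)
  have "0 \<le> ell2_norm u" by (simp add: ell2_norm_def infsum_nonneg)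
  hence uK: "(ell2_norm u)\<^sup>2 \<le> K\<^sup>2" using K[OF \<delta>(1)] \<delta>(2) unfolding u_def by (intro power_mono) auto
  define g where "g = (\<lambda>n. u (N + n))"
  have sum_g: "(\<Sum>n\<in>F. (cmod (g n))\<^sup>2) \<le> K\<^sup>2" if "finite F" for F
  proof -
    have "(\<Sum>n\<in>F. (cmod (g n))\<^sup>2) = (\<Sum>n\<in>(+) N ` F. (cmod (u n))\<^sup>2)"
      by (subst sum.reindex) (auto simp: g_def)
    also have "\<dots> \<le> (ell2_norm u)\<^sup>2" using u that by (intro sum_le_ell2_norm) auto
    finally show ?thesis using uK by simp
  qed
  have eq: "g (n + 1) + g (n - 1) + of_real (lam * of_int (letter n)) * g n - of_real E * g n
              = (if n = 0 then 1 else 0)" if n: "\<bar>n\<bar> \<le> int R" for n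
  proof -
    have "H u (N + n) - of_real E * u (N + n) = \<delta> (N + n)"
      using B(2)[OF \<delta>(1)] unfolding u_def by metis
    thus ?thesis
      using N[OF n] by (simp add: H_def sturmian_hamiltonian_def g_def \<delta>_def algebra_simps)
  qed
  \<comment> \<open>The right half of the solution and the reflected left half solve the same half-line equation.\<close>
  define f1 where "f1 = (\<lambda>n. g (int n))"
  define f2 where "f2 = (\<lambda>n. g (- 1 - int n))"
  define v where "v = (\<lambda>n. lam * of_int (letter (int n)))"
  have eq1: "f1 (n + 1) + f1 (n - 1) + of_real (v n) * f1 n = of_real E * f1 n"
    if n: "1 \<le> n" "n \<le> 2 * q (J * m)" for n
  proof -
    have "int (n - 1) = int n - 1" using n by simp
    thus ?thesis using eq[of "int n"] n by (simp add: f1_def v_def R_def add.commute)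
  qed
  have eq2: "f2 (n + 1) + f2 (n - 1) + of_real (v n) * f2 n = of_real E * f2 n"
    if n: "1 \<le> n" "n \<le> 2 * q (J * m)" for n
  proof -
    have "- 1 - int (n - 1) = (- 1 - int n) + 1" "- 1 - int (n + 1) = (- 1 - int n) - 1" using n by simp_all
    hence "f2 (n - 1) = g ((- 1 - int n) + 1)" "f2 (n + 1) = g ((- 1 - int n) - 1)"
      unfolding f2_def by presburger+
    moreover have "letter (- 1 - int n) = letter (int n)" using n by (intro letter_reflect) simp
    ultimately show ?thesis
      using eq[of "- 1 - int n"] n by (simp add: f2_def v_def R_def add.commute)
  qed
  have gordon: "\<exists>n\<in>{q (j * m), 2 * q (j * m)}. size_at f 0 \<le> 3 * size_at f n"
    if j: "j \<in> {1..J}"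
    and f: "\<And>n. 1 \<le> n \<Longrightarrow> n \<le> 2 * q (J * m) \<Longrightarrow>
              f (n + 1) + f (n - 1) + of_real (v n) * f n = of_real E * f n" for f j
  proof (rule gordon_bound)
    have "j * m \<ge> 1 * 4" using j m by (intro mult_mono) auto
    moreover define k where "k = j * m - 2"
    ultimately have k: "j * m = Suc (Suc k)" "k \<ge> 2" by simp_all
    have "q (j * m) \<le> q (J * m)" using j by (intro q_mono) auto
    thus "f (n + 1) + f (n - 1) + of_real (v n) * f n = of_real E * f n"
      if "1 \<le> n" "n \<le> 2 * q (j * m)" for n
      using f that by auto
    show "v (n + q (j * m)) = v n" if n: "1 \<le> n" "n \<le> q (j * m)" for n
    proof -
      have "q (j * m) + q (Suc k) \<le> q (Suc (j * m))" using q_add_le[of "Suc k"] k(1) by simp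
      moreover have "q (Suc k) \<ge> 2" using k(2) by (intro q_ge_2) simp
      ultimately have "int n + 1 < int (q (Suc (j * m)))" "1 \<le> int n" using n by linarith+
      from letter_periodic[OF this(2,1)] show ?thesis by (simp add: v_def)
    qed
    show "\<bar>mtr (site_prod (\<lambda>n. site_matrix E (v n)) (q (j * m)))\<bar> \<le> 2"
      using tr[of j] j by (simp add: block_def v_def)
  qed
  have small: "size_at f 0 < c"
    if f: "\<And>n. 1 \<le> n \<Longrightarrow> n \<le> 2 * q (J * m) \<Longrightarrow>
              f (n + 1) + f (n - 1) + of_real (v n) * f n = of_real E * f n"
    and sum: "\<And>F. finite F \<Longrightarrow> (\<Sum>i\<in>F. (cmod (f i))\<^sup>2) \<le> K\<^sup>2" for f
  proof (rule ccontr)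
    assume "\<not> size_at f 0 < c"
    hence "\<exists>n\<in>{q (j * m), 2 * q (j * m)}. c / 3 \<le> size_at f n" if "j \<in> {1..J}" for j
      using gordon[OF that f] by force
    then obtain n where n: "\<And>j. j \<in> {1..J} \<Longrightarrow> n j \<in> {q (j * m), 2 * q (j * m)}"
        "\<And>j. j \<in> {1..J} \<Longrightarrow> c / 3 \<le> size_at f (n j)" by metis
    have less: "n i < n j" if ij: "i \<in> {1..J}" "j \<in> {1..J}" "i < j" for i j
    proof -
      define k where "k = i * m"
      have "(i + 1) * m \<le> j * m" using ij by (intro mult_right_mono) auto
      hence "k + 4 \<le> j * m" using m by (simp add: k_def)
      hence "q (Suc (Suc (Suc k))) \<le> q (j * m)" by (intro q_mono) simp
      moreover have "q (Suc (Suc k)) + q (Suc k) \<le> q (Suc (Suc (Suc k)))" by (rule q_add_le)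
      moreover have "q (Suc k) + q k \<le> q (Suc (Suc k))" by (rule q_add_le)
      moreover have "q k \<le> q (Suc k)" by (rule q_Suc_le)
      ultimately have "2 * q k < q (j * m)" using q_pos[of "Suc k"] by linarith
      thus ?thesis using n(1)[OF ij(1)] n(1)[OF ij(2)] by (auto simp: k_def)
    qed
    hence "inj_on n {1..J}" by (intro linorder_inj_onI') (metis less_irrefl)
    hence "real (card {1..J}) * (c / 3)\<^sup>2 \<le> 4 * K\<^sup>2"
      using n(2) c sum by (intro size_at_sum_le) auto
    with J show False by simp
  qed
  have "size_at f1 0 < c"
  proof (rule small[OF eq1])
    fix F :: "nat set" assume "finite F"
    moreover have "(\<Sum>i\<in>F. (cmod (f1 i))\<^sup>2) = (\<Sum>i\<in>int ` F. (cmod (g i))\<^sup>2)"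
      by (subst sum.reindex) (auto simp: f1_def)
    ultimately show "(\<Sum>i\<in>F. (cmod (f1 i))\<^sup>2) \<le> K\<^sup>2" using sum_g by simp
  qed
  moreover have "size_at f2 0 < c"
  proof (rule small[OF eq2])
    fix F :: "nat set" assume "finite F"
    moreover have "(\<Sum>i\<in>F. (cmod (f2 i))\<^sup>2) = (\<Sum>i\<in>(\<lambda>i. - 1 - int i) ` F. (cmod (g i))\<^sup>2)"
      by (subst sum.reindex) (auto simp: f2_def inj_on_def)
    ultimately show "(\<Sum>i\<in>F. (cmod (f2 i))\<^sup>2) \<le> K\<^sup>2" using sum_g by simp
  qed
  ultimately have lt: "cmod (g 1) + cmod (g 0) < c" "cmod (g (-2)) + cmod (g (-1)) < c"
    by (simp_all add: size_at_def f1_def f2_def)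
  define b where "b = lam * of_int (letter 0) - E"
  have "letter 0 = 0" using floor_first_block[of 1] a_ge_1[of 0] by (simp add: letter_def)
  hence b: "\<bar>b\<bar> \<le> \<bar>E\<bar>" by (simp add: b_def)
  have "g 1 + g (-1) + of_real b * g 0 = 1"
    using eq[of 0] by (simp add: b_def algebra_simps)
  hence "1 = cmod (g 1 + g (-1) + of_real b * g 0)" by simp
  also have "\<dots> \<le> cmod (g 1) + cmod (g (-1)) + cmod (of_real b * g 0)"
    by (intro order_trans[OF norm_triangle_ineq] add_right_mono norm_triangle_ineq)
  also have "\<dots> = cmod (g 1) + cmod (g (-1)) + \<bar>b\<bar> * cmod (g 0)" by (simp add: norm_mult)
  also have "\<dots> \<le> (cmod (g 1) + cmod (g (-1))) + \<bar>E\<bar> * cmod (g 0)"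
    using b by (intro add_mono mult_right_mono) auto
  also have "\<dots> \<le> (1 + lam + \<bar>E\<bar>) * (cmod (g 1) + cmod (g (-1))) + (1 + lam + \<bar>E\<bar>) * cmod (g 0)"
  proof (intro add_mono)
    have "1 * (cmod (g 1) + cmod (g (-1))) \<le> (1 + lam + \<bar>E\<bar>) * (cmod (g 1) + cmod (g (-1)))"
      using lam by (intro mult_right_mono) auto
    thus "cmod (g 1) + cmod (g (-1)) \<le> (1 + lam + \<bar>E\<bar>) * (cmod (g 1) + cmod (g (-1)))" by simp
  qed (use lam in \<open>auto intro: mult_right_mono\<close>)
  also have "\<dots> = (1 + lam + \<bar>E\<bar>) * (cmod (g 1) + cmod (g (-1)) + cmod (g 0))"
    by (simp add: algebra_simps)
  also have "\<dots> < (1 + lam + \<bar>E\<bar>) * (2 * c)"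
  proof (rule mult_strict_left_mono)
    have "0 \<le> cmod (g (-2))" by simp
    with lt show "cmod (g 1) + cmod (g (-1)) + cmod (g 0) < 2 * c" by linarith
  qed (use lam in \<open>simp add: add_pos_nonneg\<close>)
  also have "\<dots> = 1"
  proof -
    have "1 + lam + \<bar>E\<bar> > 0" using lam by (simp add: add_pos_nonneg)
    thus ?thesis by (simp add: c_def field_simps)
  qed
  finally show False by simp
qed

end

section \<open>The Cantor set of energies\<close>

text \<open>With \<open>x = p\<close> the left side is essentially \<open>2 L\<^sup>s\<close> for the contraction \<open>L = C p\<close> of a block, and the
right side is its number of children.\<close>

lemma child_count_beats_power:
  fixes s C \<eta> :: real
  assumes s: "0 < s" "s < 1" and C: "C > 0" and \<eta>: "\<eta> > 0"
  shows "\<exists>P. \<forall>x\<ge>P. 2 * (C * x) powr s + 2 \<le> x * \<eta> / pi"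
proof -
  define A where "A = 4 * pi * C powr s / \<eta>"
  have A: "A > 0" using C \<eta> by (simp add: A_def)
  define P where "P = max (4 * pi / \<eta>) (A powr (1 / (1 - s)))"
  have "2 * (C * x) powr s + 2 \<le> x * \<eta> / pi" if x: "x \<ge> P" for x
  proof -
    have x1: "4 * pi / \<eta> \<le> x" "A powr (1 / (1 - s)) \<le> x" using x by (auto simp: P_def)
    have x0: "x > 0" using x1(1) \<eta> by (meson divide_pos_pos less_le_trans mult_pos_pos pi_gt_zero zero_less_numeral)
    have "A = (A powr (1 / (1 - s))) powr (1 - s)" using A s by (simp add: powr_powr)
    also have "\<dots> \<le> x powr (1 - s)" using x1(2) s by (intro powr_mono2) auto
    finally have "A * x powr s \<le> x powr (1 - s) * x powr s" by (intro mult_right_mono) auto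
    also have "\<dots> = x" using x0 by (simp flip: powr_add)
    finally have "2 * (C powr s * x powr s) \<le> x * \<eta> / (2 * pi)"
      using \<eta> by (simp add: A_def field_simps)
    hence "2 * (C * x) powr s \<le> x * \<eta> / (2 * pi)"
      using C x0 by (simp add: powr_mult)
    moreover have "2 \<le> x * \<eta> / (2 * pi)" using x1(1) \<eta> by (simp add: field_simps)
    ultimately show ?thesis by (simp add: field_simps)
  qed
  thus ?thesis by blast
qed

lemma arccos_modulus:
  assumes "\<epsilon> > 0"
  obtains d where "d > 0" "\<And>x y. x \<in> {-1..1} \<Longrightarrow> y \<in> {-1..1} \<Longrightarrow> \<bar>x - y\<bar> \<le> d \<Longrightarrow> \<bar>arccos x - arccos y\<bar> \<le> \<epsilon>"
proof -
  have "uniformly_continuous_on {-1..1} arccos"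
    by (intro compact_uniformly_continuous continuous_on_arccos') auto
  then obtain d where d: "d > 0"
      "\<And>x y. x \<in> {-1..1} \<Longrightarrow> y \<in> {-1..1} \<Longrightarrow> dist y x < d \<Longrightarrow> dist (arccos y) (arccos x) < \<epsilon>"
    unfolding uniformly_continuous_on_def using assms by blast
  show ?thesis
  proof (rule that[of "d / 2"])
    fix x y :: real assume "x \<in> {-1..1}" "y \<in> {-1..1}" "\<bar>x - y\<bar> \<le> d / 2"
    thus "\<bar>arccos x - arccos y\<bar> \<le> \<epsilon>"
      using d(1) d(2)[of y x] by (simp add: dist_real_def)
  qed (use d in simp)
qed

lemma arccos_inner:
  assumes "\<bar>x\<bar> \<le> 3/4"
  shows "1/4 \<le> arccos x" "arccos x \<le> pi - 1/4"
proof -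
  have b: "0 \<le> arccos x" "arccos x \<le> pi" "cos (arccos x) = x" using assms by (auto simp: arccos_lbound arccos_ubound)
  show "1/4 \<le> arccos x" using abs_cos_diff_le[of 0 "arccos x"] assms b by (simp add: abs_le_iff)
  show "arccos x \<le> pi - 1/4" using abs_cos_diff_le[of pi "arccos x"] assms b by (simp add: abs_le_iff)
qed

lemma abs_diff_le_arccos:
  assumes "x \<in> {-1..1}" "y \<in> {-1..1}" "x \<le> y"
  shows "y - x \<le> arccos x - arccos y"
proof -
  have "arccos y \<le> arccos x" using assms by (intro arccos_le_arccos) auto
  moreover have "\<bar>cos (arccos x) - cos (arccos y)\<bar> \<le> \<bar>arccos x - arccos y\<bar>" by (rule abs_cos_diff_le)
  ultimately show ?thesis using assms by simp
qed

context rotation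
begin

text \<open>The parameter is \<open>t = - E\<close>, so that the angles, at \<open>\<lambda> = 0\<close> both equal to \<open>arccos (E / 2)\<close>, increase.\<close>

lemma initial_admissible:
  assumes \<eta>: "0 < \<eta>" "\<eta> \<le> pi / 12" and lam: "0 \<le> lam" "lam \<le> 1/2"
  shows "admissible (lam\<^sup>2 / 4) \<eta> (\<lambda>t. initial_traces lam (- t)) (-1) 1"
proof -
  define x y where "x = (\<lambda>t::real. - t / 2)" "y = (\<lambda>t. (- t - lam) / 2)"
  note xy = this
  have b: "\<bar>x t\<bar> \<le> 3/4" "\<bar>y t\<bar> \<le> 3/4" if "t \<in> {-1..1}" for t
  proof -
    have "x t \<le> 3/4" "- x t \<le> 3/4" "y t \<le> 3/4" "- y t \<le> 3/4"
      using that lam by (simp_all add: xy field_simps)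
    thus "\<bar>x t\<bar> \<le> 3/4" "\<bar>y t\<bar> \<le> 3/4" by (auto intro: abs_leI)
  qed
  have small: "\<eta> / 2 \<le> 1/4" "\<eta> \<le> 1" using \<eta> pi_less_4 by auto
  have cells: "arccos (x t) \<in> cell (\<eta>/2) 0" "arccos (y t) \<in> cell (\<eta>/2) 0" if "t \<in> {-1..1}" for t
    using arccos_inner[OF b(1)[OF that]] arccos_inner[OF b(2)[OF that]] small by (auto simp: cell_def)
  have c: "continuous_on {-1..1} (\<lambda>t. arccos (x t))" "continuous_on {-1..1} (\<lambda>t. arccos (y t))"
    using lam by (auto simp: xy intro!: continuous_intros)
  have "initial_traces lam (- t) = sheet (parity (0 + 0)) (lam\<^sup>2 / 4) (cos (arccos (x t)), cos (arccos (y t)))"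
    if t: "t \<in> {-1..1}" for t
  proof -
    have "\<bar>x t\<bar> * \<bar>y t\<bar> \<le> 3/4 * (3/4)" using b[OF t] by (intro mult_mono) auto
    hence "\<bar>x t * y t\<bar> < 1" by (simp add: abs_mult)
    hence "(2 * x t * y t - 1) - x t * y t < 0" by (simp add: abs_less_iff)
    moreover have "fricke (x t, y t, 2 * x t * y t - 1) = lam\<^sup>2 / 4"
      by (simp add: fricke_def xy power2_eq_square field_simps)
    ultimately have "(x t, y t, 2 * x t * y t - 1) = sheet 1 (lam\<^sup>2 / 4) (x t, y t)"
      by (intro eq_sheet) auto
    moreover have "cos (arccos (x t)) = x t" "cos (arccos (y t)) = y t"
      using b[OF t] by (auto intro: cos_arccos_abs)
    moreover have "initial_traces lam (- t) = (x t, y t, 2 * x t * y t - 1)"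
      by (simp add: initial_traces_eq xy)
    ultimately show ?thesis by (simp add: parity_def)
  qed
  moreover have "arccos (x 1) - arccos (x (-1)) \<ge> \<eta>" "arccos (y 1) - arccos (y (-1)) \<ge> \<eta>"
  proof -
    have "x (-1) - x 1 = 1" "y (-1) - y 1 = 1" by (simp_all add: xy field_simps)
    moreover have "x (-1) - x 1 \<le> arccos (x 1) - arccos (x (-1))"
      by (rule abs_diff_le_arccos) (auto simp: xy)
    moreover have "y (-1) - y 1 \<le> arccos (y 1) - arccos (y (-1))"
      by (rule abs_diff_le_arccos) (use lam in \<open>auto simp: xy\<close>)
    ultimately show "arccos (x 1) - arccos (x (-1)) \<ge> \<eta>" "arccos (y 1) - arccos (y (-1)) \<ge> \<eta>"
      using small by linarith+
  qed
  ultimately show ?thesis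
    unfolding admissible_def using c cells
    by (intro conjI exI[of _ "\<lambda>t. arccos (x t)"] exI[of _ "\<lambda>t. arccos (y t)"] exI[of _ 0]) auto
qed

text \<open>The constants are chosen in the order \<open>\<eta>\<close>, \<open>e\<close>, \<open>C\<close>, \<open>m\<close>, \<open>\<lambda>\<close>: those before \<open>m\<close> depend only on the
bound \<open>K\<close> for the partial quotients, \<open>m\<close> then makes the number of children beat \<open>(C p)\<^sup>s\<close>, and \<open>\<lambda>\<close>
is small for the finitely many words of length \<open>m\<close>.\<close>

lemma dimension_lower_bound:
  assumes K: "\<And>k. a k < K" and s: "0 < s" "s < 1"
  shows "\<forall>\<^sub>F lam in at_right 0. ereal s \<le> hausdorff_dim (sturmian_spectrum lam \<alpha> \<omega>)"
proof -
  have K1: "K \<ge> 1" using K[of 0] by simp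
  define \<eta> where "\<eta> = pi / (12 * real K)"
  have \<eta>: "0 < \<eta>" "\<eta> \<le> pi / 12" "\<eta> \<le> pi"
    using K1 by (auto simp: \<eta>_def divide_le_eq field_simps intro: order_trans[of _ "real K"])
  define sn where "sn = sin (\<eta> / 2)"
  have sn: "sn > 0" unfolding sn_def using \<eta> by (intro sin_gt_zero) auto
  have cs: "0 \<le> cos (\<eta>/2)" "cos (\<eta>/2) < 1"
  proof -
    show "0 \<le> cos (\<eta>/2)" using \<eta> by (intro cos_ge_zero) auto
    have "cos (\<eta>/2) < cos 0" using \<eta> by (intro cos_monotone_0_pi) auto
    thus "cos (\<eta>/2) < 1" by simp
  qed
  obtain d where d: "d > 0" "\<And>x y. x \<in> {-1..1} \<Longrightarrow> y \<in> {-1..1} \<Longrightarrow> \<bar>x - y\<bar> \<le> d \<Longrightarrow> \<bar>arccos x - arccos y\<bar> \<le> \<eta> / 4"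
    using arccos_modulus[of "\<eta> / 4"] \<eta> by auto
  define e where "e = min (min d (1 - cos (\<eta>/2))) (min (sn\<^sup>2 / 4) 1)"
  have e: "\<And>x y. x \<in> {-1..1} \<Longrightarrow> y \<in> {-1..1} \<Longrightarrow> \<bar>x - y\<bar> \<le> e \<Longrightarrow> \<bar>arccos x - arccos y\<bar> \<le> \<eta> / 4"
       "e \<le> 1 - cos (\<eta> / 2)" "4 * e \<le> (sin (\<eta> / 2))\<^sup>2" "0 < e" "e \<le> 1"
  proof -
    have "e \<le> d" "e \<le> 1 - cos (\<eta>/2)" "e \<le> sn\<^sup>2 / 4" "e \<le> 1"
      unfolding e_def by (intro min.coboundedI1[OF min.cobounded1] min.coboundedI1[OF min.cobounded2]
        min.coboundedI2[OF min.cobounded1] min.coboundedI2[OF min.cobounded2])+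
    thus "e \<le> 1 - cos (\<eta> / 2)" "4 * e \<le> (sin (\<eta> / 2))\<^sup>2" "e \<le> 1"
      "\<And>x y. x \<in> {-1..1} \<Longrightarrow> y \<in> {-1..1} \<Longrightarrow> \<bar>x - y\<bar> \<le> e \<Longrightarrow> \<bar>arccos x - arccos y\<bar> \<le> \<eta> / 4"
      using d(2) by (auto simp: sn_def)
    show "0 < e" using d(1) cs sn by (simp add: e_def)
  qed
  define C where "C = 2 + (2 + 2 * real K) / sn"
  have C: "C \<ge> 2" using sn by (simp add: C_def)
  obtain P where P: "\<And>x. x \<ge> P \<Longrightarrow> 2 * (C * x) powr s + 2 \<le> x * \<eta> / pi"
    using child_count_beats_power[OF s, of C \<eta>] C \<eta> by auto
  define Q where "Q = max P (4 * pi / \<eta>)"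
  define m where "m = nat \<lceil>Q\<rceil> + 4"
  have m: "m \<ge> 4" by (simp add: m_def)
  \<comment> \<open>Bounded type: the blocks of \<open>m\<close> digits come from this finite set.\<close>
  define W where "W = {w. set w \<subseteq> {..<K} \<and> length w = m}"
  have finW: "finite W" unfolding W_def by (intro finite_lists_length_eq) simp
  define word where "word = (\<lambda>n. map digit [n * m..<Suc n * m])"
  have digit: "digit k < K" "k \<ge> 1 \<Longrightarrow> 1 \<le> digit k" for k
    using K[of k] K[of 0] a_ge_1[of k] by (auto simp: digit_def)
  have word: "word n \<in> W" for n
    using digit by (auto simp: W_def word_def)
  define pp where "pp = (\<lambda>n. fst (lin_word (word n)))"
  have bal: "balanced K (lin_word (word n))" and ppm: "m \<le> pp n + 2" for n
  proof -
    have nth: "word n ! i = digit (n * m + i)" if "i < m" for i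
      using that by (simp add: word_def nth_append)
    have "balanced K (lin_word (word n)) \<and> m \<le> fst (lin_word (word n)) + 2"
    proof (rule lin_word_balanced)
      show "length (word n) = m" using word[of n] by (simp add: W_def)
      show "3 \<le> m" using m by simp
      show "word n ! 0 < K" using nth[of 0] digit m by simp
      show "1 \<le> word n ! i \<and> word n ! i < K" if "1 \<le> i" "i < m" for i
        using nth[of i] digit(1)[of "n * m + i"] digit(2)[of "n * m + i"] that by simp
    qed
    thus "balanced K (lin_word (word n))" "m \<le> pp n + 2" by (auto simp: pp_def)
  qed
  have pp_ge: "P \<le> real (pp n)" "4 * pi / \<eta> \<le> real (pp n)" "1 \<le> pp n" for n
  proof -
    have "Q \<le> real (nat \<lceil>Q\<rceil>)" by (rule real_nat_ceiling_ge)
    also have "\<dots> \<le> real (pp n)" using ppm[of n] unfolding m_def by (intro of_nat_mono) linarith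
    finally show "P \<le> real (pp n)" "4 * pi / \<eta> \<le> real (pp n)" by (simp_all add: Q_def)
    show "1 \<le> pp n" using ppm[of n] m by simp
  qed
  define L where "L = (\<lambda>n. C * real (pp n))"
  have L2: "2 \<le> L n" for n
  proof -
    have "2 * 1 \<le> C * real (pp n)" using C pp_ge(3)[of n] by (intro mult_mono) auto
    thus ?thesis by (simp add: L_def)
  qed
  define M where "M = C * real (Max ((fst \<circ> lin_word) ` W))"
  have LM: "L n \<le> M" for n
  proof -
    have "pp n \<le> Max ((fst \<circ> lin_word) ` W)"
      using word[of n] finW by (intro Max_ge) (auto simp: pp_def)
    thus ?thesis unfolding L_def M_def using C by (intro mult_left_mono) auto
  qed
  define N where "N = (\<lambda>n. nat (\<lfloor>real (pp n) * \<eta> / pi\<rfloor> - 1))"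
  have N: "2 * L n powr s \<le> real (N n)" "real (N n) + 1 \<le> real (pp n) * \<eta> / pi" for n
  proof -
    have "0 \<le> 2 * (C * real (pp n)) powr s" by simp
    moreover have "2 * (C * real (pp n)) powr s + 2 \<le> real (pp n) * \<eta> / pi"
      using P pp_ge(1) by blast
    ultimately show "2 * L n powr s \<le> real (N n)" "real (N n) + 1 \<le> real (pp n) * \<eta> / pi"
      unfolding N_def L_def by linarith+
  qed
  define \<Lambda> where "\<Lambda> = (\<lambda>n. \<Prod>i<n. L i)"
  have \<Lambda>: "\<Lambda> n > 0" for n unfolding \<Lambda>_def using L2 by (intro prod_pos) (auto intro: less_le_trans[of 0 2])
  define l where "l = (\<lambda>n. sn * \<eta> / \<Lambda> n)"
  have l: "l n > 0" "l n = L n * l (Suc n)" for n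
  proof -
    show "l n > 0" using sn \<eta> \<Lambda> by (simp add: l_def)
    have "L n \<noteq> 0" using L2[of n] by auto
    thus "l n = L n * l (Suc n)" by (simp add: l_def \<Lambda>_def)
  qed
  have "\<forall>w\<in>W. \<forall>\<^sub>F s in at_right 0. close_word (cos (\<eta>/2)) e s w"
    using eventually_close_word cs e by blast
  hence "\<forall>\<^sub>F s in at_right 0. \<forall>w\<in>W. close_word (cos (\<eta>/2)) e s w"
    using finW by (simp add: eventually_ball_finite_distrib)
  moreover have "filterlim (\<lambda>lam::real. lam\<^sup>2 / 4) (at_right 0) (at_right 0)"
    unfolding filterlim_at
  proof
    show "\<forall>\<^sub>F lam::real in at_right 0. lam\<^sup>2 / 4 \<in> {0<..} \<and> lam\<^sup>2 / 4 \<noteq> 0"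
      by (rule eventually_mono[OF eventually_at_right_less]) simp
    show "((\<lambda>lam::real. lam\<^sup>2 / 4) \<longlongrightarrow> 0) (at_right 0)"
      by (auto intro!: tendsto_eq_intros)
  qed
  ultimately have "\<forall>\<^sub>F lam in at_right 0. \<forall>w\<in>W. close_word (cos (\<eta>/2)) e (lam\<^sup>2 / 4) w"
    by (rule eventually_compose_filterlim)
  moreover have "\<forall>\<^sub>F lam::real in at_right 0. 0 < lam \<and> lam < 1/2"
    by (rule eventually_at_rightI[of 0 "1/2"]) auto
  ultimately show ?thesis
  proof eventually_elim
    case (elim lam)
    hence close: "\<And>w. w \<in> W \<Longrightarrow> close_word (cos (\<eta>/2)) e (lam\<^sup>2 / 4) w"
      and lam: "0 \<le> lam" "lam \<le> 1/2" by auto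
    define X where "X = (\<lambda>n t. trace_word (map digit [0..<n * m]) (initial_traces lam (- t)))"
    have X_Suc: "X (Suc n) = (\<lambda>t. trace_word (word n) (X n t))" for n
    proof -
      have "[0..<Suc n * m] = [0..<n * m] @ [n * m..<Suc n * m]"
        using upt_add_eq_append[of 0 "n * m" m] by (simp add: add.commute del: upt_Suc)
      thus ?thesis by (simp add: X_def word_def trace_word_append del: upt_Suc mult_Suc)
    qed
    have X_cont: "continuous_on S (X n)" for S n
      unfolding X_def initial_traces_eq
      by (intro continuous_on_trace_word continuous_intros) auto
    \<comment> \<open>The tree consists of the intervals of \<open>t = - E\<close> on which the curve of traces after \<open>n\<close> blocks is
      admissible and has Lipschitz constant \<open>\<Lambda> n\<close> in the coordinates \<open>(x, y)\<close>.\<close>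
    define good where "good = (\<lambda>n t1 t2. admissible (lam\<^sup>2 / 4) \<eta> (X n) t1 t2 \<and>
        (\<forall>t\<in>{t1..t2}. \<forall>t'\<in>{t1..t2}. dist (xy (X n t)) (xy (X n t')) \<le> \<Lambda> n * \<bar>t - t'\<bar>))"
    define Adm where "Adm = (\<lambda>n E1 E2. good n (- E2) (- E1))"
    show "ereal s \<le> hausdorff_dim (sturmian_spectrum lam \<alpha> \<omega>)"
    proof (rule hausdorff_dim_ge_of_tree[where Adm = Adm and l = l and L = L and N = N and M = M, OF s(1) l L2 LM N(1)])
      show "l n \<le> E2 - E1" if "Adm n E1 E2" for n E1 E2
      proof -
        have ad: "admissible (lam\<^sup>2 / 4) \<eta> (X n) (- E2) (- E1)"
          and lip: "\<forall>t\<in>{- E2..- E1}. \<forall>t'\<in>{- E2..- E1}. dist (xy (X n t)) (xy (X n t')) \<le> \<Lambda> n * \<bar>t - t'\<bar>"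
          using that by (auto simp: Adm_def good_def)
        have ab: "- E2 \<le> - E1" using ad by (simp add: admissible_def)
        have "sn * \<eta> \<le> dist (xy (X n (- E2))) (xy (X n (- E1)))"
          unfolding sn_def by (rule admissible_length[OF \<eta>(1,3) ad])
        also have "\<dots> \<le> \<Lambda> n * \<bar>- E2 - - E1\<bar>"
        proof -
          have "- E2 \<in> {- E2..- E1}" "- E1 \<in> {- E2..- E1}" using ab by auto
          thus ?thesis using lip by blast
        qed
        finally show ?thesis using ab \<Lambda>[of n] by (simp add: l_def field_simps)
      qed
      show "Adm 0 (-1) 1"
      proof -
        have "admissible (lam\<^sup>2 / 4) \<eta> (X 0) (-1) 1"
          using initial_admissible[OF \<eta>(1,2) lam] by (simp add: X_def trace_word_def)
        moreover have "dist (xy (X 0 t)) (xy (X 0 t')) \<le> \<Lambda> 0 * \<bar>t - t'\<bar>" for t t'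
          using dist_pair_le[of "- t / 2" "(- t - lam) / 2" "- t' / 2" "(- t' - lam) / 2"]
          by (simp add: X_def trace_word_def initial_traces_eq xy_def \<Lambda>_def abs_if field_simps split: if_splits)
        ultimately show ?thesis by (simp add: Adm_def good_def)
      qed
      show "\<exists>lo hi. (\<forall>k<N n. Adm (Suc n) (lo k) (hi k) \<and> {lo k..hi k} \<subseteq> {E1..E2}) \<and>
              (\<forall>j<N n. \<forall>k<N n. j \<noteq> k \<longrightarrow> {lo j..hi j} \<inter> {lo k..hi k} = {})"
        if adm: "Adm n E1 E2" for n E1 E2
      proof -
        have ad: "admissible (lam\<^sup>2 / 4) \<eta> (X n) (- E2) (- E1)"
          and lip: "\<And>t t'. t \<in> {- E2..- E1} \<Longrightarrow> t' \<in> {- E2..- E1} \<Longrightarrow>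
              dist (xy (X n t)) (xy (X n t')) \<le> \<Lambda> n * \<bar>t - t'\<bar>"
          using adm unfolding Adm_def good_def by blast+
        obtain p' q' r' s' where lw: "lin_word (word n) = (p', q', r', s')" by (metis prod_cases4)
        have p': "p' = pp n" by (simp add: pp_def lw)
        have big: "pi / real p' \<le> \<eta> / 4"
          using pp_ge(2,3)[of n] \<eta> unfolding p' by (simp add: field_simps)
        have balanced: "balanced K (p', q', r', s')" using bal[of n] lw by simp
        have "0 \<le> lam\<^sup>2 / 4" by simp
        moreover have "real (N n) + 1 \<le> real p' * \<eta> / pi" using N(2) p' by simp
        ultimately have "\<exists>lo hi. (\<forall>k<N n. admissible (lam\<^sup>2 / 4) \<eta> (X (Suc n)) (lo k) (hi k) \<and>
              {lo k..hi k} \<subseteq> {- E2..- E1}) \<and>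
            (\<forall>j<N n. \<forall>k<N n. j \<noteq> k \<longrightarrow> {lo j..hi j} \<inter> {lo k..hi k} = {})"
          unfolding X_Suc
          by (intro expansion_step[OF K1 \<eta>_def _ lw balanced big close[OF word] e(1-4) ad X_cont])
        then obtain lo hi where
          ch: "\<And>k. k < N n \<Longrightarrow> admissible (lam\<^sup>2 / 4) \<eta> (X (Suc n)) (lo k) (hi k)"
              "\<And>k. k < N n \<Longrightarrow> {lo k..hi k} \<subseteq> {- E2..- E1}"
              "\<And>j k. j < N n \<Longrightarrow> k < N n \<Longrightarrow> j \<noteq> k \<Longrightarrow> {lo j..hi j} \<inter> {lo k..hi k} = {}"
          by metis
        have "good (Suc n) (lo k) (hi k)" if k: "k < N n" for k
          unfolding good_def
        proof (intro conjI ballI)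
          fix t t' assume "t \<in> {lo k..hi k}" "t' \<in> {lo k..hi k}"
          hence t: "t \<in> {- E2..- E1}" "t' \<in> {- E2..- E1}" using ch(2)[OF k] by blast+
          have "dist (xy (X (Suc n) t)) (xy (X (Suc n) t')) \<le> C * real p' * dist (xy (X n t)) (xy (X n t'))"
            unfolding X_Suc C_def sn_def
            by (rule admissible_lipschitz[OF \<eta>(1,3) lw balanced close[OF word] e(5) ad t])
          also have "\<dots> \<le> L n * (\<Lambda> n * \<bar>t - t'\<bar>)"
            unfolding p' L_def using lip[OF t] C by (intro mult_left_mono) auto
          also have "\<dots> = \<Lambda> (Suc n) * \<bar>t - t'\<bar>" by (simp add: \<Lambda>_def)
          finally show "dist (xy (X (Suc n) t)) (xy (X (Suc n) t')) \<le> \<Lambda> (Suc n) * \<bar>t - t'\<bar>" .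
        qed (rule ch(1)[OF k])
        hence c1: "Adm (Suc n) (- hi k) (- lo k)" if "k < N n" for k
          using that by (simp add: Adm_def)
        have c2: "{- hi k..- lo k} \<subseteq> {E1..E2}" if "k < N n" for k
        proof
          fix x assume "x \<in> {- hi k..- lo k}"
          hence "- x \<in> {- E2..- E1}" using ch(2)[OF that] by auto
          thus "x \<in> {E1..E2}" by auto
        qed
        have c3: "{- hi j..- lo j} \<inter> {- hi k..- lo k} = {}" if "j < N n" "k < N n" "j \<noteq> k" for j k
        proof (rule ccontr)
          assume "{- hi j..- lo j} \<inter> {- hi k..- lo k} \<noteq> {}"
          then obtain x where "x \<in> {- hi j..- lo j}" "x \<in> {- hi k..- lo k}" by blast
          hence "- x \<in> {lo j..hi j} \<inter> {lo k..hi k}" by auto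
          thus False using ch(3)[OF that] by blast
        qed
        show ?thesis
          by (intro exI[of _ "\<lambda>k. - hi k"] exI[of _ "\<lambda>k. - lo k"] conjI allI impI c1 c2 c3; assumption)
      qed
      show "E \<in> sturmian_spectrum lam \<alpha> \<omega>" if E: "\<And>n. \<exists>E1 E2. Adm n E1 E2 \<and> E \<in> {E1..E2}" for E
      proof (rule bounded_traces_imp_spectrum[OF lam(1) m])
        fix j :: nat assume j: "j \<ge> 1"
        obtain E1 E2 where ad: "Adm j E1 E2" "E \<in> {E1..E2}" using E by blast
        hence "- E \<in> {- E2..- E1}" by auto
        then obtain \<sigma> \<theta>1 \<theta>2 where "X j (- E) = sheet \<sigma> (lam\<^sup>2 / 4) (cos \<theta>1, cos \<theta>2)"
          using ad(1) unfolding Adm_def good_def admissible_def by blast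
        hence "fst (X j (- E)) = cos \<theta>1" by (simp add: sheet_def)
        moreover have "j * m \<ge> 1 * 4" using j m by (intro mult_mono) auto
        then obtain k where k: "j * m = Suc k" by (cases "j * m") auto
        have "fst (X j (- E)) = mtr (block lam E (j * m)) / 2"
          unfolding X_def k trace_word_digits by (simp add: pair_traces_def)
        ultimately show "\<bar>mtr (block lam E (j * m))\<bar> \<le> 2"
          using abs_cos_le_one[of \<theta>1] by (simp add: abs_mult)
      qed
    qed
  qed
qed

end

theorem theorem1:
  fixes \<alpha> \<omega> :: real
  assumes "\<alpha> \<in> {0<..<1}" and "\<alpha> \<notin> \<rat>" and "bounded_type \<alpha>"
  shows "((\<lambda>lam. hausdorff_dim (sturmian_spectrum lam \<alpha> \<omega>)) \<longlongrightarrow> 1) (at_right 0)"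
proof -
  obtain a where a: "cfrac_expansion \<alpha> a" "finite (range a)"
    using assms(3) by (auto simp: bounded_type_def)
  interpret rotation \<alpha> a
    using assms(1,2) a(1) by unfold_locales auto
  obtain K where K: "\<And>k. a k < K"
    using a(2) unfolding finite_nat_set_iff_bounded by auto
  show ?thesis
  proof (rule order_tendstoI)
    fix y :: ereal assume "y < 1"
    hence "max y 0 < 1" by simp
    then obtain z where z: "max y 0 < z" "z < 1" by (meson dense)
    hence z0: "y < z" "0 < z" by (meson le_less_trans max.cobounded1 max.cobounded2)+
    obtain s where s: "z = ereal s" using z0(2) z(2) by (cases z) auto
    have "0 < s" "s < 1" "y < ereal s" using z0 z(2) by (auto simp: s)
    from dimension_lower_bound[OF K this(1,2), of \<omega>]
    show "\<forall>\<^sub>F lam in at_right 0. y < hausdorff_dim (sturmian_spectrum lam \<alpha> \<omega>)"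
      by eventually_elim (use \<open>y < ereal s\<close> in \<open>rule less_le_trans\<close>)
  next
    fix y :: ereal assume "1 < y"
    thus "\<forall>\<^sub>F lam in at_right 0. hausdorff_dim (sturmian_spectrum lam \<alpha> \<omega>) < y"
      by (intro always_eventually allI le_less_trans[OF hausdorff_dim_real_le_1])
  qed
qed

end
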